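(* Let $D:=\{z\in\mathbb{C}:|z|<1\}$ and let $E\subset D$ be a compact set of positive logarithmic capacity. If $B_k$, $k=1,\ldots,m$, are finite Blaschke products of the corresponding degrees $n_k$, then $$\prod_{k=1}^m\|B_k\|_E\ \le\ e^{-nC_E^D}\left\|\prod_{k=1}^m B_k\right\|_E^{\sigma_E^D(D)},$$ where $n=\sum_{k=1}^m n_k$ and $$C_E^D:=\int\inf_{z\in E}\log\left|\frac{1-\bar\zeta z}{z-\zeta}\right|\,d\mu_E^D(\zeta)-V_E^D\,\sigma_E^D(D).$$ Moreover, the constant $C_E^D$ cannot be replaced by a larger value independent of $m$; that is, there is no $C>C_E^D$ such that the inequality with $C$ in place of $C_E^D$ holds for all $m$ and all finite Blaschke products $B_1,\ldots,B_m$.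
   Context: A finite Blaschke product of degree $n$ is a function $B(z)=e^{i\theta}\prod_{j=1}^n\frac{z-z_j}{1-\bar z_j z}$ with $\theta\in\mathbb{R}$ and $z_1,\ldots,z_n\in D$. $\|\cdot\|_E$ is the supremum norm on $E$. $g_D(z,\zeta)=\log\left|\frac{1-\bar\zeta z}{z-\zeta}\right|$ is the Green function of $D$. $V_E^D$ denotes the minimum Green energy $\inf_\mu\iint g_D(z,\zeta)\,d\mu(z)\,d\mu(\zeta)$ over all positive unit Borel measures $\mu$ supported on $E$, and $\mu_E^D$ (the Green equilibrium measure of $E$) is the unique such measure attaining the minimum. The measure $\sigma_E^D$ is the positive Borel measure on $D$ (the Riesz measure of the superharmonic function $z\mapsto\inf_{\zeta\in E}g_D(z,\zeta)$) for which $\inf_{\zeta\in E}g_D(z,\zeta)=\int g_D(z,\zeta)\,d\sigma_E^D(\zeta)$ for all $z\in D$; its total mass $\sigma_E^D(D)$ is finite. *)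

theory Defs
  imports "HOL-Probability.Probability"
begin

definition unit_borel_measures_on :: "complex set \<Rightarrow> complex measure set" where
  "unit_borel_measures_on E = {\<mu>. sets \<mu> = sets borel \<and> prob_space \<mu> \<and> emeasure \<mu> E = 1}"


text \<open>
  The logarithmic kernel changes sign, so the logarithmic energy is the difference of the
  integrals of its positive and negative parts; \<^const>\<open>ennreal\<close> maps negative reals to \<open>0\<close>.
  If the support of \<open>\<mu>\<close> is compact, the subtrahend is finite.
\<close>

definition log_energy :: "complex measure \<Rightarrow> ereal" where
  "log_energy \<mu> =
     enn2ereal (\<integral>\<^sup>+ z. \<integral>\<^sup>+ w. (if z = w then \<infinity> else ennreal (ln (1 / cmod (z - w)))) \<partial>\<mu> \<partial>\<mu>)
   - enn2ereal (\<integral>\<^sup>+ z. \<integral>\<^sup>+ w. (if z = w then 0 else ennreal (- ln (1 / cmod (z - w)))) \<partial>\<mu> \<partial>\<mu>)"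

definition robin_constant :: "complex set \<Rightarrow> ereal" where
  "robin_constant E = (INF \<mu>\<in>unit_borel_measures_on E. log_energy \<mu>)"

text \<open>For compact sets the Robin constant is never \<open>-\<infinity>\<close>.\<close>

definition log_capacity :: "complex set \<Rightarrow> real" where
  "log_capacity E =
     (if robin_constant E = \<infinity> then 0 else exp (- real_of_ereal (robin_constant E)))"


text \<open>
  The Green function of the unit disk, with its value \<open>\<infinity>\<close> on the diagonal. On the disk the
  logarithm is positive, so the embedding into \<^typ>\<open>ennreal\<close> loses nothing there.
\<close>

definition green_disk :: "complex \<Rightarrow> complex \<Rightarrow> ennreal" where
  "green_disk z \<zeta> =
     (if z = \<zeta> then \<infinity> else ennreal (ln (cmod ((1 - cnj \<zeta> * z) / (z - \<zeta>)))))"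

definition green_energy :: "complex measure \<Rightarrow> ennreal" where
  "green_energy \<mu> = (\<integral>\<^sup>+ z. \<integral>\<^sup>+ \<zeta>. green_disk z \<zeta> \<partial>\<mu> \<partial>\<mu>)"

definition min_green_energy :: "complex set \<Rightarrow> ennreal" where
  "min_green_energy E = (INF \<mu>\<in>unit_borel_measures_on E. green_energy \<mu>)"

definition green_equilibrium_measure :: "complex set \<Rightarrow> complex measure \<Rightarrow> bool" where
  "green_equilibrium_measure E \<mu> \<longleftrightarrow>
     \<mu> \<in> unit_borel_measures_on E \<and> green_energy \<mu> = min_green_energy E"

definition inf_green :: "complex set \<Rightarrow> complex \<Rightarrow> ennreal" where
  "inf_green E z = (INF \<zeta>\<in>E. green_disk z \<zeta>)"

text \<open>
  The Riesz measure of the superharmonic function \<^term>\<open>inf_green E\<close> on the unit disk,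
  given by its representation as a Green potential. Its space is the unit disk.
\<close>

definition inf_green_riesz_measure :: "complex set \<Rightarrow> complex measure \<Rightarrow> bool" where
  "inf_green_riesz_measure E \<sigma> \<longleftrightarrow>
     sets \<sigma> = sets (restrict_space borel (ball 0 1)) \<and>
     (\<forall>z\<in>ball 0 1. inf_green E z = (\<integral>\<^sup>+ \<zeta>. green_disk z \<zeta> \<partial>\<sigma>))"

definition green_constant :: "complex set \<Rightarrow> complex measure \<Rightarrow> complex measure \<Rightarrow> real" where
  "green_constant E \<mu> \<sigma> =
     enn2real (\<integral>\<^sup>+ \<zeta>. (INF z\<in>E. green_disk z \<zeta>) \<partial>\<mu>)
   - enn2real (min_green_energy E) * measure \<sigma> (ball 0 1)"


definition finite_blaschke :: "nat \<Rightarrow> (complex \<Rightarrow> complex) \<Rightarrow> bool" where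
  "finite_blaschke n B \<longleftrightarrow>
     (\<exists>(\<theta>::real) (a :: nat \<Rightarrow> complex). (\<forall>j\<in>{1..n}. a j \<in> ball 0 1) \<and>
        (\<forall>z\<in>ball 0 1. B z = exp (\<i> * of_real \<theta>) * (\<Prod>j=1..n. (z - a j) / (1 - cnj (a j) * z))))"

definition sup_norm_on :: "complex set \<Rightarrow> (complex \<Rightarrow> complex) \<Rightarrow> real" where
  "sup_norm_on E f = (SUP z\<in>E. cmod (f z))"

end

theory Submission imports Defs begin

text \<open>
  Write \<open>g\<close> for the Green function, \<open>V\<close> for the minimal energy, \<open>p\<close> for the Green potential of
  \<open>\<mu>\<close>, \<open>d = inf_green E\<close>, which is the Green potential of \<open>\<sigma>\<close>, and \<open>s\<close> for the mass of
  \<open>\<sigma>\<close>. By Fubini the constant is the integral of \<open>p\<close> against \<open>\<sigma>\<close> minus \<open>V * s\<close>.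

  The inequality. If a single factor has its zero at \<open>a\<close>, then its modulus at \<open>z\<close> is
  \<open>exp (- g z a)\<close>, so its norm on \<open>E\<close> is \<open>exp (- d a)\<close>. Hence the product of the norms is at most
  the exponential of minus the sum of \<open>d\<close> over all \<open>n\<close> zeros, and by the representation of \<open>d\<close>
  this sum is the integral against \<open>\<sigma>\<close> of minus the logarithm of the modulus of the whole product.
  That logarithm is bounded in the disc by its supremum on \<open>E\<close> plus \<open>n * (V - p z)\<close>
  (\<open>blaschke_bernstein_walsh\<close>), and integrating this bound gives the claim
  (\<open>sum_inf_green_ge\<close>). The bound is a maximum principle off \<open>E\<close>. It holds at every point,
  without exceptional sets, because \<open>p \<le> V\<close> on the whole disc
  (\<open>green_equilibrium_potential_le\<close>): this follows from the variational inequality for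
  \<open>\<mu>\<close> and the maximum principle for potentials. Finiteness of \<open>s\<close> comes from comparing the
  means of \<open>d\<close> over large circles with those of one Green function (\<open>riesz_measure_finite\<close>).

  Harmonicity enters only through sums over \<open>2 ^ m\<close>-th roots of unity, which collapse by a product
  formula (\<open>green_real_mean_error\<close>). Near the diagonal, limits of potentials are handled by
  Fatou's lemma, since the kernel is continuous into the extended half-line
  (\<open>tendsto_green_disk\<close>).

  Sharpness. Suppose the inequality holds with \<open>C\<close>. Single Blaschke factors turn it into an
  inequality for finite sets of points, and discretisation into one for measures: if \<open>\<nu>\<close> is
  a probability measure on \<open>E\<close> with potential at least \<open>T\<close> on \<open>E\<close>, then \<open>C + T * s\<close> is at most the
  integral of \<open>d\<close> against \<open>\<nu>\<close> (\<open>points_to_measure_inequality\<close>). For \<open>\<nu> = \<mu>\<close> and \<open>T = V\<close>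
  this would be exactly \<open>C \<le> green_constant E \<mu> \<sigma>\<close>, but \<open>p\<close> may fall below \<open>V\<close> on part of
  \<open>E\<close>. For \<open>u < V\<close> the set where \<open>p \<le> u\<close> carries no measure of finite energy, and so it
  carries probability measures with arbitrarily large potential on it
  (\<open>ex_measure_large_potential\<close>). Mixing a little of such a measure into \<open>\<mu>\<close> gives
  \<open>T\<close> as close to \<open>V\<close> as desired at negligible cost (\<open>green_constant_sharp\<close>).
\<close>

section \<open>The Green kernel and the pseudo-hyperbolic distance\<close>

definition pseudo_dist :: "complex \<Rightarrow> complex \<Rightarrow> real" where
  "pseudo_dist z w = cmod ((z - w) / (1 - cnj w * z))"

text \<open>
  Off the diagonal this is the Green function as a real number; on the diagonal it is \<open>0\<close> instead of
  \<open>\<infinity>\<close>, by the value of the logarithm at \<open>0\<close>.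
\<close>

definition green_real :: "complex \<Rightarrow> complex \<Rightarrow> real" where
  "green_real z w = - ln (pseudo_dist z w)"

lemma cmod_one_minus_cnj_mult:
  assumes "cmod z < 1" "cmod w < 1"
  shows "1 - cmod z \<le> cmod (1 - cnj w * z)" "cmod (1 - cnj w * z) \<le> 2" "0 < cmod (1 - cnj w * z)"
proof -
  have le: "cmod (cnj w * z) \<le> cmod z"
    using assms by (simp add: norm_mult mult_left_le_one_le)
  have "1 - cmod (cnj w * z) \<le> cmod (1 - cnj w * z)"
    by (metis norm_one norm_triangle_ineq2)
  with le show 1: "1 - cmod z \<le> cmod (1 - cnj w * z)" by simp
  show "cmod (1 - cnj w * z) \<le> 2"
    using norm_triangle_ineq4[of 1 "cnj w * z"] le assms by simp
  show "0 < cmod (1 - cnj w * z)" using 1 assms by linarith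
qed

lemma pseudo_dist_nonneg [simp]: "0 \<le> pseudo_dist z w"
  by (simp add: pseudo_dist_def)

lemma pseudo_dist_eq_0_iff:
  "cmod z < 1 \<Longrightarrow> cmod w < 1 \<Longrightarrow> pseudo_dist z w = 0 \<longleftrightarrow> z = w"
  using cmod_one_minus_cnj_mult(3)[of z w] by (auto simp: pseudo_dist_def)

lemma pseudo_dist_commute: "pseudo_dist z w = pseudo_dist w z"
proof -
  have "cmod (1 - cnj w * z) = cmod (cnj (1 - cnj w * z))"
    by (metis complex_mod_cnj)
  also have "\<dots> = cmod (1 - cnj z * w)" by (simp add: mult.commute)
  finally show ?thesis by (simp add: pseudo_dist_def norm_divide norm_minus_commute)
qed

lemma one_minus_pseudo_dist_sq:
  assumes "cmod z < 1" "cmod w < 1"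
  shows "1 - (pseudo_dist z w)\<^sup>2 = (1 - (cmod z)\<^sup>2) * (1 - (cmod w)\<^sup>2) / (cmod (1 - cnj w * z))\<^sup>2"
proof -
  have "(cmod (1 - cnj w * z))\<^sup>2 - (cmod (z - w))\<^sup>2 = (1 - (cmod z)\<^sup>2) * (1 - (cmod w)\<^sup>2)"
    unfolding cmod_power2 by (simp add: algebra_simps power2_eq_square)
  then show ?thesis
    using cmod_one_minus_cnj_mult(3)[OF assms]
    by (simp add: pseudo_dist_def norm_divide power_divide divide_simps)
qed

lemma pseudo_dist_less_1:
  assumes "cmod z < 1" "cmod w < 1"
  shows "pseudo_dist z w < 1"
proof -
  have "0 < (1 - (cmod z)\<^sup>2) * (1 - (cmod w)\<^sup>2) / (cmod (1 - cnj w * z))\<^sup>2"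
    using assms cmod_one_minus_cnj_mult(3)[OF assms]
    by (intro divide_pos_pos mult_pos_pos) (auto simp: power_less_one_iff abs_square_less_1)
  then have "(pseudo_dist z w)\<^sup>2 < 1"
    using one_minus_pseudo_dist_sq[OF assms] by simp
  then show ?thesis by (simp add: power_less_one_iff abs_square_less_1)
qed

lemma green_real_nonneg:
  assumes "cmod z < 1" "cmod w < 1" shows "0 \<le> green_real z w"
proof -
  have "ln (pseudo_dist z w) \<le> 0"
    using pseudo_dist_less_1[OF assms] pseudo_dist_nonneg[of z w]
    by (cases "pseudo_dist z w = 0") (simp, metis le_less ln_le_zero_iff order_le_less)
  then show ?thesis by (simp add: green_real_def)
qed

lemma green_real_commute: "green_real z w = green_real w z"
  by (simp add: green_real_def pseudo_dist_commute)

lemma green_real_diff: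
  assumes "cmod z < 1" "cmod w < 1" "z \<noteq> w"
  shows "green_real z w = ln (cmod (1 - cnj w * z)) - ln (cmod (z - w))"
  using assms cmod_one_minus_cnj_mult(3)[OF assms(1,2)]
  by (simp add: green_real_def pseudo_dist_def norm_divide ln_div)

lemma green_disk_eq:
  assumes "cmod z < 1" "cmod w < 1"
  shows "green_disk z w = (if z = w then \<infinity> else ennreal (green_real z w))"
proof -
  have "ln (cmod ((1 - cnj w * z) / (z - w))) = green_real z w" if "z \<noteq> w"
    using that cmod_one_minus_cnj_mult(3)[OF assms] assms
    by (simp add: green_real_diff norm_divide ln_div)
  then show ?thesis by (simp add: green_disk_def)
qed

lemma green_disk_commute:
  "cmod z < 1 \<Longrightarrow> cmod w < 1 \<Longrightarrow> green_disk z w = green_disk w z"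
  by (auto simp: green_disk_eq green_real_commute)

lemma green_real_le:
  assumes "cmod z < 1" "cmod w < 1" "z \<noteq> w" "r \<le> cmod (z - w)" "0 < r"
  shows "green_real z w \<le> ln (2 / r)"
proof -
  have "ln (cmod (1 - cnj w * z)) \<le> ln 2"
    using cmod_one_minus_cnj_mult[OF assms(1,2)] by simp
  moreover have "ln r \<le> ln (cmod (z - w))" using assms by (subst ln_le_cancel_iff) auto
  moreover have "green_real z w = ln (cmod (1 - cnj w * z)) - ln (cmod (z - w))"
    using assms by (simp add: green_real_diff)
  moreover have "ln (2 / r) = ln 2 - ln r" using assms by (simp add: ln_div)
  ultimately show ?thesis by linarith
qed

lemma green_disk_le:
  assumes "cmod z < 1" "cmod w < 1" "r \<le> cmod (z - w)" "0 < r"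
  shows "green_disk z w \<le> ennreal (ln (2 / r))"
proof -
  have "z \<noteq> w" using assms by auto
  with green_real_le[of z w r] assms show ?thesis by (simp add: green_disk_eq ennreal_leI)
qed

lemma sum_green_disk_eq:
  assumes "cmod z < 1" "a ` J \<subseteq> ball 0 1" "z \<notin> a ` J"
  shows "(\<Sum>i\<in>J. green_disk z (a i)) = ennreal (\<Sum>i\<in>J. green_real z (a i))"
proof -
  have "(\<Sum>i\<in>J. green_disk z (a i)) = (\<Sum>i\<in>J. ennreal (green_real z (a i)))"
    using assms by (intro sum.cong refl) (subst green_disk_eq, auto)
  also have "\<dots> = ennreal (\<Sum>i\<in>J. green_real z (a i))"
    using assms by (intro sum_ennreal green_real_nonneg) auto
  finally show ?thesis .
qed

lemma sum_green_disk_pole: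
  "finite J \<Longrightarrow> z \<in> a ` J \<Longrightarrow> (\<Sum>i\<in>J. green_disk z (a i)) = \<infinity>"
  by (auto simp: ennreal_sum_eq_top green_disk_def)

lemma green_disk_measurable [measurable]:
  "(\<lambda>x. green_disk (fst x) (snd x)) \<in> borel_measurable (borel \<Otimes>\<^sub>M borel)"
proof -
  have [measurable]: "{x::complex \<times> complex. fst x = snd x} \<in> sets (borel \<Otimes>\<^sub>M borel)"
    unfolding borel_prod by (intro borel_closed closed_Collect_eq continuous_intros)
  have [measurable]: "Measurable.pred (borel \<Otimes>\<^sub>M borel) (\<lambda>x::complex\<times>complex. fst x = snd x)"
    by (simp add: pred_def space_pair_measure)
  have [measurable]: "(cnj :: complex \<Rightarrow> complex) \<in> borel_measurable borel"
    by (intro borel_measurable_continuous_onI continuous_intros)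
  show ?thesis unfolding green_disk_def by measurable
qed

lemma green_disk_measurable' [measurable (raw)]:
  assumes [measurable]: "f \<in> borel_measurable M" "g \<in> borel_measurable M"
  shows "(\<lambda>x. green_disk (f x) (g x)) \<in> borel_measurable M"
  using measurable_compose[OF measurable_Pair[OF assms] green_disk_measurable] by simp

text \<open>
  As a map into the extended half-line the kernel is continuous on the whole bidisc, the diagonal
  included, so that Fatou's lemma applies to integrals of the kernel at moving points.
\<close>

lemma tendsto_green_disk:
  assumes f: "(f \<longlongrightarrow> z) F" and g: "(g \<longlongrightarrow> w) F" and z: "cmod z < 1" and w: "cmod w < 1"
  shows "((\<lambda>x. green_disk (f x) (g x)) \<longlongrightarrow> green_disk z w) F"
proof -
  have ne: "1 - cnj w * z \<noteq> 0" using cmod_one_minus_cnj_mult(3)[OF z w] by auto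
  have ph: "((\<lambda>x. pseudo_dist (f x) (g x)) \<longlongrightarrow> pseudo_dist z w) F"
    unfolding pseudo_dist_def using ne by (intro tendsto_intros f g) auto
  have "((\<lambda>x. cmod (f x)) \<longlongrightarrow> cmod z) F" "((\<lambda>x. cmod (g x)) \<longlongrightarrow> cmod w) F"
    by (intro tendsto_intros f g)+
  then have ev: "\<forall>\<^sub>F x in F. cmod (f x) < 1 \<and> cmod (g x) < 1"
    using z w by (simp add: order_tendstoD(2) eventually_conj)
  show ?thesis
  proof (cases "z = w")
    case False
    then have pos: "pseudo_dist z w > 0"
      using pseudo_dist_eq_0_iff[OF z w] pseudo_dist_nonneg[of z w] by linarith
    have "((\<lambda>x. green_real (f x) (g x)) \<longlongrightarrow> green_real z w) F"
      unfolding green_real_def using pos by (intro tendsto_intros ph) auto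
    then have lim: "((\<lambda>x. ennreal (green_real (f x) (g x))) \<longlongrightarrow> ennreal (green_real z w)) F"
      by simp
    have "\<forall>\<^sub>F x in F. pseudo_dist (f x) (g x) > 0"
      using ph pos by (simp add: order_tendstoD(1))
    then have "\<forall>\<^sub>F x in F. ennreal (green_real (f x) (g x)) = green_disk (f x) (g x)"
      using ev
    proof eventually_elim
      case (elim x)
      then have "f x \<noteq> g x" by (auto simp: pseudo_dist_def)
      with elim show ?case by (simp add: green_disk_eq)
    qed
    from Lim_transform_eventually[OF lim this] show ?thesis
      using False by (simp add: green_disk_eq z w)
  next
    case True
    have ph0: "((\<lambda>x. pseudo_dist (f x) (g x)) \<longlongrightarrow> 0) F"
      using ph True by (simp add: pseudo_dist_def)
    have "((\<lambda>x. green_disk (f x) (g x)) \<longlongrightarrow> \<infinity>) F"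
      unfolding infinity_ennreal_def
    proof (rule order_tendstoI)
      fix a :: ennreal assume a: "a < top"
      have "\<forall>\<^sub>F x in F. pseudo_dist (f x) (g x) < exp (- enn2real a)"
        using ph0 by (simp add: order_tendstoD(2))
      then show "\<forall>\<^sub>F x in F. a < green_disk (f x) (g x)"
        using ev
      proof eventually_elim
        case (elim x)
        show ?case
        proof (cases "f x = g x")
          case False
          then have "0 < pseudo_dist (f x) (g x)"
            using elim pseudo_dist_eq_0_iff[of "f x" "g x"] by (simp add: less_le)
          then have "ln (pseudo_dist (f x) (g x)) < - enn2real a"
            using elim by (metis exp_gt_zero ln_exp ln_less_cancel_iff)
          then have "enn2real a < green_real (f x) (g x)"
            by (simp add: green_real_def)
          then have "ennreal (enn2real a) < ennreal (green_real (f x) (g x))"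
            by (meson enn2real_nonneg ennreal_lessI le_less_trans)
          then show ?thesis using a False elim by (simp add: green_disk_eq)
        qed (use a elim in \<open>simp add: green_disk_eq\<close>)
      qed
    qed simp
    then show ?thesis using True by (simp add: green_disk_eq w)
  qed
qed

text \<open>
  The Green function vanishes at the unit circle, uniformly for poles in a compact subdisc.
\<close>

lemma green_real_boundary_le:
  assumes "cmod z < 1" "cmod w \<le> \<rho>" "\<rho> < 1" "1 - (cmod z)\<^sup>2 \<le> (1 - exp (- 2 * e)) * (1 - \<rho>)\<^sup>2" "z \<noteq> w"
  shows "green_real z w \<le> e"
proof -
  have w: "cmod w < 1" using assms by simp
  have "1 - \<rho> \<le> cmod (1 - cnj w * z)"
  proof -
    have "1 - cmod w \<le> cmod (1 - cnj z * w)"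
      using cmod_one_minus_cnj_mult(1)[OF w assms(1)] .
    also have "\<dots> = cmod (cnj (1 - cnj w * z))" by (simp add: mult.commute)
    also have "\<dots> = cmod (1 - cnj w * z)" by (rule complex_mod_cnj)
    finally show ?thesis using assms by simp
  qed
  then have sq: "(1 - \<rho>)\<^sup>2 \<le> (cmod (1 - cnj w * z))\<^sup>2"
    using assms by (intro power_mono) auto
  have "(1 - (cmod z)\<^sup>2) * (1 - (cmod w)\<^sup>2) \<le> (1 - (cmod z)\<^sup>2) * 1"
    using assms w by (intro mult_left_mono) (auto simp: abs_square_le_1 power_le_one)
  also have "\<dots> \<le> (1 - exp (- 2 * e)) * (1 - \<rho>)\<^sup>2" using assms by simp
  finally have *: "(1 - (cmod z)\<^sup>2) * (1 - (cmod w)\<^sup>2) \<le> (1 - exp (- 2 * e)) * (1 - \<rho>)\<^sup>2" .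
  have pos: "0 < (1 - \<rho>)\<^sup>2" using assms by simp
  have num: "0 \<le> (1 - (cmod z)\<^sup>2) * (1 - (cmod w)\<^sup>2)"
    using assms w by (intro mult_nonneg_nonneg) (auto simp: power_le_one)
  have "1 - (pseudo_dist z w)\<^sup>2 \<le> (1 - (cmod z)\<^sup>2) * (1 - (cmod w)\<^sup>2) / (1 - \<rho>)\<^sup>2"
    unfolding one_minus_pseudo_dist_sq[OF assms(1) w]
    using sq pos num cmod_one_minus_cnj_mult(3)[OF assms(1) w] by (intro divide_left_mono) auto
  also have "\<dots> \<le> 1 - exp (- 2 * e)"
    using * pos by (simp add: pos_divide_le_eq)
  finally have 1: "exp (- 2 * e) \<le> (pseudo_dist z w)\<^sup>2" by simp
  have "0 < pseudo_dist z w"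
    using assms w pseudo_dist_eq_0_iff[of z w] pseudo_dist_nonneg[of z w] by linarith
  then have "ln (exp (- 2 * e)) \<le> ln ((pseudo_dist z w)\<^sup>2)"
    using 1 by (subst ln_le_cancel_iff) auto
  then show ?thesis using \<open>0 < pseudo_dist z w\<close>
    by (simp add: green_real_def ln_realpow)
qed

section \<open>Means over roots of unity\<close>

text \<open>
  Only roots of unity of order \<open>2 ^ m\<close> are used, because then the product formula for
  \<open>x ^ n - y ^ n\<close> follows by doubling from \<open>(x - y) * (x + y) = x\<^sup>2 - y\<^sup>2\<close>.
\<close>

definition dyadic_root :: "nat \<Rightarrow> nat \<Rightarrow> complex" where
  "dyadic_root m j = cis (2 * pi * real j / 2 ^ m)"

lemma cmod_dyadic_root [simp]: "cmod (dyadic_root m j) = 1"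
  by (simp add: dyadic_root_def)

lemma dyadic_root_Suc_square: "(dyadic_root (Suc m) j)\<^sup>2 = dyadic_root m j"
  by (simp add: dyadic_root_def Complex.DeMoivre field_simps)

lemma dyadic_root_Suc_add: "dyadic_root (Suc m) (2 ^ m + j) = - dyadic_root (Suc m) j"
proof -
  have "2 * pi * real (2 ^ m + j) / 2 ^ Suc m = pi + 2 * pi * real j / 2 ^ Suc m"
    by (simp add: field_simps)
  then have "dyadic_root (Suc m) (2 ^ m + j) = cis pi * cis (2 * pi * real j / 2 ^ Suc m)"
    unfolding dyadic_root_def by (simp only: cis_mult)
  then show ?thesis by (simp add: dyadic_root_def)
qed

lemma lessThan_split_double: "{..<2 ^ Suc m} = {..<2 ^ m} \<union> (+) (2 ^ m) ` {..<2 ^ m :: nat}"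
proof -
  have "{..<2 ^ Suc m} = {0..<2 ^ m} \<union> {2 ^ m..<2 ^ m + 2 ^ m :: nat}" by auto
  moreover have "{2 ^ m..<2 ^ m + 2 ^ m :: nat} = (+) (2 ^ m) ` {0..<2 ^ m}"
    by (simp add: image_add_atLeastLessThan)
  ultimately show ?thesis by (simp add: atLeast0LessThan)
qed

lemma prod_dyadic_root: "(\<Prod>j<2 ^ m. x - dyadic_root m j * y) = x ^ 2 ^ m - y ^ 2 ^ m"
proof (induction m arbitrary: x y)
  case 0
  then show ?case by (simp add: dyadic_root_def)
next
  case (Suc m)
  let ?c = "dyadic_root (Suc m)"
  have "(\<Prod>j<2 ^ Suc m. x - ?c j * y)
      = (\<Prod>j<2 ^ m. x - ?c j * y) * (\<Prod>j<2 ^ m. x - ?c (2 ^ m + j) * y)"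
    unfolding lessThan_split_double by (subst prod.union_disjoint) (auto simp: prod.reindex)
  also have "\<dots> = (\<Prod>j<2 ^ m. (x - ?c j * y) * (x + ?c j * y))"
    by (simp add: dyadic_root_Suc_add prod.distrib)
  also have "\<dots> = (\<Prod>j<2 ^ m. x\<^sup>2 - dyadic_root m j * y\<^sup>2)"
    by (intro prod.cong refl, subst dyadic_root_Suc_square[symmetric])
      (simp add: power2_eq_square algebra_simps)
  also have "\<dots> = (x\<^sup>2) ^ 2 ^ m - (y\<^sup>2) ^ 2 ^ m" by (rule Suc.IH)
  finally show ?case by (simp add: power_mult)
qed

lemma sum_norm_sq_dyadic_root:
  assumes "1 \<le> m"
  shows "(\<Sum>j<2 ^ m. (cmod (x + dyadic_root m j * of_real r))\<^sup>2) = 2 ^ m * ((cmod x)\<^sup>2 + r\<^sup>2)"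
proof -
  obtain k where m: "m = Suc k" using assms by (cases m) auto
  let ?f = "\<lambda>c. (cmod (x + c * of_real r))\<^sup>2"
  have par: "?f c + ?f (- c) = 2 * ((cmod x)\<^sup>2 + r\<^sup>2)" if "cmod c = 1" for c
  proof -
    have "?f c + ?f (- c) = 2 * ((cmod x)\<^sup>2 + (cmod c)\<^sup>2 * r\<^sup>2)"
      unfolding cmod_power2 by (simp add: power2_eq_square algebra_simps)
    then show ?thesis using that by simp
  qed
  have "(\<Sum>j<2 ^ m. ?f (dyadic_root m j))
      = (\<Sum>j<2 ^ k. ?f (dyadic_root m j)) + (\<Sum>j<2 ^ k. ?f (dyadic_root m (2 ^ k + j)))"
    unfolding m lessThan_split_double by (subst sum.union_disjoint) (auto simp: sum.reindex)
  also have "\<dots> = (\<Sum>j<2 ^ k. ?f (dyadic_root m j) + ?f (- dyadic_root m j))"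
    unfolding m dyadic_root_Suc_add by (simp only: sum.distrib)
  also have "\<dots> = (\<Sum>j<(2::nat) ^ k. 2 * ((cmod x)\<^sup>2 + r\<^sup>2))"
    by (intro sum.cong refl par) simp
  finally show ?thesis by (simp add: m)
qed

lemma sum_ln_cmod_dyadic_root:
  assumes "\<And>j. x + dyadic_root m j * y \<noteq> 0"
  shows "(\<Sum>j<2 ^ m. ln (cmod (x + dyadic_root m j * y))) = ln (cmod (x ^ 2 ^ m - (- y) ^ 2 ^ m))"
proof -
  have "(\<Sum>j<2 ^ m. ln (cmod (x + dyadic_root m j * y)))
      = ln (\<Prod>j<2 ^ m. cmod (x - dyadic_root m j * (- y)))"
    using assms by (subst ln_prod) (auto simp: less_le)
  also have "(\<Prod>j<2 ^ m. cmod (x - dyadic_root m j * (- y))) = cmod (x ^ 2 ^ m - (- y) ^ 2 ^ m)"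
    by (subst prod_dyadic_root[symmetric]) (rule prod_norm)
  finally show ?thesis .
qed

text \<open>
  By the product formula the sum of logarithms is the logarithm of a single modulus, which differs
  from \<open>cmod x ^ 2 ^ m\<close> by a factor between \<open>1 / 2\<close> and \<open>2\<close>.
\<close>

lemma ln_cmod_mean_error:
  assumes "x \<noteq> 0" "2 * cmod y \<le> cmod x"
  shows "\<bar>(\<Sum>j<2 ^ m. ln (cmod (x + dyadic_root m j * y))) - 2 ^ m * ln (cmod x)\<bar> \<le> ln 2"
proof -
  have pos: "0 < cmod x" using assms by simp
  have "x + dyadic_root m j * y \<noteq> 0" for j
  proof
    assume "x + dyadic_root m j * y = 0"
    then have "cmod x = cmod (dyadic_root m j * y)" by (metis add_eq_0_iff norm_minus_cancel)
    then show False using assms pos by (simp add: norm_mult)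
  qed
  note S = sum_ln_cmod_dyadic_root[OF this]
  define u where "u = (- y / x) ^ 2 ^ m"
  have "x ^ 2 ^ m - (- y) ^ 2 ^ m = x ^ 2 ^ m * (1 - u)"
    using assms unfolding u_def power_divide right_diff_distrib by simp
  then have eq: "cmod (x ^ 2 ^ m - (- y) ^ 2 ^ m) = cmod x ^ 2 ^ m * cmod (1 - u)"
    by (simp add: norm_mult norm_power)
  have "cmod (- y / x) \<le> 1 / 2"
    using assms pos by (simp add: norm_divide pos_divide_le_eq)
  then have "cmod u \<le> (1 / 2) ^ 2 ^ m"
    unfolding u_def norm_power by (intro power_mono) auto
  also have "\<dots> \<le> (1 / 2) ^ 1" by (intro power_decreasing) auto
  finally have u: "cmod u \<le> 1 / 2" by simp
  have l: "1 / 2 \<le> cmod (1 - u)" using u norm_triangle_ineq2[of 1 u] by simp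
  have h: "cmod (1 - u) \<le> 2" using u norm_triangle_ineq4[of 1 u] by simp
  have "ln (1 / 2) \<le> ln (cmod (1 - u))" using l by (subst ln_le_cancel_iff) auto
  moreover have "ln (cmod (1 - u)) \<le> ln 2" using l h by (subst ln_le_cancel_iff) auto
  ultimately have "\<bar>ln (cmod (1 - u))\<bar> \<le> ln 2" by (simp add: ln_div)
  moreover have "ln (cmod x ^ 2 ^ m * cmod (1 - u)) = 2 ^ m * ln (cmod x) + ln (cmod (1 - u))"
    using pos l by (subst ln_mult_pos) (auto simp: ln_realpow)
  ultimately show ?thesis unfolding S eq by simp
qed

text \<open>
  The mean value property of the Green function, in a discrete form: the error of the sum over
  \<open>2 ^ m\<close> equidistributed points of a circle stays bounded, so that the error of the mean
  tends to zero, uniformly in the pole.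
\<close>

lemma green_real_mean_error:
  assumes z: "cmod z < 1" and w: "cmod w < 1" and "z \<noteq> w"
    and r: "0 < r" "2 * r \<le> cmod (z - w)" "2 * r \<le> 1 - cmod z"
  shows "\<bar>(\<Sum>j<2 ^ m. green_real (z + dyadic_root m j * of_real r) w) - 2 ^ m * green_real z w\<bar> \<le> 2 * ln 2"
proof -
  let ?z = "\<lambda>j. z + dyadic_root m j * of_real r"
  have in_disk: "cmod (?z j) < 1" for j
    using norm_triangle_ineq[of z "dyadic_root m j * of_real r"] r by (simp add: norm_mult)
  have ne: "?z j \<noteq> w" for j
  proof
    assume "?z j = w"
    then have "cmod (z - w) = cmod (dyadic_root m j * of_real r)"
      by (metis add_diff_cancel_left' norm_minus_commute)
    then show False using r by (simp add: norm_mult)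
  qed
  let ?A = "\<lambda>j. ln (cmod ((1 - cnj w * z) + dyadic_root m j * (- cnj w * of_real r)))"
  let ?B = "\<lambda>j. ln (cmod ((z - w) + dyadic_root m j * of_real r))"
  have g: "green_real (?z j) w = ?A j - ?B j" for j
    using in_disk ne w by (simp add: green_real_diff algebra_simps)
  have "cmod (cnj w * of_real r) \<le> r" using w r by (simp add: norm_mult mult_left_le_one_le)
  then have "2 * cmod (- cnj w * of_real r) \<le> cmod (1 - cnj w * z)"
    using cmod_one_minus_cnj_mult(1)[OF z w] r by simp
  then have A: "\<bar>(\<Sum>j<2 ^ m. ?A j) - 2 ^ m * ln (cmod (1 - cnj w * z))\<bar> \<le> ln 2"
    using cmod_one_minus_cnj_mult(3)[OF z w] by (intro ln_cmod_mean_error) auto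
  have B: "\<bar>(\<Sum>j<2 ^ m. ?B j) - 2 ^ m * ln (cmod (z - w))\<bar> \<le> ln 2"
    using assms by (intro ln_cmod_mean_error) auto
  have "(\<Sum>j<2 ^ m. green_real (?z j) w) - 2 ^ m * green_real z w
      = ((\<Sum>j<2 ^ m. ?A j) - 2 ^ m * ln (cmod (1 - cnj w * z)))
        - ((\<Sum>j<2 ^ m. ?B j) - 2 ^ m * ln (cmod (z - w)))"
    unfolding g by (simp add: sum_subtractf green_real_diff z w \<open>z \<noteq> w\<close> algebra_simps)
  then show ?thesis using A B by linarith
qed

section \<open>A maximum principle\<close>

text \<open>
  The hypothesis \<open>mean\<close> is the sub-mean value inequality, up to an error that
  vanishes with the mesh. Adding a small multiple of \<^term>\<open>\<lambda>z. (cmod z)\<^sup>2\<close>, whose means exceed its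
  value by exactly \<open>r\<^sup>2\<close>, beats the error, so that the perturbed function has no
  maximum in the interior.
\<close>

lemma maximum_principle:
  fixes h :: "complex \<Rightarrow> real"
  assumes U: "U \<subseteq> ball 0 1"
    and cont: "continuous_on U h"
    and mean: "\<And>z. z \<in> U \<Longrightarrow> \<exists>r>0. \<exists>K. \<forall>m. (\<forall>j. z + dyadic_root m j * of_real r \<in> U) \<and>
        2 ^ m * h z \<le> (\<Sum>j<2 ^ m. h (z + dyadic_root m j * of_real r)) + K"
    and bdry: "\<And>f \<zeta> c'. (\<And>k. f k \<in> U) \<Longrightarrow> f \<longlonglongrightarrow> \<zeta> \<Longrightarrow> \<zeta> \<in> cball 0 1 - U \<Longrightarrow> c < c' \<Longrightarrow>
        (\<And>k::nat. c' \<le> h (f k)) \<Longrightarrow> False"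
    and z1: "z1 \<in> U"
  shows "h z1 \<le> c"
proof (rule ccontr)
  assume "\<not> h z1 \<le> c"
  then have lt: "c < h z1" by simp
  define \<epsilon> where "\<epsilon> = (h z1 - c) / 2"
  have \<epsilon>: "0 < \<epsilon>" using lt by (simp add: \<epsilon>_def)
  define f where "f z = h z + \<epsilon> * (cmod z)\<^sup>2" for z
  define K where "K = {z \<in> U. h z1 - \<epsilon> \<le> h z}"
  have "closed K"
    unfolding closed_sequential_limits
  proof (intro allI impI)
    fix x l assume xl: "(\<forall>n. x n \<in> K) \<and> x \<longlonglongrightarrow> l"
    then have xU: "x n \<in> U" and xh: "h z1 - \<epsilon> \<le> h (x n)" for n by (auto simp: K_def)
    have "l \<in> cball 0 1"
      using xU U xl by (intro closed_sequentially[of "cball (0::complex) 1" x l]) (auto simp: less_imp_le subset_eq)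
    moreover have "c < h z1 - \<epsilon>" using lt by (simp add: \<epsilon>_def field_simps)
    ultimately have lU: "l \<in> U" using bdry[of x l "h z1 - \<epsilon>"] xU xh xl by blast
    have "(\<lambda>n. h (x n)) \<longlonglongrightarrow> h l"
      using continuous_on_tendsto_compose[OF cont _ lU, of x] xl xU by auto
    then have "h z1 - \<epsilon> \<le> h l" using xh by (intro LIMSEQ_le_const) auto
    with lU show "l \<in> K" by (simp add: K_def)
  qed
  moreover have "bounded K"
    using U by (intro bounded_subset[OF bounded_ball, of K 0 1]) (auto simp: K_def)
  ultimately have "compact K" by (simp add: compact_eq_bounded_closed)
  moreover have "z1 \<in> K" using z1 \<epsilon> by (simp add: K_def)
  moreover have "continuous_on K f"
    unfolding f_def by (intro continuous_intros continuous_on_subset[OF cont]) (auto simp: K_def)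
  ultimately obtain z where zK: "z \<in> K" and zmax: "\<And>y. y \<in> K \<Longrightarrow> f y \<le> f z"
    using continuous_attains_sup[of K f] by auto
  have max: "f y \<le> f z" if "y \<in> U" for y
  proof (cases "y \<in> K")
    case False
    then have "h y < h z1 - \<epsilon>" using that by (simp add: K_def)
    moreover have "\<epsilon> * (cmod y)\<^sup>2 \<le> \<epsilon> * 1"
      using that U \<epsilon> by (intro mult_left_mono) (auto intro!: power_le_one)
    ultimately have "f y \<le> h z1" unfolding f_def by linarith
    also have "h z1 \<le> f z1" using \<epsilon> by (simp add: f_def)
    finally show ?thesis using zmax[OF \<open>z1 \<in> K\<close>] by simp
  qed (use zmax in auto)
  obtain r C where r: "0 < r" and
    rU: "\<And>m j. z + dyadic_root m j * of_real r \<in> U" and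
    rC: "\<And>m. 2 ^ m * h z \<le> (\<Sum>j<2 ^ m. h (z + dyadic_root m j * of_real r)) + C"
    using mean[of z] zK unfolding K_def by blast
  obtain m0 where m0: "C / (\<epsilon> * r\<^sup>2) < 2 ^ m0"
    using real_arch_pow[of 2] by auto
  define m where "m = Suc m0"
  have "C / (\<epsilon> * r\<^sup>2) < 2 ^ m"
    using m0 by (rule less_le_trans) (simp add: m_def)
  then have big: "C < 2 ^ m * (\<epsilon> * r\<^sup>2)"
    using \<epsilon> r by (simp add: pos_divide_less_eq)
  have "(\<Sum>j<2 ^ m. f (z + dyadic_root m j * of_real r))
      = (\<Sum>j<2 ^ m. h (z + dyadic_root m j * of_real r)) + \<epsilon> * (2 ^ m * ((cmod z)\<^sup>2 + r\<^sup>2))"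
    unfolding f_def using sum_norm_sq_dyadic_root[of m z r]
    by (simp add: sum.distrib m_def flip: sum_distrib_left)
  also have "\<dots> \<ge> 2 ^ m * h z - C + \<epsilon> * (2 ^ m * ((cmod z)\<^sup>2 + r\<^sup>2))"
    using rC[of m] by simp
  finally have "2 ^ m * f z < (\<Sum>j<2 ^ m. f (z + dyadic_root m j * of_real r))"
    using big by (simp add: f_def algebra_simps)
  also have "\<dots> \<le> (\<Sum>j<(2::nat) ^ m. f z)" by (intro sum_mono max rU)
  finally show False by simp
qed

section \<open>Green potentials and energies\<close>

definition green_potential :: "complex measure \<Rightarrow> complex \<Rightarrow> ennreal" where
  "green_potential \<mu> z = (\<integral>\<^sup>+ w. green_disk z w \<partial>\<mu>)"

lemma green_energy_eq: "green_energy \<mu> = (\<integral>\<^sup>+ z. green_potential \<mu> z \<partial>\<mu>)"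
  by (simp add: green_energy_def green_potential_def)

lemma unit_borel_measures_onD:
  assumes "\<mu> \<in> unit_borel_measures_on E"
  shows "sets \<mu> = sets borel" "prob_space \<mu>" "space \<mu> = UNIV"
  using assms sets_eq_imp_space_eq[of \<mu> borel] by (auto simp: unit_borel_measures_on_def)

lemma unit_borel_measures_on_AE:
  assumes "\<mu> \<in> unit_borel_measures_on E" "E \<in> sets borel"
  shows "AE w in \<mu>. w \<in> E"
proof -
  interpret prob_space \<mu> using unit_borel_measures_onD(2)[OF assms(1)] .
  have "prob E = 1" using assms(1) by (simp add: unit_borel_measures_on_def measure_def)
  moreover have "E \<in> events" using assms unit_borel_measures_onD(1) by blast
  ultimately show ?thesis using AE_in_set_eq_1 by blast
qed

lemma unit_borel_measures_on_AE_disk: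
  assumes "\<mu> \<in> unit_borel_measures_on E" "compact E" "E \<subseteq> ball 0 1"
  shows "AE w in \<mu>. cmod w < 1"
  using unit_borel_measures_on_AE[OF assms(1) borel_compact[OF assms(2)]]
  by eventually_elim (use assms(3) in auto)

lemma unit_borel_measures_onI:
  assumes "sets \<mu> = sets borel" "prob_space \<mu>" "E \<in> sets borel" "AE w in \<mu>. w \<in> E"
  shows "\<mu> \<in> unit_borel_measures_on E"
proof -
  interpret prob_space \<mu> by fact
  have "prob E = 1" using assms AE_in_set_eq_1[of E] by simp
  then show ?thesis using assms by (simp add: unit_borel_measures_on_def emeasure_eq_measure)
qed

lemma unit_borel_measures_on_mono:
  "\<mu> \<in> unit_borel_measures_on E \<Longrightarrow> E \<subseteq> F \<Longrightarrow> E \<in> sets borel \<Longrightarrow> F \<in> sets borel \<Longrightarrow>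
    \<mu> \<in> unit_borel_measures_on F"
  using unit_borel_measures_on_AE[of \<mu> E] unit_borel_measures_onD[of \<mu> E]
  by (intro unit_borel_measures_onI) auto

lemma green_potential_measurable:
  assumes "sets \<mu> = sets borel" "sigma_finite_measure \<mu>"
  shows "green_potential \<mu> \<in> borel_measurable borel"
proof -
  interpret sigma_finite_measure \<mu> by fact
  note [measurable_cong] = assms(1)
  show ?thesis unfolding green_potential_def[abs_def]
    by (rule borel_measurable_nn_integral) measurable
qed

lemma green_potential_swap:
  assumes "sets \<mu> = sets borel" "sigma_finite_measure \<mu>"
    and "sets \<nu> = sets borel" "sigma_finite_measure \<nu>"
    and "AE w in \<mu>. cmod w < 1" "AE w in \<nu>. cmod w < 1"
  shows "(\<integral>\<^sup>+ z. green_potential \<mu> z \<partial>\<nu>) = (\<integral>\<^sup>+ z. green_potential \<nu> z \<partial>\<mu>)"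
proof -
  interpret pair_sigma_finite \<mu> \<nu>
    using assms by (simp add: pair_sigma_finite_def)
  note [measurable_cong] = assms(1,3)
  have "(\<integral>\<^sup>+ z. green_potential \<mu> z \<partial>\<nu>) = (\<integral>\<^sup>+ w. (\<integral>\<^sup>+ z. green_disk z w \<partial>\<nu>) \<partial>\<mu>)"
    unfolding green_potential_def
    by (rule Fubini'[of "\<lambda>w z. green_disk z w"]) measurable
  also have "\<dots> = (\<integral>\<^sup>+ z. green_potential \<nu> z \<partial>\<mu>)"
    unfolding green_potential_def
  proof (intro nn_integral_cong_AE)
    show "AE w in \<mu>. (\<integral>\<^sup>+ z. green_disk z w \<partial>\<nu>) = (\<integral>\<^sup>+ z. green_disk w z \<partial>\<nu>)"
      using assms(5)
    proof eventually_elim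
      case (elim w)
      show ?case using assms(6)
        by (intro nn_integral_cong_AE, eventually_elim) (simp add: elim green_disk_commute)
    qed
  qed
  finally show ?thesis .
qed

lemma green_potential_le:
  assumes "prob_space \<mu>" "AE w in \<mu>. green_disk z w \<le> c"
  shows "green_potential \<mu> z \<le> c"
proof -
  interpret prob_space \<mu> by fact
  have "green_potential \<mu> z \<le> (\<integral>\<^sup>+ w. c \<partial>\<mu>)"
    unfolding green_potential_def using assms by (intro nn_integral_mono_AE)
  then show ?thesis by (simp add: emeasure_space_1)
qed

text \<open>
  Joint lower semicontinuity: of the potential in its argument and, through the maps \<open>X k\<close>,
  of the potential in the measure.
\<close>

lemma green_potential_fatou:
  assumes [measurable]: "\<And>k. X k \<in> borel_measurable M"
    and "f \<longlonglongrightarrow> z" "cmod z < 1"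
    and "AE w in M. (\<lambda>k. X k w) \<longlonglongrightarrow> Y w" "AE w in M. cmod (Y w) < 1"
  shows "(\<integral>\<^sup>+ w. green_disk z (Y w) \<partial>M) \<le> liminf (\<lambda>k. \<integral>\<^sup>+ w. green_disk (f k) (X k w) \<partial>M)"
proof -
  have "(\<integral>\<^sup>+ w. green_disk z (Y w) \<partial>M)
      = (\<integral>\<^sup>+ w. liminf (\<lambda>k. green_disk (f k) (X k w)) \<partial>M)"
  proof (intro nn_integral_cong_AE)
    show "AE w in M. green_disk z (Y w) = liminf (\<lambda>k. green_disk (f k) (X k w))"
      using assms(4,5)
    proof eventually_elim
      case (elim w)
      have "(\<lambda>k. green_disk (f k) (X k w)) \<longlonglongrightarrow> green_disk z (Y w)"
        using elim assms by (intro tendsto_green_disk)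
      then show ?case by (simp add: lim_imp_Liminf)
    qed
  qed
  also have "\<dots> \<le> liminf (\<lambda>k. \<integral>\<^sup>+ w. green_disk (f k) (X k w) \<partial>M)"
    by (intro nn_integral_liminf) measurable
  finally show ?thesis .
qed

lemma closed_green_potential_le:
  assumes \<mu>: "sets \<mu> = sets borel" "AE w in \<mu>. cmod w < 1" and E: "closed E" "E \<subseteq> ball 0 1"
  shows "closed {z \<in> E. green_potential \<mu> z \<le> c}"
  unfolding closed_sequential_limits
proof (intro allI impI)
  note [measurable_cong] = \<mu>(1)
  fix x l assume xl: "(\<forall>n. x n \<in> {z \<in> E. green_potential \<mu> z \<le> c}) \<and> x \<longlonglongrightarrow> l"
  then have l: "l \<in> E" using E closed_sequentially by blast
  then have "cmod l < 1" using E by auto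
  then have "green_potential \<mu> l \<le> liminf (\<lambda>k. green_potential \<mu> (x k))"
    unfolding green_potential_def using xl \<mu> by (intro green_potential_fatou) auto
  also have "\<dots> \<le> c" using xl by (intro Liminf_le) auto
  finally show "l \<in> {z \<in> E. green_potential \<mu> z \<le> c}" using l by simp
qed

section \<open>Mixtures and the variational inequality\<close>

lemma ex_mixture:
  assumes "\<mu> \<in> unit_borel_measures_on E" "\<nu> \<in> unit_borel_measures_on E" "E \<in> sets borel"
    and t: "0 \<le> t" "t \<le> 1"
  shows "\<exists>\<kappa> \<in> unit_borel_measures_on E. \<forall>f \<in> borel_measurable borel.
    (\<integral>\<^sup>+ z. f z \<partial>\<kappa>) = ennreal (1 - t) * (\<integral>\<^sup>+ z. f z \<partial>\<mu>) + ennreal t * (\<integral>\<^sup>+ z. f z \<partial>\<nu>)"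
proof -
  define N where "N b = (if b then \<nu> else \<mu>)" for b
  define \<kappa> where "\<kappa> = measure_pmf (bernoulli_pmf t) \<bind> N"
  have N: "N b \<in> unit_borel_measures_on E" for b using assms by (simp add: N_def)
  have Nm: "N \<in> measurable (measure_pmf (bernoulli_pmf t)) (subprob_algebra borel)"
    using unit_borel_measures_onD(1,2)[OF N]
    by (auto simp: space_subprob_algebra intro!: prob_space_imp_subprob_space)
  have \<kappa>: "(\<integral>\<^sup>+ z. f z \<partial>\<kappa>) = ennreal (1 - t) * (\<integral>\<^sup>+ z. f z \<partial>\<mu>) + ennreal t * (\<integral>\<^sup>+ z. f z \<partial>\<nu>)"
    if "f \<in> borel_measurable borel" for f
    unfolding \<kappa>_def using t
    by (subst nn_integral_bind[OF that Nm]) (simp add: N_def mult.commute add.commute)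
  have sets: "sets \<kappa> = sets borel"
    unfolding \<kappa>_def using unit_borel_measures_onD(1)[OF N] by (intro sets_bind) auto
  then have space: "space \<kappa> = UNIV" by (metis sets_eq_imp_space_eq space_borel)
  have em: "emeasure \<kappa> A = ennreal (1 - t) * emeasure \<mu> A + ennreal t * emeasure \<nu> A"
    if "A \<in> sets borel" for A
    using \<kappa>[of "indicator A"] that sets unit_borel_measures_onD(1)[OF assms(1)]
      unit_borel_measures_onD(1)[OF assms(2)] by simp
  have one: "ennreal (1 - t) * 1 + ennreal t * 1 = 1"
    using t by (simp flip: ennreal_plus)
  have "emeasure \<kappa> E = 1" "emeasure \<kappa> UNIV = 1"
    using em[of E] em[of UNIV] assms one
      prob_space.emeasure_space_1[OF unit_borel_measures_onD(2)[OF assms(1)]]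
      prob_space.emeasure_space_1[OF unit_borel_measures_onD(2)[OF assms(2)]]
    by (auto simp: unit_borel_measures_on_def unit_borel_measures_onD(3)[OF assms(1)]
        unit_borel_measures_onD(3)[OF assms(2)])
  then have "\<kappa> \<in> unit_borel_measures_on E"
    using sets space by (auto simp: unit_borel_measures_on_def intro!: prob_spaceI)
  with \<kappa> show ?thesis by blast
qed

text \<open>
  The first-order condition for the energy to be minimal along the segment from \<open>\<mu>\<close> to \<open>\<nu>\<close>.
\<close>

lemma green_equilibrium_variation:
  assumes eq: "green_equilibrium_measure E \<mu>" and E: "compact E" "E \<subseteq> ball 0 1"
    and V: "min_green_energy E < \<infinity>"
    and \<nu>: "\<nu> \<in> unit_borel_measures_on E" "green_energy \<nu> < \<infinity>"
  shows "min_green_energy E \<le> (\<integral>\<^sup>+ z. green_potential \<mu> z \<partial>\<nu>)"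
proof (rule ccontr)
  let ?x = "\<integral>\<^sup>+ z. green_potential \<mu> z \<partial>\<nu>"
  assume "\<not> ?thesis"
  then have lt: "?x < min_green_energy E" by simp
  have Eb: "E \<in> sets borel" using E by (simp add: borel_compact)
  have \<mu>: "\<mu> \<in> unit_borel_measures_on E" and I\<mu>: "green_energy \<mu> = min_green_energy E"
    using eq by (auto simp: green_equilibrium_measure_def)
  interpret m: prob_space \<mu> using unit_borel_measures_onD(2)[OF \<mu>] .
  interpret n: prob_space \<nu> using unit_borel_measures_onD(2)[OF \<nu>(1)] .
  have AE\<mu>: "AE w in \<mu>. cmod w < 1" and AE\<nu>: "AE w in \<nu>. cmod w < 1"
    using unit_borel_measures_on_AE_disk \<mu> \<nu>(1) E by blast+
  have sets: "sets \<mu> = sets borel" "sets \<nu> = sets borel"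
    using unit_borel_measures_onD(1) \<mu> \<nu> by blast+
  have meas: "green_potential \<mu> \<in> borel_measurable borel" "green_potential \<nu> \<in> borel_measurable borel"
    using sets m.sigma_finite_measure_axioms n.sigma_finite_measure_axioms
    by (auto intro: green_potential_measurable)
  have swap: "(\<integral>\<^sup>+ z. green_potential \<nu> z \<partial>\<mu>) = ?x"
    using sets m.sigma_finite_measure_axioms n.sigma_finite_measure_axioms AE\<mu> AE\<nu>
    by (intro green_potential_swap)
  obtain v where v: "min_green_energy E = ennreal v" "0 \<le> v"
    using V by (cases "min_green_energy E") auto
  obtain x where x: "?x = ennreal x" "0 \<le> x"
    using lt V by (cases ?x) auto
  obtain j where j: "green_energy \<nu> = ennreal j" "0 \<le> j"
    using \<nu>(2) by (cases "green_energy \<nu>") auto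
  have xv: "x < v" using lt x v by (simp add: ennreal_less_iff)
  \<comment> \<open>On the segment from \<open>\<mu>\<close> to \<open>\<nu>\<close> the energy is a quadratic polynomial in \<open>t\<close>, with slope
      \<open>2 * (x - v) < 0\<close> at \<open>t = 0\<close>.\<close>
  define c where "c = \<bar>v - 2 * x + j\<bar> + (v - x)"
  define t where "t = (v - x) / c"
  have c: "0 < c" using xv by (simp add: c_def)
  have t: "0 < t" "t \<le> 1" using xv c by (auto simp: t_def c_def)
  obtain \<kappa> where \<kappa>: "\<kappa> \<in> unit_borel_measures_on E" and
    int\<kappa>: "\<And>f. f \<in> borel_measurable borel \<Longrightarrow>
      (\<integral>\<^sup>+ z. f z \<partial>\<kappa>) = ennreal (1 - t) * (\<integral>\<^sup>+ z. f z \<partial>\<mu>) + ennreal t * (\<integral>\<^sup>+ z. f z \<partial>\<nu>)"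
    using ex_mixture[OF \<mu> \<nu>(1) Eb, of t] t by auto
  have pot: "green_potential \<kappa> = (\<lambda>z. ennreal (1 - t) * green_potential \<mu> z + ennreal t * green_potential \<nu> z)"
    unfolding green_potential_def by (rule ext, rule int\<kappa>) measurable
  have part: "(\<integral>\<^sup>+ z. green_potential \<kappa> z \<partial>\<rho>) =
      ennreal (1 - t) * (\<integral>\<^sup>+ z. green_potential \<mu> z \<partial>\<rho>) + ennreal t * (\<integral>\<^sup>+ z. green_potential \<nu> z \<partial>\<rho>)"
    if "sets \<rho> = sets borel" for \<rho>
  proof -
    note [measurable_cong] = that
    note [measurable] = meas
    show ?thesis unfolding pot
      by (subst nn_integral_add) (auto simp: nn_integral_cmult)
  qed
  have "green_energy \<kappa> = ennreal (1 - t) * (\<integral>\<^sup>+ z. green_potential \<kappa> z \<partial>\<mu>)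
      + ennreal t * (\<integral>\<^sup>+ z. green_potential \<kappa> z \<partial>\<nu>)"
    unfolding green_energy_eq by (rule int\<kappa>) (use meas in \<open>simp add: pot\<close>)
  also have "\<dots> = ennreal ((1 - t) * ((1 - t) * v + t * x) + t * ((1 - t) * x + t * j))"
  proof -
    have nn: "0 \<le> 1 - t" "0 \<le> t" "0 \<le> (1 - t) * v" "0 \<le> t * x" "0 \<le> (1 - t) * x" "0 \<le> t * j"
      using t v x j by auto
    have 1: "(\<integral>\<^sup>+ z. green_potential \<kappa> z \<partial>\<mu>) = ennreal ((1 - t) * v + t * x)"
      using nn v x by (simp add: part sets swap x I\<mu> ennreal_mult flip: green_energy_eq)
    have 2: "(\<integral>\<^sup>+ z. green_potential \<kappa> z \<partial>\<nu>) = ennreal ((1 - t) * x + t * j)"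
      using nn x j by (simp add: part sets x ennreal_mult flip: green_energy_eq)
    show ?thesis unfolding 1 2 using nn by (simp add: ennreal_mult add_nonneg_nonneg)
  qed
  finally have "green_energy \<kappa> = ennreal ((1 - t) * ((1 - t) * v + t * x) + t * ((1 - t) * x + t * j))" .
  moreover have "min_green_energy E \<le> green_energy \<kappa>"
    unfolding min_green_energy_def using \<kappa> by (intro INF_lower)
  ultimately have "v \<le> (1 - t) * ((1 - t) * v + t * x) + t * ((1 - t) * x + t * j)"
    unfolding v(1) using v(2) t x j
    by (metis add_nonneg_nonneg diff_ge_0_iff_ge ennreal_le_iff less_imp_le mult_nonneg_nonneg)
  then have "t * (2 * (v - x)) \<le> t * (t * (v - 2 * x + j))"
    by (simp add: algebra_simps power2_eq_square)
  then have "2 * (v - x) \<le> t * (v - 2 * x + j)" using t by simp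
  also have "\<dots> \<le> t * c" using t xv by (intro mult_left_mono) (auto simp: c_def)
  also have "\<dots> = v - x" using c by (simp add: t_def)
  finally show False using xv by simp
qed

lemma green_energy_uniform_measure:
  assumes "sets \<mu> = sets borel" "prob_space \<mu>" "A \<in> sets borel" "emeasure \<mu> A \<noteq> 0" "green_energy \<mu> < \<infinity>"
  shows "green_energy (uniform_measure \<mu> A) < \<infinity>"
proof -
  interpret prob_space \<mu> by fact
  note [measurable_cong] = assms(1)
  have A: "A \<in> events" using assms by simp
  have meas: "green_potential \<mu> \<in> borel_measurable borel"
    using assms sigma_finite_measure_axioms by (intro green_potential_measurable)
  note [measurable] = meas
  have le: "(\<integral>\<^sup>+ w. f w \<partial>uniform_measure \<mu> A) \<le> (\<integral>\<^sup>+ w. f w \<partial>\<mu>) / emeasure \<mu> A"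
    if [measurable]: "f \<in> borel_measurable borel" for f
    using A by (subst nn_integral_uniform_measure)
      (auto intro!: divide_right_mono_ennreal nn_integral_mono split: split_indicator)
  have "green_energy (uniform_measure \<mu> A)
      \<le> (\<integral>\<^sup>+ z. green_potential \<mu> z / emeasure \<mu> A \<partial>uniform_measure \<mu> A)"
    unfolding green_energy_eq green_potential_def by (intro nn_integral_mono le) measurable
  also have "\<dots> \<le> (\<integral>\<^sup>+ z. green_potential \<mu> z / emeasure \<mu> A \<partial>\<mu>) / emeasure \<mu> A"
    by (intro le) measurable
  also have "\<dots> = green_energy \<mu> / emeasure \<mu> A / emeasure \<mu> A"
    unfolding green_energy_eq by (simp add: nn_integral_divide)
  also have "\<dots> < \<infinity>"
    using assms(4,5) by (simp add: ennreal_divide_eq_top_iff less_top[symmetric])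
  finally show ?thesis .
qed

text \<open>
  If the potential exceeded the minimal energy on a set of positive \<open>\<mu>\<close>-measure, its
  mean over the complement would have to fall below, against the variational inequality for the
  normalised restriction of \<open>\<mu>\<close> to that complement.
\<close>

lemma green_equilibrium_potential_AE_le:
  assumes eq: "green_equilibrium_measure E \<mu>" and E: "compact E" "E \<subseteq> ball 0 1"
    and V: "min_green_energy E < \<infinity>"
  shows "AE z in \<mu>. green_potential \<mu> z \<le> min_green_energy E"
proof -
  let ?V = "min_green_energy E"
  have Eb: "E \<in> sets borel" using E by (simp add: borel_compact)
  have \<mu>: "\<mu> \<in> unit_borel_measures_on E" and I\<mu>: "green_energy \<mu> = ?V"
    using eq by (auto simp: green_equilibrium_measure_def)
  interpret m: prob_space \<mu> using unit_borel_measures_onD(2)[OF \<mu>] .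
  have sets: "sets \<mu> = sets borel" using unit_borel_measures_onD(1) \<mu> by blast
  note [measurable_cong] = sets
  note space = unit_borel_measures_onD(3)[OF \<mu>]
  have [measurable]: "green_potential \<mu> \<in> borel_measurable borel"
    using sets m.sigma_finite_measure_axioms by (rule green_potential_measurable)
  define A where "A = {z. ?V < green_potential \<mu> z}"
  have [measurable]: "A \<in> sets borel" unfolding A_def by measurable
  define B where "B = - A"
  have [measurable]: "B \<in> sets borel" by (simp add: B_def)
  let ?PA = "\<integral>\<^sup>+ z. green_potential \<mu> z * indicator A z \<partial>\<mu>"
  let ?PB = "\<integral>\<^sup>+ z. green_potential \<mu> z * indicator B z \<partial>\<mu>"
  let ?R = "\<integral>\<^sup>+ z. (green_potential \<mu> z - ?V) * indicator A z \<partial>\<mu>"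
  have B_ge: "?V * emeasure \<mu> B \<le> ?PB"
  proof (cases "emeasure \<mu> B = 0")
    case False
    let ?\<nu> = "uniform_measure \<mu> B"
    interpret n: prob_space ?\<nu>
      using False by (intro prob_space_uniform_measure) auto
    have "AE w in ?\<nu>. w \<in> E"
      using unit_borel_measures_on_AE[OF \<mu> Eb] by (intro AE_uniform_measureI) (auto simp: sets)
    then have "?\<nu> \<in> unit_borel_measures_on E"
      using sets Eb n.prob_space_axioms by (intro unit_borel_measures_onI) auto
    moreover have "green_energy ?\<nu> < \<infinity>"
      using False V I\<mu> sets m.prob_space_axioms by (intro green_energy_uniform_measure) auto
    ultimately have "?V \<le> (\<integral>\<^sup>+ z. green_potential \<mu> z \<partial>?\<nu>)"
      using eq E V by (intro green_equilibrium_variation)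
    also have "\<dots> = ?PB / emeasure \<mu> B"
      by (intro nn_integral_uniform_measure) auto
    finally have "emeasure \<mu> B * ?V
        \<le> emeasure \<mu> B * (?PB / emeasure \<mu> B)"
      by (intro mult_left_mono) auto
    also have "\<dots> = ?PB * emeasure \<mu> B / emeasure \<mu> B"
      by (simp only: ennreal_times_divide mult.commute)
    also have "\<dots> = ?PB"
      using False by (intro mult_divide_eq_ennreal) auto
    finally show ?thesis by (simp only: mult.commute)
  qed simp
  have A_eq: "?PA
      = ?V * emeasure \<mu> A + ?R"
  proof -
    have "?V * emeasure \<mu> A = (\<integral>\<^sup>+ z. ?V * indicator A z \<partial>\<mu>)"
      by (simp add: nn_integral_cmult sets)
    then show ?thesis
      by (simp, subst nn_integral_add[symmetric])
        (auto intro!: nn_integral_cong split: split_indicator simp: A_def less_imp_le add_diff_inverse_ennreal)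
  qed
  have AB: "emeasure \<mu> A + emeasure \<mu> B = 1"
    using plus_emeasure[of A \<mu> B] m.emeasure_space_1 by (simp add: B_def sets space)
  have "?V = (\<integral>\<^sup>+ z. green_potential \<mu> z * indicator A z + green_potential \<mu> z * indicator B z \<partial>\<mu>)"
    unfolding I\<mu>[symmetric] green_energy_eq
    by (intro nn_integral_cong) (auto simp: B_def split: split_indicator)
  also have "\<dots> = ?PA
      + ?PB"
    by (intro nn_integral_add) auto
  also have "\<dots> \<ge> (?V * emeasure \<mu> A + ?R) + ?V * emeasure \<mu> B"
    unfolding A_eq using B_ge by (intro add_left_mono)
  also have "?V * emeasure \<mu> A + ?R + ?V * emeasure \<mu> B
      = ?V * (emeasure \<mu> A + emeasure \<mu> B) + ?R"
    by (simp add: distrib_left ac_simps)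
  finally have "?V + ?R \<le> ?V + 0"
    by (simp add: AB)
  then have "?R = 0"
    using V by (auto simp only: ennreal_add_left_cancel_le infinity_ennreal_def le_zero_eq less_irrefl)
  then have "AE z in \<mu>. (green_potential \<mu> z - ?V) * indicator A z = 0"
    by (subst (asm) nn_integral_0_iff_AE) auto
  then show ?thesis
    by eventually_elim (auto simp: A_def split: split_indicator_asm dest: ennreal_minus_eq_0)
qed

text \<open>
  In the disc the Green kernel exceeds the logarithmic kernel by at most \<open>ln 2\<close>.
\<close>

lemma min_green_energy_finite:
  assumes E: "compact E" "E \<subseteq> ball 0 1" and cap: "log_capacity E > 0"
  shows "min_green_energy E < \<infinity>"
proof -
  have "robin_constant E \<noteq> \<infinity>" using cap by (auto simp: log_capacity_def)
  then have "(INF \<mu>\<in>unit_borel_measures_on E. log_energy \<mu>) < \<infinity>"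
    by (simp add: robin_constant_def)
  then obtain \<mu> where \<mu>: "\<mu> \<in> unit_borel_measures_on E" and le: "log_energy \<mu> < \<infinity>"
    unfolding INF_less_iff by blast
  let ?P = "\<integral>\<^sup>+ z. \<integral>\<^sup>+ w. (if z = w then \<infinity> else ennreal (ln (1 / cmod (z - w)))) \<partial>\<mu> \<partial>\<mu>"
  have P: "?P < \<infinity>"
  proof -
    have "?P \<noteq> \<infinity>"
    proof
      assume "?P = \<infinity>"
      then have "log_energy \<mu> = \<infinity>" by (simp add: log_energy_def)
      with le show False by simp
    qed
    then show ?thesis by (simp add: less_top[symmetric])
  qed
  have Eb: "E \<in> sets borel" using E by (simp add: borel_compact)
  have AE: "AE w in \<mu>. cmod w < 1"
    using unit_borel_measures_on_AE_disk \<mu> E by blast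
  interpret prob_space \<mu> using unit_borel_measures_onD(2)[OF \<mu>] .
  have sets: "sets \<mu> = sets borel" using unit_borel_measures_onD(1) \<mu> by blast
  note [measurable_cong] = sets
  have [measurable]: "Measurable.pred (borel \<Otimes>\<^sub>M borel) (\<lambda>x::complex\<times>complex. fst x = snd x)"
    unfolding borel_prod pred_def by (auto intro!: borel_closed closed_Collect_eq continuous_intros)
  let ?k = "\<lambda>z w. if z = w then \<infinity> else ennreal (ln (1 / cmod (z - w)))"
  have km: "(\<lambda>x. ?k (fst x) (snd x)) \<in> borel_measurable (borel \<Otimes>\<^sub>M borel)" by measurable
  have [measurable]: "(\<lambda>x. ?k (fst x) (snd x)) \<in> borel_measurable (\<mu> \<Otimes>\<^sub>M \<mu>)"
    using km sets by (simp cong: measurable_cong_sets sets_pair_measure_cong)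
  have kz: "(\<lambda>w. ?k z w) \<in> borel_measurable \<mu>" for z
    using measurable_compose[OF measurable_Pair1'[of z \<mu> \<mu>], of "\<lambda>x. ?k (fst x) (snd x)" borel]
      unit_borel_measures_onD(3)[OF \<mu>] by simp
  have kint: "(\<lambda>z. \<integral>\<^sup>+ w. ?k z w \<partial>\<mu>) \<in> borel_measurable \<mu>"
    by (intro borel_measurable_nn_integral) (simp add: case_prod_unfold)
  have bound: "green_disk z w \<le> ?k z w + ennreal (ln 2)" if "cmod z < 1" "cmod w < 1" for z w
  proof (cases "z = w")
    case False
    then have "green_real z w \<le> ln (2 / cmod (z - w))" using that by (intro green_real_le) auto
    also have "\<dots> = ln (1 / cmod (z - w)) + ln 2" using False by (simp add: ln_div)
    finally have "ennreal (green_real z w) \<le> ennreal (ln (1 / cmod (z - w)) + ln 2)"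
      by (rule ennreal_leI)
    also have "\<dots> \<le> ennreal (ln (1 / cmod (z - w))) + ennreal (ln 2)"
      by (cases "0 \<le> ln (1 / cmod (z - w))")
        (auto simp: ennreal_neg simp flip: ennreal_plus intro!: ennreal_leI)
    finally show ?thesis using False that by (simp add: green_disk_eq)
  qed simp
  have "green_energy \<mu> \<le> (\<integral>\<^sup>+ z. (\<integral>\<^sup>+ w. ?k z w \<partial>\<mu>) + ennreal (ln 2) \<partial>\<mu>)"
    unfolding green_energy_def
  proof (rule nn_integral_mono_AE)
    show "AE z in \<mu>. (\<integral>\<^sup>+ w. green_disk z w \<partial>\<mu>) \<le> (\<integral>\<^sup>+ w. ?k z w \<partial>\<mu>) + ennreal (ln 2)"
      using AE
    proof eventually_elim
      case (elim z)
      have "(\<integral>\<^sup>+ w. green_disk z w \<partial>\<mu>) \<le> (\<integral>\<^sup>+ w. ?k z w + ennreal (ln 2) \<partial>\<mu>)"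
        using AE by (intro nn_integral_mono_AE, eventually_elim) (intro bound elim)
      also have "\<dots> = (\<integral>\<^sup>+ w. ?k z w \<partial>\<mu>) + ennreal (ln 2)"
        using kz by (subst nn_integral_add) (auto simp: emeasure_space_1)
      finally show ?case .
    qed
  qed
  also have "\<dots> = ?P + ennreal (ln 2)"
    using kint by (subst nn_integral_add) (auto simp: emeasure_space_1)
  also have "\<dots> < \<infinity>" using P by (simp add: less_top[symmetric])
  finally have "green_energy \<mu> < \<infinity>" .
  moreover have "min_green_energy E \<le> green_energy \<mu>"
    unfolding min_green_energy_def using \<mu> by (intro INF_lower)
  ultimately show ?thesis by simp
qed

section \<open>Maximum principles for potentials\<close>

lemma compact_in_disk_radius:
  assumes "compact E" "E \<subseteq> ball (0::complex) 1"
  obtains \<rho> where "0 \<le> \<rho>" "\<rho> < 1" "\<And>w. w \<in> E \<Longrightarrow> cmod w \<le> \<rho>"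
proof (cases "E = {}")
  case True
  then show ?thesis using that[of 0] by auto
next
  case False
  then obtain x where "x \<in> E" "\<And>y. y \<in> E \<Longrightarrow> cmod y \<le> cmod x"
    using continuous_attains_sup[of E cmod] assms(1) by (auto intro: continuous_intros)
  then show ?thesis using that[of "cmod x"] assms(2) by auto
qed

lemma green_potential_finite:
  assumes "prob_space \<nu>" "AE w in \<nu>. w \<in> S" "closed S" "S \<subseteq> ball 0 1" "cmod z < 1" "z \<notin> S"
  shows "green_potential \<nu> z < \<infinity>"
proof -
  have "open (- S)" "z \<in> - S" using assms by auto
  then obtain r where r: "0 < r" "ball z r \<subseteq> - S" unfolding open_contains_ball by blast
  have "green_potential \<nu> z \<le> ennreal (ln (2 / r))"
  proof (rule green_potential_le[OF assms(1)])
    show "AE w in \<nu>. green_disk z w \<le> ennreal (ln (2 / r))"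
      using assms(2)
    proof eventually_elim
      case (elim w)
      have "r \<le> cmod (z - w)" using r(2) elim by (auto simp: dist_norm not_less subset_eq)
      then show ?case using elim assms r by (intro green_disk_le) auto
    qed
  qed
  also have "\<dots> < \<infinity>" by simp
  finally show ?thesis .
qed

lemma green_potential_continuous:
  assumes \<nu>: "sets \<nu> = sets borel" "prob_space \<nu>" "AE w in \<nu>. w \<in> S"
    and S: "closed S" "S \<subseteq> ball 0 1"
    and f: "f \<longlonglongrightarrow> z" and z: "cmod z < 1" "z \<notin> S"
  shows "(\<lambda>k. green_potential \<nu> (f k)) \<longlonglongrightarrow> green_potential \<nu> z"
proof -
  note [measurable_cong] = \<nu>(1)
  interpret prob_space \<nu> by fact
  have "open (- S)" "z \<in> - S" using S z by auto
  then obtain r where r: "0 < r" "ball z r \<subseteq> - S" unfolding open_contains_ball by blast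
  have "\<forall>\<^sub>F k in sequentially. dist (f k) z < r / 2"
    using f r by (intro tendstoD) auto
  moreover have "\<forall>\<^sub>F k in sequentially. cmod (f k) < 1"
    using tendsto_norm[OF f] z by (simp add: order_tendstoD(2))
  ultimately have "\<forall>\<^sub>F k in sequentially. dist (f k) z < r / 2 \<and> cmod (f k) < 1"
    by (rule eventually_conj)
  then obtain N where N: "\<And>k. N \<le> k \<Longrightarrow> dist (f k) z < r / 2 \<and> cmod (f k) < 1"
    unfolding eventually_sequentially by blast
  have "(\<lambda>k. \<integral>\<^sup>+ w. green_disk (f (k + N)) w \<partial>\<nu>) \<longlonglongrightarrow> (\<integral>\<^sup>+ w. green_disk z w \<partial>\<nu>)"
  proof (rule nn_integral_dominated_convergence[where w = "\<lambda>_. ennreal (ln (2 / (r / 2)))"])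
    fix k
    show "AE w in \<nu>. green_disk (f (k + N)) w \<le> ennreal (ln (2 / (r / 2)))"
      using \<nu>(3)
    proof eventually_elim
      case (elim w)
      have "r \<le> dist z w" using r(2) elim by (auto simp: not_less subset_eq)
      then have "r / 2 \<le> cmod (f (k + N) - w)"
        using N[of "k + N"] dist_triangle2[of z w "f (k + N)"] by (simp add: dist_norm norm_minus_commute)
      moreover have "cmod w < 1" "cmod (f (k + N)) < 1" using elim S N[of "k + N"] by auto
      ultimately show ?case using r by (intro green_disk_le) auto
    qed
  next
    show "AE w in \<nu>. (\<lambda>k. green_disk (f (k + N)) w) \<longlonglongrightarrow> green_disk z w"
      using \<nu>(3)
    proof eventually_elim
      case (elim w)
      then show ?case using z S
        by (intro tendsto_green_disk tendsto_const LIMSEQ_ignore_initial_segment[OF f]) auto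
    qed
  qed (auto simp: emeasure_space_1)
  then show ?thesis unfolding green_potential_def by (rule LIMSEQ_offset)
qed

text \<open>
  The maximum principle applied to the difference of a potential and finitely many Green functions.
  Such a function is harmonic off the support and the poles and has nonpositive limits on the
  unit circle, so only the boundary behaviour at the support and at the poles has to be supplied.
\<close>

lemma green_potential_minus_green_le:
  assumes \<nu>: "sets \<nu> = sets borel" "prob_space \<nu>" "AE w in \<nu>. w \<in> S"
    and S: "compact S" "S \<subseteq> ball 0 1"
    and J: "finite J" "a ` J \<subseteq> ball 0 1" and A: "0 \<le> A" and c: "0 \<le> c"
    and h_def: "\<And>z. h z = A * enn2real (green_potential \<nu> z) - (\<Sum>i\<in>J. green_real z (a i))"
    and bdry: "\<And>f \<zeta> c'. (\<And>k. f k \<in> ball 0 1 - (S \<union> a ` J)) \<Longrightarrow> f \<longlonglongrightarrow> \<zeta> \<Longrightarrow> \<zeta> \<in> S \<union> a ` J \<Longrightarrow> c < c' \<Longrightarrow>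
        (\<And>k::nat. c' \<le> h (f k)) \<Longrightarrow> False"
    and z: "z \<in> ball 0 1 - (S \<union> a ` J)"
  shows "h z \<le> c"
proof (rule maximum_principle[where U = "ball 0 1 - (S \<union> a ` J)"])
  let ?K = "S \<union> a ` J"
  let ?U = "ball 0 1 - ?K"
  let ?p = "green_potential \<nu>"
  interpret prob_space \<nu> by fact
  note [measurable_cong] = \<nu>(1)
  have clS: "closed S" using S compact_imp_closed by blast
  have clK: "closed ?K" using clS J by (auto intro!: closed_Un finite_imp_closed[of "a ` J"])
  have fin: "?p y < \<infinity>" if "y \<in> ?U" for y
    using that \<nu> clS S by (intro green_potential_finite[of \<nu> S]) auto
  have fin_eq: "?p y = ennreal (enn2real (?p y))" if "y \<in> ?U" for y
    using fin[OF that] by simp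
  show "?U \<subseteq> ball 0 1" by auto
  show "z \<in> ?U" by fact
  show "continuous_on ?U h"
  proof (rule continuous_on_sequentiallyI)
    fix u y assume u: "\<forall>n. u n \<in> ?U" "y \<in> ?U" "u \<longlonglongrightarrow> y"
    have "(\<lambda>n. ?p (u n)) \<longlonglongrightarrow> ?p y"
      using u \<nu> clS S by (intro green_potential_continuous) auto
    then have "(\<lambda>n. enn2real (?p (u n))) \<longlonglongrightarrow> enn2real (?p y)"
      using fin[OF u(2)] by (intro tendsto_enn2real) auto
    moreover have "(\<lambda>n. green_real (u n) (a i)) \<longlonglongrightarrow> green_real y (a i)" if i: "i \<in> J" for i
    proof -
      have "cmod y < 1" "cmod (a i) < 1" "y \<noteq> a i" using u i J by auto
      then show ?thesis unfolding green_real_def pseudo_dist_def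
        using pseudo_dist_eq_0_iff[of y "a i"] cmod_one_minus_cnj_mult(3)[of y "a i"] u(3)
        by (intro tendsto_intros) (auto simp: pseudo_dist_def)
    qed
    ultimately show "(\<lambda>n. h (u n)) \<longlonglongrightarrow> h y"
      unfolding h_def by (intro tendsto_diff tendsto_mult tendsto_const tendsto_sum)
  qed
  show "\<exists>r>0. \<exists>C. \<forall>m. (\<forall>j. y + dyadic_root m j * of_real r \<in> ?U) \<and>
      2 ^ m * h y \<le> (\<Sum>j<2 ^ m. h (y + dyadic_root m j * of_real r)) + C" if y: "y \<in> ?U" for y
  proof -
    have "open (- ?K)" using clK by (rule open_Compl)
    moreover have "y \<in> - ?K" using y by auto
    ultimately obtain \<delta> where \<delta>: "0 < \<delta>" "ball y \<delta> \<subseteq> - ?K" unfolding open_contains_ball by blast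
    define r where "r = min \<delta> (1 - cmod y) / 2"
    have r: "0 < r" "2 * r \<le> \<delta>" "2 * r \<le> 1 - cmod y" using \<delta> y by (auto simp: r_def)
    have far: "2 * r \<le> cmod (y - w)" if "w \<in> ?K" for w
    proof -
      have "\<delta> \<le> dist y w" using \<delta>(2) that by (auto simp: not_less subset_eq)
      then show ?thesis using r by (simp add: dist_norm)
    qed
    have inU: "y + dyadic_root m j * of_real r \<in> ?U" for m j
    proof -
      have n: "cmod (dyadic_root m j * of_real r) = r" using r by (simp add: norm_mult)
      then have "y + dyadic_root m j * of_real r \<in> ball y \<delta>" using r by (simp add: dist_norm)
      moreover have "cmod (y + dyadic_root m j * of_real r) < 1"
        using norm_triangle_ineq[of y "dyadic_root m j * of_real r"] n r by simp
      ultimately show ?thesis using \<delta>(2) by auto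
    qed
    define C where "C = A * (2 * ln 2) + real (card J) * (2 * ln 2)"
    have "2 ^ m * h y \<le> (\<Sum>j<2 ^ m. h (y + dyadic_root m j * of_real r)) + C" for m
    proof -
      let ?y = "\<lambda>j. y + dyadic_root m j * of_real r"
      have err: "\<bar>(\<Sum>j<2 ^ m. green_real (?y j) w) - 2 ^ m * green_real y w\<bar> \<le> 2 * ln 2" if "w \<in> ?K" for w
        using that y r far[OF that] S J by (intro green_real_mean_error) auto
      have "ennreal (2 ^ m) * ?p y = (\<integral>\<^sup>+ w. ennreal (2 ^ m) * green_disk y w \<partial>\<nu>)"
        unfolding green_potential_def by (simp add: nn_integral_cmult)
      also have "\<dots> \<le> (\<integral>\<^sup>+ w. (\<Sum>j<2 ^ m. green_disk (?y j) w) + ennreal (2 * ln 2) \<partial>\<nu>)"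
      proof (rule nn_integral_mono_AE)
        show "AE w in \<nu>. ennreal (2 ^ m) * green_disk y w
            \<le> (\<Sum>j<2 ^ m. green_disk (?y j) w) + ennreal (2 * ln 2)"
          using \<nu>(3)
        proof eventually_elim
          case (elim w)
          have w: "cmod w < 1" "w \<in> ?K" using elim S by auto
          have gy: "green_disk y w = ennreal (green_real y w)" "0 \<le> green_real y w"
            using w y by (auto simp: green_disk_eq green_real_nonneg)
          have gj: "green_disk (?y j) w = ennreal (green_real (?y j) w)" "0 \<le> green_real (?y j) w" for j
            using w inU[of m j] by (auto simp: green_disk_eq green_real_nonneg)
          have "ennreal (2 ^ m) * green_disk y w = ennreal (2 ^ m * green_real y w)"
            using gy by (simp add: ennreal_mult)
          also have "\<dots> \<le> ennreal ((\<Sum>j<2 ^ m. green_real (?y j) w) + 2 * ln 2)"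
            using err[OF w(2)] by (intro ennreal_leI) linarith
          also have "\<dots> = (\<Sum>j<2 ^ m. green_disk (?y j) w) + ennreal (2 * ln 2)"
            using gj by (simp add: sum_nonneg)
          finally show ?case .
        qed
      qed
      also have "\<dots> = (\<Sum>j<2 ^ m. ?p (?y j)) + ennreal (2 * ln 2)"
        unfolding green_potential_def
        by (subst nn_integral_add) (auto simp: nn_integral_sum emeasure_space_1)
      finally have "ennreal (2 ^ m * enn2real (?p y))
          \<le> (\<Sum>j<2 ^ m. ennreal (enn2real (?p (?y j)))) + ennreal (2 * ln 2)"
        using fin_eq[OF y] fin_eq[OF inU[of m]] by (simp add: ennreal_mult)
      also have "\<dots> = ennreal ((\<Sum>j<2 ^ m. enn2real (?p (?y j))) + 2 * ln 2)"
        by (simp add: sum_nonneg)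
      finally have p: "2 ^ m * enn2real (?p y) \<le> (\<Sum>j<2 ^ m. enn2real (?p (?y j))) + 2 * ln 2"
        by (subst (asm) ennreal_le_iff) (auto intro!: add_nonneg_nonneg sum_nonneg)
      have "(\<Sum>j<2 ^ m. \<Sum>i\<in>J. green_real (?y j) (a i)) = (\<Sum>i\<in>J. \<Sum>j<2 ^ m. green_real (?y j) (a i))"
        by (rule sum.swap)
      also have "\<dots> \<le> (\<Sum>i\<in>J. 2 ^ m * green_real y (a i) + 2 * ln 2)"
      proof (rule sum_mono)
        fix i assume "i \<in> J"
        then show "(\<Sum>j<2 ^ m. green_real (?y j) (a i)) \<le> 2 ^ m * green_real y (a i) + 2 * ln 2"
          using err[of "a i"] by fastforce
      qed
      also have "\<dots> = 2 ^ m * (\<Sum>i\<in>J. green_real y (a i)) + real (card J) * (2 * ln 2)"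
        by (simp add: sum.distrib sum_distrib_left)
      finally have g: "(\<Sum>j<2 ^ m. \<Sum>i\<in>J. green_real (?y j) (a i))
          \<le> 2 ^ m * (\<Sum>i\<in>J. green_real y (a i)) + real (card J) * (2 * ln 2)" .
      have "(\<Sum>j<2 ^ m. h (?y j)) = A * (\<Sum>j<2 ^ m. enn2real (?p (?y j))) - (\<Sum>j<2 ^ m. \<Sum>i\<in>J. green_real (?y j) (a i))"
        unfolding h_def by (simp add: sum_subtractf sum_distrib_left)
      moreover have "2 ^ m * h y = A * (2 ^ m * enn2real (?p y)) - 2 ^ m * (\<Sum>i\<in>J. green_real y (a i))"
        unfolding h_def by (simp add: algebra_simps)
      moreover have "A * (2 ^ m * enn2real (?p y)) \<le> A * ((\<Sum>j<2 ^ m. enn2real (?p (?y j))) + 2 * ln 2)"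
        using p A by (rule mult_left_mono)
      ultimately show ?thesis using g by (simp add: C_def distrib_left)
    qed
    then show ?thesis using r(1) inU by blast
  qed
  show False if f: "\<And>k. f k \<in> ?U" "f \<longlonglongrightarrow> \<zeta>" and \<zeta>: "\<zeta> \<in> cball 0 1 - ?U" and c': "c < c'"
    and le: "\<And>k::nat. c' \<le> h (f k)" for f \<zeta> c'
  proof (cases "\<zeta> \<in> ?K")
    case True
    with bdry[of f \<zeta> c'] f c' le show False by blast
  next
    case False
    with \<zeta> have one: "cmod \<zeta> = 1" by auto
    obtain \<rho> where \<rho>: "0 \<le> \<rho>" "\<rho> < 1" "\<And>w. w \<in> S \<Longrightarrow> cmod w \<le> \<rho>"
      using compact_in_disk_radius S by blast
    define e where "e = c' / (2 * (A + 1))"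
    have c'0: "0 < c'" using c c' by simp
    then have e: "0 < e" using A by (simp add: e_def)
    have "(\<lambda>k. 1 - (cmod (f k))\<^sup>2) \<longlonglongrightarrow> 1 - (cmod \<zeta>)\<^sup>2" by (intro tendsto_intros f)
    moreover have "1 - (cmod \<zeta>)\<^sup>2 < (1 - exp (- 2 * e)) * (1 - \<rho>)\<^sup>2"
      using one e \<rho> by simp
    ultimately have "\<forall>\<^sub>F k in sequentially. 1 - (cmod (f k))\<^sup>2 < (1 - exp (- 2 * e)) * (1 - \<rho>)\<^sup>2"
      by (rule order_tendstoD(2))
    then obtain k where k: "1 - (cmod (f k))\<^sup>2 < (1 - exp (- 2 * e)) * (1 - \<rho>)\<^sup>2"
      using eventually_happens'[OF sequentially_bot] by blast
    have "?p (f k) \<le> ennreal e"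
    proof (rule green_potential_le[OF \<nu>(2)])
      show "AE w in \<nu>. green_disk (f k) w \<le> ennreal e"
        using \<nu>(3)
      proof eventually_elim
        case (elim w)
        then have "f k \<noteq> w" "cmod w < 1" "cmod (f k) < 1" using f(1)[of k] S by auto
        then show ?case
          using k \<rho>(2) \<rho>(3)[OF elim] by (auto simp: green_disk_eq intro!: ennreal_leI green_real_boundary_le)
      qed
    qed
    then have "enn2real (?p (f k)) \<le> e" using e by (intro enn2real_leI) auto
    then have "A * enn2real (?p (f k)) \<le> A * e" using A by (rule mult_left_mono)
    moreover have "0 \<le> (\<Sum>i\<in>J. green_real (f k) (a i))"
      using f(1)[of k] J by (intro sum_nonneg green_real_nonneg) auto
    ultimately have "h (f k) \<le> A * e" unfolding h_def by linarith
    also have "A * e < c'" using A c'0 by (simp add: e_def field_simps) (smt (verit) mult_nonneg_nonneg)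
    finally show False using le[of k] by simp
  qed
qed

text \<open>
  The Maria--Frostman maximum principle. At a boundary point of \<open>S\<close> the potential is
  compared with its values at the nearest points of \<open>S\<close>: moving to a nearest point changes each
  distance to \<open>S\<close> by a factor at most two, so the kernels differ by at most a constant \<open>C\<close>, and
  Fatou's lemma applied to the nonnegative difference controls the limit from above.
\<close>

lemma green_potential_maximum_principle:
  assumes \<nu>: "sets \<nu> = sets borel" "prob_space \<nu>" "AE w in \<nu>. w \<in> S"
    and S: "compact S" "S \<subseteq> ball 0 1"
    and V: "V < \<infinity>" "\<And>z. z \<in> S \<Longrightarrow> green_potential \<nu> z \<le> V"
    and z: "z \<in> ball 0 1"
  shows "green_potential \<nu> z \<le> V"
proof (cases "z \<in> S")
  case False
  let ?p = "green_potential \<nu>"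
  interpret prob_space \<nu> by fact
  note [measurable_cong] = \<nu>(1)
  obtain v where v: "V = ennreal v" "0 \<le> v" using V(1) by (cases V) auto
  have clS: "closed S" using S compact_imp_closed by blast
  have fin: "?p y < \<infinity>" if "y \<in> ball 0 1 - S" for y
    using that \<nu> clS S by (intro green_potential_finite[of \<nu> S]) auto
  have "1 * enn2real (?p z) - (\<Sum>i\<in>({}::nat set). green_real z (0::complex)) \<le> v"
  proof (rule green_potential_minus_green_le[OF \<nu> S, where J = "{} :: nat set" and a = "\<lambda>_. 0" and A = 1
        and h = "\<lambda>z. 1 * enn2real (?p z) - (\<Sum>i\<in>{}. green_real z 0)"])
    fix f \<zeta> c' assume "\<And>k::nat. f k \<in> ball 0 1 - (S \<union> (\<lambda>_. 0) ` ({}::nat set))" "f \<longlonglongrightarrow> \<zeta>"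
      "\<zeta> \<in> S \<union> (\<lambda>_. 0) ` ({}::nat set)" "v < c'"
      "\<And>k. c' \<le> 1 * enn2real (?p (f k)) - (\<Sum>i\<in>({}::nat set). green_real (f k) (0::complex))"
    then have f: "\<And>k. f k \<in> ball 0 1 - S" "f \<longlonglongrightarrow> \<zeta>" and \<zeta>: "\<zeta> \<in> S" and c': "v < c'"
      and le: "\<And>k. c' \<le> enn2real (?p (f k))" by auto
    obtain \<rho> where \<rho>: "0 \<le> \<rho>" "\<rho> < 1" "\<And>w. w \<in> S \<Longrightarrow> cmod w \<le> \<rho>"
      using compact_in_disk_radius S by blast
    define s where "s k = closest_point S (f k)" for k
    have s: "s k \<in> S" for k
      unfolding s_def using clS \<zeta> by (intro closest_point_in_set) auto
    have smin: "dist (f k) (s k) \<le> dist (f k) y" if "y \<in> S" for k y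
      unfolding s_def using clS that by (rule closest_point_le)
    have "(\<lambda>k. s k - \<zeta>) \<longlonglongrightarrow> 0"
    proof (rule Lim_null_comparison)
      show "\<forall>\<^sub>F k in sequentially. norm (s k - \<zeta>) \<le> 2 * dist (f k) \<zeta>"
      proof (intro always_eventually allI)
        fix k show "norm (s k - \<zeta>) \<le> 2 * dist (f k) \<zeta>"
          using dist_triangle3[of "s k" \<zeta> "f k"] smin[OF \<zeta>, of k] by (simp add: dist_norm)
      qed
      show "(\<lambda>k. 2 * dist (f k) \<zeta>) \<longlonglongrightarrow> 0"
        using tendsto_mult_right_zero[OF tendsto_dist_iff[THEN iffD1, OF f(2)]] by simp
    qed
    then have s_lim: "s \<longlonglongrightarrow> \<zeta>" by (rule LIM_zero_cancel)
    define C where "C = 2 * ln 2 - ln (1 - \<rho>)"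
    have C: "0 < C"
    proof -
      have "ln (1 - \<rho>) \<le> 0" using \<rho> by simp
      moreover have "0 < ln (2::real)" by simp
      ultimately show ?thesis unfolding C_def by linarith
    qed
    have comp: "green_disk (f k) w \<le> green_disk (s k) w + ennreal C" if w: "w \<in> S" for k w
    proof (cases "s k = w")
      case False
      have d: "cmod (f k) < 1" "cmod (s k) < 1" "cmod w < 1" "f k \<noteq> w"
        using f(1)[of k] s[of k] S w by auto
      have "dist (s k) w \<le> 2 * dist (f k) w"
        using dist_triangle3[of "s k" w "f k"] smin[OF w, of k] by linarith
      then have "cmod (s k - w) / 2 \<le> cmod (f k - w)" by (simp add: dist_norm)
      then have "green_real (f k) w \<le> ln (2 / (cmod (s k - w) / 2))"
        using d False by (intro green_real_le) auto
      also have "\<dots> = 2 * ln 2 - ln (cmod (s k - w))"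
        using False ln_mult_pos[of 2 "2::real"] by (simp add: ln_div)
      also have "\<dots> \<le> green_real (s k) w + C"
      proof -
        have "ln (1 - \<rho>) \<le> ln (cmod (1 - cnj w * s k))"
          using cmod_one_minus_cnj_mult(1,3)[of "s k" w] d \<rho>(3)[OF s[of k]] \<rho>(2)
          by (subst ln_le_cancel_iff) auto
        then show ?thesis using d False by (simp add: green_real_diff C_def)
      qed
      finally have "ennreal (green_real (f k) w) \<le> ennreal (green_real (s k) w + C)" by (rule ennreal_leI)
      then show ?thesis using d False C by (simp add: green_disk_eq green_real_nonneg)
    qed (use s[of k] S in \<open>auto simp: green_disk_eq\<close>)
    let ?F = "\<lambda>k w. green_disk (s k) w + ennreal C - green_disk (f k) w"
    have AE_lim: "AE w in \<nu>. ennreal C = liminf (\<lambda>k. ?F k w)"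
    proof -
      have "?p \<zeta> < \<infinity>" using V(1) V(2)[OF \<zeta>] by (rule le_less_trans[rotated])
      then have "AE w in \<nu>. green_disk \<zeta> w \<noteq> \<infinity>"
        unfolding green_potential_def by (intro nn_integral_noteq_infinite) auto
      then show ?thesis using \<nu>(3)
      proof eventually_elim
        case (elim w)
        have d: "cmod \<zeta> < 1" "cmod w < 1" using \<zeta> elim S by auto
        have "(\<lambda>k. ?F k w) \<longlonglongrightarrow> green_disk \<zeta> w + ennreal C - green_disk \<zeta> w"
          using elim d f s_lim
          by (intro tendsto_diff_ennreal tendsto_add tendsto_const tendsto_green_disk) auto
        then show ?case using elim by (simp add: lim_imp_Liminf)
      qed
    qed
    have F_le: "(\<integral>\<^sup>+ w. ?F k w \<partial>\<nu>) \<le> ennreal (v + C - c')" for k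
    proof -
      have "(\<integral>\<^sup>+ w. ?F k w \<partial>\<nu>) + ennreal c' \<le> (\<integral>\<^sup>+ w. ?F k w \<partial>\<nu>) + ?p (f k)"
        using le[of k] fin[OF f(1)[of k]]
        by (intro add_left_mono) (metis ennreal_enn2real ennreal_leI infinity_ennreal_def)
      also have "\<dots> = (\<integral>\<^sup>+ w. ?F k w + green_disk (f k) w \<partial>\<nu>)"
        unfolding green_potential_def by (subst nn_integral_add) auto
      also have "\<dots> = (\<integral>\<^sup>+ w. green_disk (s k) w + ennreal C \<partial>\<nu>)"
        using \<nu>(3) by (intro nn_integral_cong_AE, eventually_elim) (simp add: comp diff_add_cancel_ennreal)
      also have "\<dots> = ?p (s k) + ennreal C"
        unfolding green_potential_def by (subst nn_integral_add) (auto simp: emeasure_space_1)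
      also have "\<dots> \<le> ennreal v + ennreal C"
        using V(2)[OF s[of k]] v by (intro add_right_mono) simp
      also have "\<dots> = ennreal (v + C)" using v C by simp
      finally show ?thesis
        using c' v by (cases "\<integral>\<^sup>+ w. ?F k w \<partial>\<nu>") (auto simp flip: ennreal_plus simp: ennreal_le_iff2 top_unique)
    qed
    have "ennreal C = (\<integral>\<^sup>+ w. ennreal C \<partial>\<nu>)" by (simp add: emeasure_space_1)
    also have "\<dots> = (\<integral>\<^sup>+ w. liminf (\<lambda>k. ?F k w) \<partial>\<nu>)"
      using AE_lim by (rule nn_integral_cong_AE)
    also have "\<dots> \<le> liminf (\<lambda>k. \<integral>\<^sup>+ w. ?F k w \<partial>\<nu>)" by (intro nn_integral_liminf) measurable
    also have "\<dots> \<le> ennreal (v + C - c')"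
      by (rule Liminf_le) (auto intro!: always_eventually F_le)
    finally have "C \<le> v + C - c'" using C by (simp add: ennreal_le_iff2)
    then show False using c' by simp
  qed (use z False v in auto)
  then have "ennreal (enn2real (?p z)) \<le> ennreal v" by (intro ennreal_leI) simp
  moreover have "ennreal (enn2real (?p z)) = ?p z" using fin[of z] z False by simp
  ultimately show ?thesis using v by simp
qed (use V in auto)

lemma green_equilibrium_potential_le:
  assumes eq: "green_equilibrium_measure E \<mu>" and E: "compact E" "E \<subseteq> ball 0 1"
    and V: "min_green_energy E < \<infinity>" and z: "z \<in> ball 0 1"
  shows "green_potential \<mu> z \<le> min_green_energy E"
proof -
  let ?S = "{z \<in> E. green_potential \<mu> z \<le> min_green_energy E}"
  have \<mu>: "\<mu> \<in> unit_borel_measures_on E" using eq by (simp add: green_equilibrium_measure_def)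
  have "closed ?S"
    using unit_borel_measures_onD(1)[OF \<mu>] unit_borel_measures_on_AE_disk[OF \<mu> E] E
    by (intro closed_green_potential_le) (auto intro: compact_imp_closed)
  then have "compact (E \<inter> ?S)" using E(1) by (rule compact_Int_closed[rotated])
  moreover have "E \<inter> ?S = ?S" by auto
  ultimately have "compact ?S" by simp
  moreover have "AE w in \<mu>. w \<in> ?S"
    using unit_borel_measures_on_AE[OF \<mu> borel_compact[OF E(1)]]
      green_equilibrium_potential_AE_le[OF eq E V]
    by eventually_elim simp
  moreover have "?S \<subseteq> ball 0 1" using E by blast
  ultimately show ?thesis
    by (intro green_potential_maximum_principle[OF unit_borel_measures_onD(1,2)[OF \<mu>] _ _ _ V _ z]) auto
qed

text \<open>
  A Bernstein--Walsh inequality: the norm of a product of Blaschke factors on \<open>E\<close>, here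
  given by \<open>L\<close>, controls the product everywhere in the disc.
\<close>

lemma blaschke_bernstein_walsh:
  assumes eq: "green_equilibrium_measure E \<mu>" and E: "compact E" "E \<subseteq> ball 0 1"
    and V: "min_green_energy E < \<infinity>"
    and J: "finite J" "a ` J \<subseteq> ball 0 1"
    and L: "\<And>z. z \<in> E \<Longrightarrow> ennreal L \<le> (\<Sum>i\<in>J. green_disk z (a i))"
    and L0: "0 \<le> L" and z: "z \<in> ball 0 1"
  shows "of_nat (card J) * green_potential \<mu> z + ennreal L
    \<le> (\<Sum>i\<in>J. green_disk z (a i)) + of_nat (card J) * min_green_energy E"
proof -
  let ?n = "card J"
  let ?p = "green_potential \<mu>"
  have \<mu>: "\<mu> \<in> unit_borel_measures_on E" using eq by (simp add: green_equilibrium_measure_def)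
  note prob = unit_borel_measures_onD(2)[OF \<mu>]
  interpret prob_space \<mu> by fact
  note sets = unit_borel_measures_onD(1)[OF \<mu>]
  note [measurable_cong] = sets
  note AE_E = unit_borel_measures_on_AE[OF \<mu> borel_compact[OF E(1)]]
  obtain v where v: "min_green_energy E = ennreal v" "0 \<le> v" using V by (cases "min_green_energy E") auto
  have p_le: "?p y \<le> ennreal v" if "y \<in> ball 0 1" for y
    using green_equilibrium_potential_le[OF eq E V that] v by simp
  have p_real: "?p y = ennreal (enn2real (?p y))" "enn2real (?p y) \<le> v" if "y \<in> ball 0 1" for y
  proof -
    have "?p y < top" using p_le[OF that] by (rule le_less_trans) simp
    then show "?p y = ennreal (enn2real (?p y))" by simp
    show "enn2real (?p y) \<le> v" using v(2) p_le[OF that] by (rule enn2real_leI)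
  qed
  have Ln: "L \<le> real ?n * v"
  proof -
    have "ennreal L = (\<integral>\<^sup>+ z. ennreal L \<partial>\<mu>)" by (simp add: emeasure_space_1)
    also have "\<dots> \<le> (\<integral>\<^sup>+ z. (\<Sum>i\<in>J. green_disk z (a i)) \<partial>\<mu>)"
      using AE_E by (intro nn_integral_mono_AE, eventually_elim) (rule L)
    also have "\<dots> = (\<Sum>i\<in>J. \<integral>\<^sup>+ z. green_disk z (a i) \<partial>\<mu>)"
      by (intro nn_integral_sum) measurable
    also have "\<dots> = (\<Sum>i\<in>J. ?p (a i))"
      unfolding green_potential_def
    proof (intro sum.cong refl nn_integral_cong_AE)
      fix i assume "i \<in> J"
      then have ai: "cmod (a i) < 1" using J by auto
      show "AE z in \<mu>. green_disk z (a i) = green_disk (a i) z"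
        using unit_borel_measures_on_AE_disk[OF \<mu> E] by eventually_elim (simp add: green_disk_commute ai)
    qed
    also have "\<dots> \<le> (\<Sum>i\<in>J. ennreal v)" using J by (intro sum_mono p_le) auto
    also have "\<dots> = ennreal (real ?n * v)" using v by (simp add: ennreal_mult ennreal_of_nat_eq_real_of_nat)
    finally show ?thesis using v by (simp add: ennreal_le_iff)
  qed
  consider "z \<in> E" | "z \<in> a ` J" | "z \<in> ball 0 1 - (E \<union> a ` J)" using z by blast
  then show ?thesis
  proof cases
    case 1
    have "of_nat ?n * ?p z + ennreal L \<le> of_nat ?n * min_green_energy E + (\<Sum>i\<in>J. green_disk z (a i))"
      using L[OF 1] green_equilibrium_potential_le[OF eq E V z] by (intro add_mono mult_left_mono) auto
    then show ?thesis by (simp add: add.commute)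
  next
    case 2
    then show ?thesis using J by (simp add: sum_green_disk_pole)
  next
    case 3
    define h where "h z = real ?n * enn2real (?p z) - (\<Sum>i\<in>J. green_real z (a i))" for z
    have "h z \<le> real ?n * v - L"
    proof (rule green_potential_minus_green_le[OF sets prob AE_E E J _ _ h_def _ 3])
      fix f \<zeta> c' assume f: "\<And>k. f k \<in> ball 0 1 - (E \<union> a ` J)" "f \<longlonglongrightarrow> \<zeta>"
        and \<zeta>: "\<zeta> \<in> E \<union> a ` J" and c': "real ?n * v - L < c'" and le: "\<And>k::nat. c' \<le> h (f k)"
      have \<zeta>1: "cmod \<zeta> < 1" using \<zeta> E J by auto
      have "(\<lambda>k. \<Sum>i\<in>J. green_disk (f k) (a i)) \<longlonglongrightarrow> (\<Sum>i\<in>J. green_disk \<zeta> (a i))"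
        using f \<zeta>1 J by (intro tendsto_sum tendsto_green_disk tendsto_const) auto
      moreover have "(\<Sum>i\<in>J. green_disk (f k) (a i)) \<le> ennreal (real ?n * v - c')" for k
      proof -
        have "(\<Sum>i\<in>J. green_disk (f k) (a i)) = ennreal (\<Sum>i\<in>J. green_real (f k) (a i))"
          using f(1)[of k] J by (intro sum_green_disk_eq) auto
        also have "\<dots> \<le> ennreal (real ?n * v - c')"
        proof (rule ennreal_leI)
          have "real ?n * enn2real (?p (f k)) \<le> real ?n * v"
            using p_real[of "f k"] f(1)[of k] by (intro mult_left_mono) auto
          then show "(\<Sum>i\<in>J. green_real (f k) (a i)) \<le> real ?n * v - c'"
            using le[of k] unfolding h_def by linarith
        qed
        finally show ?thesis .
      qed
      ultimately have lim: "(\<Sum>i\<in>J. green_disk \<zeta> (a i)) \<le> ennreal (real ?n * v - c')"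
        by (intro LIMSEQ_le_const2) auto
      show False
      proof (cases "\<zeta> \<in> a ` J")
        case True
        then show False using lim J by (simp add: sum_green_disk_pole top_unique)
      next
        case False
        then have "ennreal L \<le> ennreal (real ?n * v - c')" using \<zeta> L[of \<zeta>] lim by auto
        moreover have "real ?n * v - c' < L" using c' by simp
        moreover have "L > 0 \<or> L = 0" using L0 by auto
        ultimately have "L = 0" by (auto simp: ennreal_le_iff2)
        \<comment> \<open>For \<open>L = 0\<close> the bound on the limit degenerates, but then the Green
            functions at \<open>f k\<close> would have a negative sum.\<close>
        have "0 \<le> (\<Sum>i\<in>J. green_real (f 0) (a i))"
          using f(1)[of 0] J by (intro sum_nonneg green_real_nonneg) auto
        moreover have "real ?n * enn2real (?p (f 0)) \<le> real ?n * v"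
          using p_real[of "f 0"] f(1)[of 0] by (intro mult_left_mono) auto
        ultimately show False using le[of 0] c' \<open>L = 0\<close> unfolding h_def by linarith
      qed
    qed (use Ln in auto)
    then have *: "real ?n * enn2real (?p z) + L \<le> (\<Sum>i\<in>J. green_real z (a i)) + real ?n * v"
      unfolding h_def by linarith
    have gs: "(\<Sum>i\<in>J. green_disk z (a i)) = ennreal (\<Sum>i\<in>J. green_real z (a i))"
      using 3 J by (intro sum_green_disk_eq) auto
    have "of_nat ?n * ?p z + ennreal L = ennreal (real ?n * enn2real (?p z) + L)"
      using L0 by (subst p_real(1)[OF z]) (simp add: ennreal_mult ennreal_of_nat_eq_real_of_nat)
    also have "\<dots> \<le> ennreal ((\<Sum>i\<in>J. green_real z (a i)) + real ?n * v)"
      using * by (rule ennreal_leI)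
    also have "\<dots> = (\<Sum>i\<in>J. green_disk z (a i)) + of_nat ?n * min_green_energy E"
      using v 3 J unfolding gs v(1)
      by (subst ennreal_plus) (auto simp: ennreal_mult ennreal_of_nat_eq_real_of_nat intro!: sum_nonneg green_real_nonneg)
    finally show ?thesis .
  qed
qed

section \<open>The Riesz measure\<close>

text \<open>
  The Riesz measure lives on the \<open>\<sigma>\<close>-algebra of the disc; transported to the plane it can be
  combined with \<open>\<mu>\<close> in Fubini's theorem.
\<close>

definition riesz_on_plane :: "complex measure \<Rightarrow> complex measure" where
  "riesz_on_plane \<sigma> = distr \<sigma> borel (\<lambda>x. x)"

lemma riesz_on_plane:
  assumes "inf_green_riesz_measure E \<sigma>"
  shows "sets (riesz_on_plane \<sigma>) = sets borel"
    and "AE w in riesz_on_plane \<sigma>. cmod w < 1"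
    and "emeasure (riesz_on_plane \<sigma>) UNIV = emeasure \<sigma> (ball 0 1)"
    and "\<And>z. z \<in> ball 0 1 \<Longrightarrow> inf_green E z = green_potential (riesz_on_plane \<sigma>) z"
proof -
  have sets: "sets \<sigma> = sets (restrict_space borel (ball 0 1))"
    and rep: "\<And>z. z \<in> ball 0 1 \<Longrightarrow> inf_green E z = (\<integral>\<^sup>+ \<zeta>. green_disk z \<zeta> \<partial>\<sigma>)"
    using assms by (auto simp: inf_green_riesz_measure_def)
  have space: "space \<sigma> = ball 0 1"
    using sets_eq_imp_space_eq[OF sets] by (simp add: space_restrict_space)
  have [measurable]: "(\<lambda>x. x) \<in> measurable \<sigma> borel"
    using measurable_restrict_space1[of "\<lambda>x. x" borel borel "ball (0::complex) 1"] sets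
    by (simp cong: measurable_cong_sets)
  show "sets (riesz_on_plane \<sigma>) = sets borel" by (simp add: riesz_on_plane_def)
  show "AE w in riesz_on_plane \<sigma>. cmod w < 1"
    unfolding riesz_on_plane_def by (subst AE_distr_iff) (auto simp: space intro!: AE_I2)
  show "emeasure (riesz_on_plane \<sigma>) UNIV = emeasure \<sigma> (ball 0 1)"
    unfolding riesz_on_plane_def by (subst emeasure_distr) (auto simp: space)
  show "inf_green E z = green_potential (riesz_on_plane \<sigma>) z" if "z \<in> ball 0 1" for z
    unfolding rep[OF that] riesz_on_plane_def green_potential_def
    by (subst nn_integral_distr) auto
qed

lemma sum_green_circle:
  assumes r: "0 < r" "r < 1" and w: "cmod w < r"
    and m: "r ^ 2 ^ m \<le> 1 / 2" "(cmod w / r) ^ 2 ^ m \<le> 1 / 2"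
  shows "\<bar>(\<Sum>j<2 ^ m. green_real (dyadic_root m j * of_real r) w) - 2 ^ m * ln (1 / r)\<bar> \<le> 2 * ln 2"
proof -
  let ?N = "(2::nat) ^ m"
  have w1: "cmod w < 1" using w r by simp
  have z1: "cmod (dyadic_root m j * of_real r) < 1" for j using r by (simp add: norm_mult)
  have ne: "dyadic_root m j * of_real r \<noteq> w" for j
    using w r by (auto simp: norm_mult)
  let ?A = "\<lambda>j. ln (cmod (1 + dyadic_root m j * (- cnj w * of_real r)))"
  let ?B = "\<lambda>j. ln (cmod (- w + dyadic_root m j * of_real r))"
  have g: "green_real (dyadic_root m j * of_real r) w = ?A j - ?B j" for j
    using z1 w1 ne by (simp add: green_real_diff algebra_simps)
  have "1 + dyadic_root m j * (- cnj w * of_real r) \<noteq> 0" for j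
    using cmod_one_minus_cnj_mult(3)[OF z1[of j] w1] by (auto simp: algebra_simps)
  then have A: "(\<Sum>j<?N. ?A j) = ln (cmod (1 ^ ?N - (- (- cnj w * of_real r)) ^ ?N))"
    by (rule sum_ln_cmod_dyadic_root)
  have "- w + dyadic_root m j * of_real r \<noteq> 0" for j using ne by (simp add: add_eq_0_iff)
  then have B: "(\<Sum>j<?N. ?B j) = ln (cmod ((- w) ^ ?N - (- of_real r) ^ ?N))"
    by (rule sum_ln_cmod_dyadic_root)
  have "(- w) ^ ?N - (- of_real r) ^ ?N = (- 1) ^ ?N * (w ^ ?N - of_real r ^ ?N)"
    by (simp add: power_minus[of w] power_minus[of "of_real r"] right_diff_distrib)
  then have B': "cmod ((- w) ^ ?N - (- of_real r) ^ ?N) = cmod (w ^ ?N - of_real r ^ ?N)"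
    by (simp add: norm_mult norm_power)
  have rN: "0 < r ^ ?N" using r by simp
  have wN: "cmod (w ^ ?N) \<le> r ^ ?N / 2"
    using m(2) rN by (simp add: norm_power power_divide pos_divide_le_eq)
  have rn: "cmod (of_real r ^ ?N :: complex) = r ^ ?N" using r by (simp add: norm_power)
  have Bl: "r ^ ?N / 2 \<le> cmod (w ^ ?N - of_real r ^ ?N)"
    using norm_triangle_ineq2[of "of_real r ^ ?N" "w ^ ?N"] wN unfolding rn
    by (simp add: norm_minus_commute)
  have Bh: "cmod (w ^ ?N - of_real r ^ ?N) \<le> 2 * r ^ ?N"
    using norm_triangle_ineq4[of "w ^ ?N" "of_real r ^ ?N"] wN rN unfolding rn by simp
  have "cmod ((cnj w * of_real r) ^ ?N) = cmod w ^ ?N * r ^ ?N"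
    using r by (simp add: norm_power norm_mult power_mult_distrib)
  also have "\<dots> \<le> 1 * (1 / 2)" using m(1) w1 rN by (intro mult_mono) (auto intro: power_le_one)
  finally have u: "cmod ((cnj w * of_real r) ^ ?N) \<le> 1 / 2" by simp
  have Al: "1 / 2 \<le> cmod (1 ^ ?N - (- (- cnj w * of_real r)) ^ ?N)"
    using norm_triangle_ineq2[of 1 "(cnj w * of_real r) ^ ?N"] u by simp
  have Ah: "cmod (1 ^ ?N - (- (- cnj w * of_real r)) ^ ?N) \<le> 2"
    using norm_triangle_ineq4[of 1 "(cnj w * of_real r) ^ ?N"] u by simp
  have lA: "\<bar>\<Sum>j<?N. ?A j\<bar> \<le> ln 2"
  proof -
    have "ln (1 / 2) \<le> (\<Sum>j<?N. ?A j)" unfolding A using Al by (subst ln_le_cancel_iff) auto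
    moreover have "(\<Sum>j<?N. ?A j) \<le> ln 2" unfolding A using Al Ah by (subst ln_le_cancel_iff) auto
    ultimately show ?thesis by (simp add: ln_div)
  qed
  have lB: "\<bar>(\<Sum>j<?N. ?B j) - ?N * ln r\<bar> \<le> ln 2"
  proof -
    have "ln (r ^ ?N / 2) \<le> (\<Sum>j<?N. ?B j)"
      unfolding B B' using Bl rN by (subst ln_le_cancel_iff) auto
    moreover have "(\<Sum>j<?N. ?B j) \<le> ln (2 * r ^ ?N)"
      unfolding B B' using Bl Bh rN by (subst ln_le_cancel_iff) auto
    moreover have "ln (r ^ ?N / 2) = ?N * ln r - ln 2" "ln (2 * r ^ ?N) = ln 2 + ?N * ln r"
      using r by (simp_all add: ln_div ln_mult_pos ln_realpow)
    ultimately show ?thesis by linarith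
  qed
  have "(\<Sum>j<?N. green_real (dyadic_root m j * of_real r) w) - ?N * ln (1 / r)
      = (\<Sum>j<?N. ?A j) - ((\<Sum>j<?N. ?B j) - ?N * ln r)"
    unfolding g using r by (simp add: sum_subtractf ln_div)
  then show ?thesis using lA lB by (simp add: abs_le_iff)
qed

text \<open>
  The Green potential of the Riesz measure is bounded by the Green function with pole \<open>w0\<close>. The
  mean of a Green function over a circle of radius \<open>r\<close> is about \<open>ln (1 / r)\<close> if its pole lies well
  inside, so comparing means over large circles shows that the mass of the Riesz measure is at
  most about that of a point mass. The crude constant \<open>3\<close> absorbs the discretisation error.
\<close>

lemma riesz_measure_finite:
  assumes \<sigma>: "inf_green_riesz_measure E \<sigma>" and w0: "w0 \<in> E" "cmod w0 < 1"
  shows "emeasure (riesz_on_plane \<sigma>) UNIV < \<infinity>"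
proof -
  let ?\<tau> = "riesz_on_plane \<sigma>"
  note sets = riesz_on_plane(1)[OF \<sigma>]
  note [measurable_cong] = sets
  have le3: "emeasure ?\<tau> (cball 0 \<rho>) \<le> 3" if "\<rho> < 1" for \<rho>
  proof -
    define t where "t = max \<rho> (cmod w0)"
    have t: "\<rho> \<le> t" "cmod w0 \<le> t" "t < 1" "0 \<le> t"
      using that w0 by (auto simp: t_def max_def order_trans[OF norm_ge_zero[of w0]] split: if_splits)
    define r where "r = (1 + t) / 2"
    have r: "t < r" "0 < r" "r < 1" using t by (auto simp: r_def)
    define l where "l = ln (1 / r)"
    have l: "0 < l" using r by (simp add: l_def)
    have q: "\<bar>t / r\<bar> < 1" using t r by simp
    let ?big = "\<lambda>k. r ^ k < 1 / 2 \<and> (t / r) ^ k < 1 / 2 \<and> 4 * ln 2 / l \<le> real k"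
    have "(\<lambda>k. r ^ k) \<longlonglongrightarrow> 0" "(\<lambda>k. (t / r) ^ k) \<longlonglongrightarrow> 0"
      using r q by (intro LIMSEQ_power_zero; simp)+
    then have "\<forall>\<^sub>F k in sequentially. r ^ k < 1 / 2" "\<forall>\<^sub>F k in sequentially. (t / r) ^ k < 1 / 2"
      by (simp_all add: order_tendstoD(2) del: divide_less_eq less_divide_eq_numeral1 divide_less_eq_numeral1)
    moreover have "\<forall>\<^sub>F k in sequentially. 4 * ln 2 / l \<le> real k"
      using filterlim_real_sequentially unfolding filterlim_at_top by blast
    ultimately have "\<forall>\<^sub>F k in sequentially. ?big k"
      by (intro eventually_conj)
    then obtain m where m: "\<And>k. m \<le> k \<Longrightarrow> ?big k"
      unfolding eventually_sequentially by blast
    let ?N = "(2::nat) ^ m"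
    have "m \<le> ?N" by (simp add: less_imp_le)
    note mN = m[OF this]
    then have big: "4 * ln 2 \<le> ?N * l" using l by (simp add: pos_divide_le_eq)
    let ?z = "\<lambda>j. dyadic_root m j * of_real r"
    have z: "cmod (?z j) < 1" for j using r by (simp add: norm_mult)
    have est: "\<bar>(\<Sum>j<?N. green_real (?z j) w) - ?N * l\<bar> \<le> 2 * ln 2" if "cmod w \<le> t" for w
    proof -
      have "(cmod w / r) ^ ?N \<le> (t / r) ^ ?N"
        using that r by (intro power_mono divide_right_mono) auto
      then show ?thesis
        using sum_green_circle[of r w m] r mN that unfolding l_def by auto
    qed
    have gsum: "(\<Sum>j<?N. green_disk (?z j) w) = ennreal (\<Sum>j<?N. green_real (?z j) w)"
      if "cmod w \<le> t" for w
    proof -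
      have "?z j \<noteq> w" for j using that r by (auto simp: norm_mult)
      then have "green_disk (?z j) w = ennreal (green_real (?z j) w)" for j
        using z that t by (simp add: green_disk_eq)
      then show ?thesis using z that t by (simp add: green_real_nonneg sum_nonneg)
    qed
    have "ennreal (?N * l / 2) * emeasure ?\<tau> (cball 0 \<rho>)
        = (\<integral>\<^sup>+ w. ennreal (?N * l / 2) * indicator (cball 0 \<rho>) w \<partial>?\<tau>)"
      by (subst nn_integral_cmult_indicator) (auto simp: sets)
    also have "\<dots> \<le> (\<integral>\<^sup>+ w. (\<Sum>j<?N. green_disk (?z j) w) \<partial>?\<tau>)"
    proof (intro nn_integral_mono)
      fix w show "ennreal (?N * l / 2) * indicator (cball 0 \<rho>) w \<le> (\<Sum>j<?N. green_disk (?z j) w)"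
      proof (cases "w \<in> cball 0 \<rho>")
        case True
        then have wt: "cmod w \<le> t" using t by simp
        have "?N * l / 2 \<le> (\<Sum>j<?N. green_real (?z j) w)" using est[OF wt] big by linarith
        then show ?thesis using True by (simp add: gsum[OF wt] ennreal_leI)
      qed simp
    qed
    also have "\<dots> = (\<Sum>j<?N. inf_green E (?z j))"
      using z riesz_on_plane(4)[OF \<sigma>]
      by (subst nn_integral_sum) (auto simp: green_potential_def)
    also have "\<dots> \<le> (\<Sum>j<?N. green_disk (?z j) w0)"
      unfolding inf_green_def using w0 by (intro sum_mono INF_lower)
    also have "\<dots> \<le> ennreal (?N * l / 2 * 3)"
      unfolding gsum[OF t(2)] using est[OF t(2)] big by (intro ennreal_leI) linarith
    also have "\<dots> = ennreal (?N * l / 2) * ennreal 3"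
      using l by (intro ennreal_mult) auto
    finally have *: "ennreal (?N * l / 2) * emeasure ?\<tau> (cball 0 \<rho>) \<le> ennreal (?N * l / 2) * 3"
      by simp
    have "0 < ennreal (?N * l / 2)" using l by simp
    then show ?thesis using * by (subst (asm) ennreal_mult_le_mult_iff) auto
  qed
  let ?r = "\<lambda>n. 1 - 1 / real (Suc n)"
  have inc: "incseq (\<lambda>n. cball (0::complex) (?r n))"
    by (intro incseq_SucI subset_cball) (simp add: field_simps)
  have un: "(\<Union>n. cball (0::complex) (?r n)) = ball 0 1"
  proof safe
    fix w :: complex assume "w \<in> ball 0 1"
    then have "0 < 1 - cmod w" by simp
    then obtain n where "inverse (real (Suc n)) < 1 - cmod w" using reals_Archimedean by blast
    then show "w \<in> (\<Union>n. cball 0 (?r n))" by (auto simp: inverse_eq_divide intro!: exI[of _ n])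
  next
    fix w :: complex and n assume "w \<in> cball 0 (?r n)"
    then have "cmod w \<le> ?r n" by simp
    also have "\<dots> < 1" by simp
    finally show "w \<in> ball 0 1" by simp
  qed
  have "emeasure ?\<tau> UNIV = emeasure ?\<tau> (ball 0 1)"
    using riesz_on_plane(2)[OF \<sigma>] by (intro emeasure_eq_AE) (auto simp: sets)
  also have "\<dots> = (SUP n. emeasure ?\<tau> (cball 0 (?r n)))"
    unfolding un[symmetric] using inc by (intro SUP_emeasure_incseq[symmetric]) (auto simp: sets)
  also have "\<dots> \<le> 3" by (intro SUP_least le3) simp
  also have "\<dots> < \<infinity>" by simp
  finally show ?thesis .
qed

section \<open>The inequality for Blaschke products\<close>

text \<open>
  The equilibrium measure has no atoms, because its potential would be infinite at an atom.
\<close>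

lemma green_equilibrium_infinite:
  assumes eq: "green_equilibrium_measure E \<mu>" and E: "compact E" "E \<subseteq> ball 0 1"
    and V: "min_green_energy E < \<infinity>"
  shows "infinite E"
proof
  assume fin: "finite E"
  have \<mu>: "\<mu> \<in> unit_borel_measures_on E" using eq by (simp add: green_equilibrium_measure_def)
  interpret prob_space \<mu> using unit_borel_measures_onD(2)[OF \<mu>] .
  note [measurable_cong] = unit_borel_measures_onD(1)[OF \<mu>]
  have "AE z in \<mu>. z \<noteq> w" if "w \<in> E" for w
  proof -
    have "green_potential \<mu> w < \<infinity>"
      using green_equilibrium_potential_le[OF eq E V, of w] that E V by (auto intro: le_less_trans)
    then have "AE z in \<mu>. green_disk w z \<noteq> \<infinity>"
      unfolding green_potential_def by (intro nn_integral_noteq_infinite) auto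
    then show ?thesis by eventually_elim (auto simp: green_disk_def)
  qed
  then have "AE z in \<mu>. \<forall>w\<in>E. z \<noteq> w" using fin by (intro AE_finite_allI)
  then have "AE z in \<mu>. False"
    using unit_borel_measures_on_AE[OF \<mu> borel_compact[OF E(1)]] by eventually_elim auto
  then show False by simp
qed

lemma inf_green_le: "w \<in> E \<Longrightarrow> inf_green E z \<le> green_disk z w"
  unfolding inf_green_def by (rule INF_lower)

lemma inf_green_finite:
  assumes "infinite E" "E \<subseteq> ball 0 1" "cmod z < 1"
  shows "inf_green E z < \<infinity>"
proof -
  obtain w where w: "w \<in> E" "w \<noteq> z"
    using assms(1) by (metis finite.emptyI finite.insertI finite_subset insertI1 subsetI)
  then have "cmod w < 1" using assms(2) by auto
  have "inf_green E z \<le> green_disk z w" using w by (intro inf_green_le)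
  also have "\<dots> < \<infinity>" using w \<open>cmod w < 1\<close> assms by (simp add: green_disk_eq)
  finally show ?thesis .
qed

lemma nn_integral_inf_green:
  assumes eq: "green_equilibrium_measure E \<mu>" and E: "compact E" "E \<subseteq> ball 0 1"
    and V: "min_green_energy E < \<infinity>"
    and \<sigma>: "inf_green_riesz_measure E \<sigma>"
  shows "(\<integral>\<^sup>+ \<zeta>. (INF z\<in>E. green_disk z \<zeta>) \<partial>\<mu>) = (\<integral>\<^sup>+ z. inf_green E z \<partial>\<mu>)"
    and "(\<integral>\<^sup>+ z. inf_green E z \<partial>\<mu>) = (\<integral>\<^sup>+ z. green_potential \<mu> z \<partial>riesz_on_plane \<sigma>)"
    and "(\<integral>\<^sup>+ z. inf_green E z \<partial>\<mu>) < \<infinity>"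
    and "emeasure (riesz_on_plane \<sigma>) UNIV = ennreal (measure \<sigma> (ball 0 1))"
    and "finite_measure (riesz_on_plane \<sigma>)"
proof -
  let ?\<tau> = "riesz_on_plane \<sigma>"
  have \<mu>: "\<mu> \<in> unit_borel_measures_on E" using eq by (simp add: green_equilibrium_measure_def)
  interpret prob_space \<mu> using unit_borel_measures_onD(2)[OF \<mu>] .
  have AE\<mu>: "AE z in \<mu>. cmod z < 1" using unit_borel_measures_on_AE_disk[OF \<mu> E] .
  show "(\<integral>\<^sup>+ \<zeta>. (INF z\<in>E. green_disk z \<zeta>) \<partial>\<mu>) = (\<integral>\<^sup>+ z. inf_green E z \<partial>\<mu>)"
  proof (rule nn_integral_cong_AE)
    show "AE \<zeta> in \<mu>. (INF z\<in>E. green_disk z \<zeta>) = inf_green E \<zeta>"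
      using AE\<mu> unfolding inf_green_def
      by eventually_elim (use E in \<open>auto intro!: INF_cong green_disk_commute\<close>)
  qed
  obtain w0 where "w0 \<in> E" using green_equilibrium_infinite[OF eq E V] by (metis finite.emptyI ex_in_conv)
  then have fin: "emeasure ?\<tau> UNIV < \<infinity>" using \<sigma> E by (intro riesz_measure_finite) auto
  have sp: "space ?\<tau> = UNIV" by (simp add: riesz_on_plane_def)
  show fm: "finite_measure ?\<tau>" using fin by (intro finite_measureI) (simp add: sp)
  show "emeasure ?\<tau> UNIV = ennreal (measure \<sigma> (ball 0 1))"
    using fin riesz_on_plane(3)[OF \<sigma>] by (simp add: measure_def)
  interpret t: finite_measure ?\<tau> by fact
  have "(\<integral>\<^sup>+ z. inf_green E z \<partial>\<mu>) = (\<integral>\<^sup>+ z. green_potential ?\<tau> z \<partial>\<mu>)"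
    using AE\<mu> by (intro nn_integral_cong_AE, eventually_elim) (simp add: riesz_on_plane(4)[OF \<sigma>])
  also have "\<dots> = (\<integral>\<^sup>+ z. green_potential \<mu> z \<partial>?\<tau>)"
    using riesz_on_plane(1,2)[OF \<sigma>] unit_borel_measures_onD(1)[OF \<mu>] AE\<mu>
      sigma_finite_measure_axioms t.sigma_finite_measure_axioms
    by (intro green_potential_swap)
  finally show *: "(\<integral>\<^sup>+ z. inf_green E z \<partial>\<mu>) = (\<integral>\<^sup>+ z. green_potential \<mu> z \<partial>?\<tau>)" .
  have "(\<integral>\<^sup>+ z. green_potential \<mu> z \<partial>?\<tau>) \<le> (\<integral>\<^sup>+ z. min_green_energy E \<partial>?\<tau>)"
    using riesz_on_plane(2)[OF \<sigma>]
    by (intro nn_integral_mono_AE, eventually_elim) (simp add: green_equilibrium_potential_le[OF eq E V])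
  also have "\<dots> < \<infinity>" using V fin by (simp add: sp ennreal_mult_less_top)
  finally show "(\<integral>\<^sup>+ z. inf_green E z \<partial>\<mu>) < \<infinity>" using * by simp
qed

text \<open>
  Integrating the Bernstein--Walsh inequality against the Riesz measure turns each Green function
  with pole \<open>a i\<close> into the value of \<^term>\<open>inf_green E\<close> at \<open>a i\<close>.
\<close>

lemma sum_inf_green_ge:
  assumes eq: "green_equilibrium_measure E \<mu>" and E: "compact E" "E \<subseteq> ball 0 1"
    and V: "min_green_energy E < \<infinity>"
    and \<sigma>: "inf_green_riesz_measure E \<sigma>"
    and J: "finite J" "a ` J \<subseteq> ball 0 1"
    and L: "\<And>z. z \<in> E \<Longrightarrow> ennreal L \<le> (\<Sum>i\<in>J. green_disk z (a i))"
    and L0: "0 \<le> L"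
  shows "real (card J) * green_constant E \<mu> \<sigma> + L * measure \<sigma> (ball 0 1)
    \<le> (\<Sum>i\<in>J. enn2real (inf_green E (a i)))"
proof -
  let ?\<tau> = "riesz_on_plane \<sigma>"
  let ?n = "card J"
  let ?s = "measure \<sigma> (ball 0 1)"
  note \<tau> = riesz_on_plane[OF \<sigma>]
  note \<tau>' = nn_integral_inf_green[OF eq E V \<sigma>]
  note [measurable_cong] = \<tau>(1)
  have \<mu>: "\<mu> \<in> unit_borel_measures_on E" using eq by (simp add: green_equilibrium_measure_def)
  interpret prob_space \<mu> using unit_borel_measures_onD(2)[OF \<mu>] .
  have [measurable]: "green_potential \<mu> \<in> borel_measurable borel"
    using unit_borel_measures_onD(1)[OF \<mu>] sigma_finite_measure_axioms by (rule green_potential_measurable)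
  have sp: "space ?\<tau> = UNIV" by (simp add: riesz_on_plane_def)
  obtain v where v: "min_green_energy E = ennreal v" "0 \<le> v" using V by (cases "min_green_energy E") auto
  obtain D where D: "(\<integral>\<^sup>+ z. inf_green E z \<partial>\<mu>) = ennreal D" "0 \<le> D"
    using \<tau>'(3) by (cases "\<integral>\<^sup>+ z. inf_green E z \<partial>\<mu>") auto
  have d: "inf_green E (a i) = ennreal (enn2real (inf_green E (a i)))" if "i \<in> J" for i
    using inf_green_finite[OF green_equilibrium_infinite[OF eq E V] E(2), of "a i"] J that by auto
  have "ennreal (real ?n * D + L * ?s) = of_nat ?n * (\<integral>\<^sup>+ z. green_potential \<mu> z \<partial>?\<tau>) + ennreal L * emeasure ?\<tau> UNIV"
    using D L0 \<tau>'(2,4) by (simp add: ennreal_mult ennreal_of_nat_eq_real_of_nat)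
  also have "\<dots> = (\<integral>\<^sup>+ z. of_nat ?n * green_potential \<mu> z + ennreal L \<partial>?\<tau>)"
    by (subst nn_integral_add) (auto simp: nn_integral_cmult sp)
  also have "\<dots> \<le> (\<integral>\<^sup>+ z. (\<Sum>i\<in>J. green_disk z (a i)) + of_nat ?n * min_green_energy E \<partial>?\<tau>)"
    using \<tau>(2) by (intro nn_integral_mono_AE, eventually_elim)
      (rule blaschke_bernstein_walsh[OF eq E V J L L0], auto)
  also have "\<dots> = (\<Sum>i\<in>J. \<integral>\<^sup>+ z. green_disk z (a i) \<partial>?\<tau>) + of_nat ?n * min_green_energy E * ennreal ?s"
    by (subst nn_integral_add) (auto simp: nn_integral_sum sp \<tau>'(4))
  also have "(\<Sum>i\<in>J. \<integral>\<^sup>+ z. green_disk z (a i) \<partial>?\<tau>) = (\<Sum>i\<in>J. inf_green E (a i))"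
  proof (rule sum.cong[OF refl])
    fix i assume "i \<in> J"
    then have ai: "cmod (a i) < 1" using J by auto
    have "(\<integral>\<^sup>+ z. green_disk z (a i) \<partial>?\<tau>) = green_potential ?\<tau> (a i)"
      unfolding green_potential_def using \<tau>(2)
      by (intro nn_integral_cong_AE, eventually_elim) (simp add: green_disk_commute ai)
    then show "(\<integral>\<^sup>+ z. green_disk z (a i) \<partial>?\<tau>) = inf_green E (a i)" using ai by (simp add: \<tau>(4))
  qed
  also have "\<dots> = (\<Sum>i\<in>J. ennreal (enn2real (inf_green E (a i))))" using d by (intro sum.cong) auto
  also have "(\<Sum>i\<in>J. ennreal (enn2real (inf_green E (a i)))) + of_nat ?n * min_green_energy E * ennreal ?s
      = ennreal ((\<Sum>i\<in>J. enn2real (inf_green E (a i))) + real ?n * v * ?s)"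
    using v by (simp add: ennreal_mult ennreal_of_nat_eq_real_of_nat sum_nonneg)
  finally have "real ?n * D + L * ?s \<le> (\<Sum>i\<in>J. enn2real (inf_green E (a i))) + real ?n * v * ?s"
    using v by (subst (asm) ennreal_le_iff) (auto intro!: add_nonneg_nonneg sum_nonneg)
  moreover have "green_constant E \<mu> \<sigma> = D - v * ?s"
    unfolding green_constant_def \<tau>'(1) D(1) v(1) using D v by simp
  moreover have "real ?n * (D - v * ?s) = real ?n * D - real ?n * v * ?s"
    by (simp add: right_diff_distrib)
  ultimately show ?thesis by simp
qed

lemma finite_blaschkeE:
  assumes "finite_blaschke n B"
  obtains a where "\<And>j. j \<in> {1..n} \<Longrightarrow> cmod (a j) < 1"
    "\<And>z. cmod z < 1 \<Longrightarrow> cmod (B z) = (\<Prod>j=1..n. pseudo_dist z (a j))"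
proof -
  from assms obtain \<theta> :: real and a where a: "\<forall>j\<in>{1..n}. a j \<in> ball 0 1"
    and B: "\<forall>z\<in>ball 0 1. B z = exp (\<i> * of_real \<theta>) * (\<Prod>j=1..n. (z - a j) / (1 - cnj (a j) * z))"
    unfolding finite_blaschke_def by blast
  show ?thesis
  proof (rule that[of a])
    show "cmod (B z) = (\<Prod>j=1..n. pseudo_dist z (a j))" if "cmod z < 1" for z
      using B that by (simp add: norm_mult pseudo_dist_def flip: prod_norm)
  qed (use a in auto)
qed

lemma finite_blaschke_factor:
  "cmod w < 1 \<Longrightarrow> finite_blaschke 1 (\<lambda>z. (z - w) / (1 - cnj w * z))"
  unfolding finite_blaschke_def by (intro exI[of _ 0] exI[of _ "\<lambda>_. w"]) simp

lemma prod_pseudo_dist_le_iff: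
  assumes J: "finite J" "a ` J \<subseteq> ball 0 1" and z: "cmod z < 1" and s: "0 < s" "s \<le> 1"
  shows "(\<Prod>i\<in>J. pseudo_dist z (a i)) \<le> s \<longleftrightarrow> ennreal (- ln s) \<le> (\<Sum>i\<in>J. green_disk z (a i))"
proof (cases "z \<in> a ` J")
  case True
  then obtain i where i: "i \<in> J" "z = a i" by auto
  then have "pseudo_dist z (a i) = 0" by (simp add: pseudo_dist_def)
  then have "(\<Prod>i\<in>J. pseudo_dist z (a i)) = 0" using i J by (intro prod_zero) auto
  moreover have "(\<Sum>i\<in>J. green_disk z (a i)) = \<infinity>" using True J by (intro sum_green_disk_pole)
  ultimately show ?thesis using s by simp
next
  case False
  have pos: "0 < pseudo_dist z (a i)" if "i \<in> J" for i
  proof -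
    have "cmod (a i) < 1" "z \<noteq> a i" using that J False by auto
    then show ?thesis using pseudo_dist_eq_0_iff[OF z] by (simp add: less_le)
  qed
  have "(\<Sum>i\<in>J. green_disk z (a i)) = ennreal (\<Sum>i\<in>J. green_real z (a i))"
    using z J(2) False by (rule sum_green_disk_eq)
  also have "(\<Sum>i\<in>J. green_real z (a i)) = - ln (\<Prod>i\<in>J. pseudo_dist z (a i))"
    using pos J by (subst ln_prod) (force simp: green_real_def sum_negf)+
  finally have eq: "(\<Sum>i\<in>J. green_disk z (a i)) = ennreal (- ln (\<Prod>i\<in>J. pseudo_dist z (a i)))" .
  have P: "0 < (\<Prod>i\<in>J. pseudo_dist z (a i))" using pos by (intro prod_pos) auto
  have P1: "(\<Prod>i\<in>J. pseudo_dist z (a i)) \<le> 1"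
    using J z by (intro prod_le_1) (auto intro!: less_imp_le[OF pseudo_dist_less_1])
  then have "0 \<le> - ln (\<Prod>i\<in>J. pseudo_dist z (a i))" using P by simp
  then show ?thesis unfolding eq using s P by (simp add: ennreal_le_iff)
qed

lemma pseudo_dist_le_exp_inf_green:
  assumes "infinite E" "E \<subseteq> ball 0 1" "z \<in> E" "cmod w < 1"
  shows "pseudo_dist z w \<le> exp (- enn2real (inf_green E w))"
proof -
  let ?d = "inf_green E w"
  have "ennreal (enn2real ?d) = ?d" using inf_green_finite[OF assms(1,2,4)] by simp
  also have "?d \<le> green_disk w z" using assms by (intro inf_green_le)
  also have "\<dots> = green_disk z w" using assms by (intro green_disk_commute) auto
  finally show ?thesis
    using assms prod_pseudo_dist_le_iff[of "{()}" "\<lambda>_. w" z "exp (- enn2real ?d)"] by auto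
qed

lemma sup_norm_on_upper:
  assumes "z \<in> E" "\<And>z. z \<in> E \<Longrightarrow> cmod (f z) \<le> b"
  shows "cmod (f z) \<le> sup_norm_on E f"
  unfolding sup_norm_on_def using assms by (intro cSUP_upper bdd_aboveI2)

lemma sup_norm_on_least:
  assumes "E \<noteq> {}" "\<And>z. z \<in> E \<Longrightarrow> cmod (f z) \<le> b"
  shows "sup_norm_on E f \<le> b"
  unfolding sup_norm_on_def using assms by (intro cSUP_least)

lemma blaschke_product_inequality:
  fixes n :: "nat \<Rightarrow> nat" and B :: "nat \<Rightarrow> complex \<Rightarrow> complex"
  assumes eq: "green_equilibrium_measure E \<mu>" and E: "compact E" "E \<subseteq> ball 0 1"
    and V: "min_green_energy E < \<infinity>"
    and \<sigma>: "inf_green_riesz_measure E \<sigma>"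
    and B: "\<forall>k\<in>{1..m}. finite_blaschke (n k) (B k)"
  shows "(\<Prod>k=1..m. sup_norm_on E (B k))
    \<le> exp (- (real (\<Sum>k=1..m. n k) * green_constant E \<mu> \<sigma>))
      * sup_norm_on E (\<lambda>z. \<Prod>k=1..m. B k z) powr measure \<sigma> (ball 0 1)"
proof -
  let ?s = "measure \<sigma> (ball 0 1)"
  have inf: "infinite E" using green_equilibrium_infinite[OF eq E V] .
  then have ne: "E \<noteq> {}" by auto
  have "\<forall>k\<in>{1..m}. \<exists>a. (\<forall>j\<in>{1..n k}. cmod (a j) < 1)
      \<and> (\<forall>z. cmod z < 1 \<longrightarrow> cmod (B k z) = (\<Prod>j=1..n k. pseudo_dist z (a j)))"
  proof
    fix k assume "k \<in> {1..m}"
    then have "finite_blaschke (n k) (B k)" using B by blast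
    then show "\<exists>a. (\<forall>j\<in>{1..n k}. cmod (a j) < 1)
      \<and> (\<forall>z. cmod z < 1 \<longrightarrow> cmod (B k z) = (\<Prod>j=1..n k. pseudo_dist z (a j)))"
      by (elim finite_blaschkeE) blast
  qed
  from bchoice[OF this] obtain a where
    a1: "\<And>k j. k \<in> {1..m} \<Longrightarrow> j \<in> {1..n k} \<Longrightarrow> cmod (a k j) < 1" and
    Bk: "\<And>k z. k \<in> {1..m} \<Longrightarrow> cmod z < 1 \<Longrightarrow> cmod (B k z) = (\<Prod>j=1..n k. pseudo_dist z (a k j))"
    by blast
  define J where "J = (SIGMA k:{1..m}. {1..n k})"
  let ?a = "\<lambda>i. a (fst i) (snd i)"
  have J: "finite J" "?a ` J \<subseteq> ball 0 1" using a1 by (auto simp: J_def)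
  have card: "card J = (\<Sum>k=1..m. n k)" by (simp add: J_def)
  have E1: "cmod z < 1" if "z \<in> E" for z using that E by auto
  let ?P = "\<lambda>z. \<Prod>k=1..m. B k z"
  have P: "cmod (?P z) = (\<Prod>i\<in>J. pseudo_dist z (?a i))" if "cmod z < 1" for z
    unfolding J_def using that Bk
    by (simp add: prod.Sigma[symmetric] case_prod_unfold flip: prod_norm)
      (simp add: prod.Sigma case_prod_unfold)
  have P1: "cmod (?P z) \<le> 1" if "cmod z < 1" for z
    unfolding P[OF that] using that J
    by (intro prod_le_1) (auto intro!: less_imp_le[OF pseudo_dist_less_1])
  let ?S = "sup_norm_on E ?P"
  let ?e = "\<lambda>k. \<Prod>j=1..n k. exp (- enn2real (inf_green E (a k j)))"
  have upper: "cmod (?P z) \<le> ?S" if "z \<in> E" for z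
    using that P1 E1 by (intro sup_norm_on_upper) auto
  have S1: "?S \<le> 1" using ne P1 E1 by (intro sup_norm_on_least) blast+
  have S0: "0 < ?S"
  proof -
    have "\<not> E \<subseteq> ?a ` J" using inf J finite_subset by blast
    then obtain z where z: "z \<in> E" "z \<notin> ?a ` J" by blast
    have "0 < (\<Prod>i\<in>J. pseudo_dist z (?a i))"
    proof (rule prod_pos)
      fix i assume i: "i \<in> J"
      then have "cmod (?a i) < 1" "z \<noteq> ?a i" using J z by auto
      then show "0 < pseudo_dist z (?a i)" using pseudo_dist_eq_0_iff[OF E1[OF z(1)]] by (simp add: less_le)
    qed
    then show ?thesis using upper[OF z(1)] P[OF E1[OF z(1)]] by simp
  qed
  have L: "ennreal (- ln ?S) \<le> (\<Sum>i\<in>J. green_disk z (?a i))" if "z \<in> E" for z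
    using upper[OF that] P[OF E1[OF that]] prod_pseudo_dist_le_iff[OF J E1[OF that] S0 S1] by simp
  have key: "real (card J) * green_constant E \<mu> \<sigma> + (- ln ?S) * ?s \<le> (\<Sum>i\<in>J. enn2real (inf_green E (?a i)))"
    using S0 S1 by (intro sum_inf_green_ge[OF eq E V \<sigma> J L]) auto
  have "(\<Prod>k=1..m. sup_norm_on E (B k)) \<le> (\<Prod>k=1..m. ?e k)"
  proof (rule prod_mono)
    fix k assume k: "k \<in> {1..m}"
    have "sup_norm_on E (B k) \<le> ?e k"
    proof (rule sup_norm_on_least[OF ne])
      fix z assume z: "z \<in> E"
      show "cmod (B k z) \<le> ?e k"
        unfolding Bk[OF k E1[OF z]]
        using pseudo_dist_le_exp_inf_green[OF inf E(2) z a1[OF k]] by (intro prod_mono) auto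
    qed
    moreover have "0 \<le> sup_norm_on E (B k)"
    proof -
      obtain z where z: "z \<in> E" using ne by auto
      have "cmod (B k z) \<le> 1" if "z \<in> E" for z
        unfolding Bk[OF k E1[OF that]] using E1[OF that] a1[OF k]
        by (intro prod_le_1) (auto intro!: less_imp_le[OF pseudo_dist_less_1])
      then have "cmod (B k z) \<le> sup_norm_on E (B k)" using z by (intro sup_norm_on_upper)
      then show ?thesis using norm_ge_zero order_trans by blast
    qed
    ultimately show "0 \<le> sup_norm_on E (B k) \<and> sup_norm_on E (B k) \<le> ?e k"
      by simp
  qed
  also have "\<dots> = exp (- (\<Sum>i\<in>J. enn2real (inf_green E (?a i))))"
    unfolding J_def by (simp add: prod.Sigma case_prod_unfold exp_sum sum_negf[symmetric])
  also have "\<dots> \<le> exp (- (real (card J) * green_constant E \<mu> \<sigma>) + ?s * ln ?S)"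
    using key by (simp add: mult.commute)
  also have "\<dots> = exp (- (real (card J) * green_constant E \<mu> \<sigma>)) * ?S powr ?s"
    using S0 unfolding exp_add powr_def by simp
  finally show ?thesis unfolding card .
qed

section \<open>A space-filling curve\<close>

lemma ex_binary_digits:
  assumes "0 \<le> x" "x \<le> (1::real)"
  shows "\<exists>b. (\<forall>k. b k = 0 \<or> b k = 1) \<and> (\<lambda>k. b k * (1 / 2) ^ Suc k) sums x"
proof -
  define r where "r = rec_nat x (\<lambda>_ y. if 1 / 2 \<le> y then 2 * y - 1 else 2 * y)"
  have r0: "r 0 = x" and rS: "r (Suc k) = (if 1 / 2 \<le> r k then 2 * r k - 1 else 2 * r k)" for k
    by (simp_all add: r_def)
  define b where "b k = (if 1 / 2 \<le> r k then 1 else 0 :: real)" for k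
  have r01: "0 \<le> r k \<and> r k \<le> 1" for k
    by (induction k) (auto simp: r0 rS assms)
  have part: "(\<Sum>k<n. b k * (1 / 2) ^ Suc k) = x - r n * (1 / 2) ^ n" for n
    by (induction n) (auto simp: r0 rS b_def field_simps)
  have "(\<lambda>n. r n * (1 / 2) ^ n) \<longlonglongrightarrow> 0"
  proof (rule Lim_null_comparison)
    show "\<forall>\<^sub>F n in sequentially. norm (r n * (1 / 2) ^ n) \<le> (1 / 2) ^ n"
      using r01 by (intro always_eventually allI) (simp add: abs_mult mult_left_le_one_le)
  qed (intro LIMSEQ_power_zero, simp)
  then have "(\<lambda>n. x - r n * (1 / 2) ^ n) \<longlonglongrightarrow> x - 0" by (intro tendsto_diff tendsto_const)
  then have "(\<lambda>k. b k * (1 / 2) ^ Suc k) sums x" unfolding sums_def part by simp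
  then show ?thesis by (intro exI[of _ b]) (auto simp: b_def)
qed

text \<open>
  An even continuous wave of period \<open>2\<close> that is \<open>0\<close> on \<open>{0..1/3}\<close> and \<open>1\<close> on \<open>{2/3..1}\<close>.
\<close>

definition digit_wave :: "real \<Rightarrow> real" where
  "digit_wave x = max 0 (min 1 (1 / 2 - cos (pi * x)))"

lemma digit_wave_continuous: "continuous_on UNIV digit_wave"
  unfolding digit_wave_def[abs_def] by (intro continuous_intros)

lemma digit_wave_bounds: "0 \<le> digit_wave x" "digit_wave x \<le> 1"
  by (auto simp: digit_wave_def)

lemma digit_wave_periodic: "digit_wave (x + 2 * real n) = digit_wave x"
proof -
  have "cos (pi * (x + 2 * real n)) = cos (pi * x + real n * (2 * pi))" by (simp add: algebra_simps)
  also have "\<dots> = cos (pi * x)" using cos.plus_of_nat[of "pi * x" n] by simp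
  finally show ?thesis by (simp add: digit_wave_def)
qed

lemma digit_wave_digit:
  assumes "d = 0 \<or> d = 1" "0 \<le> s" "s \<le> 1"
  shows "digit_wave (2 * d / 3 + s / 3) = d"
proof -
  from assms(1) show ?thesis
  proof
    assume d: "d = 0"
    have "cos (pi / 3) \<le> cos (pi * (s / 3))"
      using assms by (intro cos_monotone_0_pi_le) (auto simp: field_simps)
    then show ?thesis by (simp add: d digit_wave_def cos_60)
  next
    assume d: "d = 1"
    have "cos (pi / 3) \<le> cos (pi * (1 / 3 - s / 3))"
      using assms by (intro cos_monotone_0_pi_le) (auto simp: field_simps)
    moreover have "pi * (2 / 3 + s / 3) = pi - pi * (1 / 3 - s / 3)" by (simp add: field_simps)
    then have "cos (pi * (2 / 3 + s / 3)) = - cos (pi * (1 / 3 - s / 3))" by (simp only: cos_pi_minus)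
    ultimately show ?thesis by (simp add: d digit_wave_def cos_60)
  qed
qed

definition schoenberg :: "nat \<Rightarrow> real \<Rightarrow> real" where
  "schoenberg c t = (\<Sum>k. digit_wave (3 ^ (2 * k + c) * t) * (1 / 2) ^ Suc k)"

lemma schoenberg_continuous: "continuous_on UNIV (schoenberg c)"
proof (rule uniform_limit_theorem)
  show "uniform_limit UNIV (\<lambda>n t. \<Sum>k<n. digit_wave (3 ^ (2 * k + c) * t) * (1 / 2) ^ Suc k)
      (schoenberg c) sequentially"
    unfolding schoenberg_def[abs_def]
  proof (rule Weierstrass_m_test)
    show "norm (digit_wave (3 ^ (2 * k + c) * t) * (1 / 2) ^ Suc k) \<le> (1 / 2) ^ Suc k" for k t
      using digit_wave_bounds by (simp add: abs_mult mult_left_le_one_le)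
    show "summable (\<lambda>k. (1 / 2 :: real) ^ Suc k)" using power_half_series sums_summable by blast
  qed
  show "\<forall>\<^sub>F n in sequentially. continuous_on UNIV (\<lambda>t. \<Sum>k<n. digit_wave (3 ^ (2 * k + c) * t) * (1 / 2) ^ Suc k)"
    by (intro always_eventually allI continuous_intros
        continuous_on_compose2[OF digit_wave_continuous]) auto
qed simp

text \<open>
  Schoenberg's curve. If \<open>t\<close> has the ternary digits \<open>2 * a k\<close> with \<open>a k \<in> {0, 1}\<close>, then
  \<^term>\<open>digit_wave (3 ^ k * t)\<close> is the digit \<open>a k\<close>, and the two coordinates of the curve are the
  binary numbers formed from the digits with even and with odd index.
\<close>

lemma schoenberg_surj:
  assumes "0 \<le> x" "x \<le> 1" "0 \<le> y" "y \<le> 1"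
  shows "\<exists>t\<in>{0..1}. schoenberg 0 t = x \<and> schoenberg 1 t = y"
proof -
  obtain b where b: "\<And>k. b k = 0 \<or> b k = (1::real)" "(\<lambda>k. b k * (1 / 2) ^ Suc k) sums x"
    using ex_binary_digits assms by metis
  obtain b' where b': "\<And>k. b' k = 0 \<or> b' k = (1::real)" "(\<lambda>k. b' k * (1 / 2) ^ Suc k) sums y"
    using ex_binary_digits assms by metis
  define a where "a k = (if even k then b (k div 2) else b' (k div 2))" for k
  have a: "a k = 0 \<or> a k = 1" for k using b(1) b'(1) by (simp add: a_def)
  define tail where "tail k = (\<Sum>i. 2 * a (k + i) * (1 / 3) ^ Suc i)" for k
  have gs: "(\<lambda>i. 2 * (1 / 3 :: real) ^ Suc i) sums 1"
    using sums_mult[OF geometric_sums[of "1 / 3 :: real"], of "2 / 3"] by (simp add: field_simps)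
  have term_le: "norm (2 * a (k + i) * (1 / 3) ^ Suc i) \<le> 2 * (1 / 3) ^ Suc i" for k i
    using a[of "k + i"] by auto
  have summ: "summable (\<lambda>i. 2 * a (k + i) * (1 / 3) ^ Suc i)" for k
    by (rule summable_comparison_test'[OF sums_summable[OF gs], of 0]) (rule term_le)
  have tail01: "0 \<le> tail k" "tail k \<le> 1" for k
  proof -
    show "0 \<le> tail k" unfolding tail_def
    proof (intro suminf_nonneg summ)
      show "0 \<le> 2 * a (k + n) * (1 / 3) ^ Suc n" for n using a[of "k + n"] by auto
    qed
    have "tail k \<le> (\<Sum>i. 2 * (1 / 3) ^ Suc i)" unfolding tail_def
    proof (intro suminf_le summ sums_summable[OF gs])
      show "2 * a (k + n) * (1 / 3) ^ Suc n \<le> 2 * (1 / 3) ^ Suc n" for n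
        using term_le[of k n] by (simp add: abs_le_iff)
    qed
    then show "tail k \<le> 1" using sums_unique[OF gs] by simp
  qed
  have tail_step: "tail k = 2 * a k / 3 + tail (Suc k) / 3" for k
  proof -
    have "(\<Sum>i. 2 * a (k + Suc i) * (1 / 3) ^ Suc (Suc i)) = tail k - 2 * a (k + 0) * (1 / 3) ^ Suc 0"
      unfolding tail_def by (rule suminf_split_head[OF summ])
    moreover have "(\<Sum>i. 2 * a (k + Suc i) * (1 / 3) ^ Suc (Suc i)) = tail (Suc k) * (1 / 3)"
      unfolding tail_def by (subst suminf_mult2[OF summ]) (simp add: mult_ac)
    ultimately show ?thesis by simp
  qed
  have shift: "\<exists>n. 3 ^ k * tail 0 = tail k + 2 * real n" for k
  proof (induction k)
    case 0 show ?case by (intro exI[of _ 0]) simp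
  next
    case (Suc k)
    then obtain n where n: "3 ^ k * tail 0 = tail k + 2 * real n" by blast
    have "3 ^ Suc k * tail 0 = 3 * tail k + 6 * real n" using n by simp
    also have "\<dots> = tail (Suc k) + 2 * (a k + 3 * real n)" by (subst tail_step) simp
    also have "a k + 3 * real n = real ((if a k = 0 then 0 else 1) + 3 * n)" using a[of k] by auto
    finally show ?case by blast
  qed
  have digit: "digit_wave (3 ^ k * tail 0) = a k" for k
  proof -
    obtain n where "3 ^ k * tail 0 = tail k + 2 * real n" using shift by blast
    then have "digit_wave (3 ^ k * tail 0) = digit_wave (tail k)" by (simp add: digit_wave_periodic)
    also have "\<dots> = digit_wave (2 * a k / 3 + tail (Suc k) / 3)" by (subst tail_step) simp
    also have "\<dots> = a k" using a tail01 by (intro digit_wave_digit)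
    finally show ?thesis .
  qed
  have "schoenberg 0 (tail 0) = x" "schoenberg 1 (tail 0) = y"
    unfolding schoenberg_def digit using sums_unique[OF b(2)] sums_unique[OF b'(2)]
    by (simp_all add: a_def)
  then show ?thesis using tail01[of 0] by auto
qed

lemma ex_space_filling_curve:
  "\<exists>\<phi> :: real \<Rightarrow> complex. continuous_on UNIV \<phi> \<and> ball 0 1 \<subseteq> \<phi> ` {0..1}"
proof (intro exI conjI)
  let ?\<phi> = "\<lambda>t. Complex (2 * schoenberg 0 t - 1) (2 * schoenberg 1 t - 1)"
  show "continuous_on UNIV ?\<phi>"
    unfolding Complex_eq by (intro continuous_intros schoenberg_continuous)
  show "ball 0 1 \<subseteq> ?\<phi> ` {0..1}"
  proof
    fix z :: complex assume "z \<in> ball 0 1"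
    then have "cmod z < 1" by simp
    then have "\<bar>Re z\<bar> < 1" "\<bar>Im z\<bar> < 1"
      using abs_Re_le_cmod[of z] abs_Im_le_cmod[of z] by linarith+
    then have "\<exists>t\<in>{0..1}. schoenberg 0 t = (Re z + 1) / 2 \<and> schoenberg 1 t = (Im z + 1) / 2"
      by (intro schoenberg_surj) auto
    then obtain t where "t \<in> {0..1}" "schoenberg 0 t = (Re z + 1) / 2" "schoenberg 1 t = (Im z + 1) / 2"
      by blast
    then show "z \<in> ?\<phi> ` {0..1}" by (intro image_eqI[of _ _ t]) (auto simp: complex_eq_iff)
  qed
qed

section \<open>Compact sets carrying no measure of finite energy\<close>

text \<open>
  The index \<open>n\<close> stands for the \<open>n + 1\<close> points \<open>w 0, ..., w n\<close>, so that the sample is never empty.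
\<close>

definition empirical_measure :: "nat \<Rightarrow> (nat \<Rightarrow> 'a::topological_space) \<Rightarrow> 'a measure" where
  "empirical_measure n w = distr (measure_pmf (pmf_of_set {..n})) borel w"

lemma empirical_measure:
  fixes w :: "nat \<Rightarrow> 'a::topological_space"
  shows "sets (empirical_measure n w) = sets borel" "prob_space (empirical_measure n w)"
    and "f \<in> borel_measurable borel \<Longrightarrow>
      (\<integral>\<^sup>+ x. f x \<partial>empirical_measure n w) = (\<Sum>i\<le>n. f (w i)) / of_nat (Suc n)"
    and "{x \<in> space borel. P x} \<in> sets borel \<Longrightarrow> (\<And>i. P (w i)) \<Longrightarrow> AE x in empirical_measure n w. P x"
proof -
  show "sets (empirical_measure n w) = sets borel" by (simp add: empirical_measure_def)
  show "prob_space (empirical_measure n w)"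
    unfolding empirical_measure_def
    by (intro prob_space.prob_space_distr[OF prob_space_measure_pmf]) simp
  show "(\<integral>\<^sup>+ x. f x \<partial>empirical_measure n w) = (\<Sum>i\<le>n. f (w i)) / of_nat (Suc n)"
    if "f \<in> borel_measurable borel"
    unfolding empirical_measure_def using that
    by (subst nn_integral_distr) (auto simp: nn_integral_pmf_of_set simp del: of_nat_Suc)
  show "AE x in empirical_measure n w. P x" if "{x \<in> space borel. P x} \<in> sets borel" "\<And>i. P (w i)"
    unfolding empirical_measure_def using that by (subst AE_distr_iff) auto
qed

lemma ennreal_of_nat_mult_divide: "0 < m \<Longrightarrow> of_nat m * x / of_nat m = (x::ennreal)"
  by (subst mult.commute, rule mult_divide_eq_ennreal) auto

text \<open>
  Off the diagonal every pair occurs twice, and twice the sum of \<open>j * K\<close> over \<open>j < n\<close> is at most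
  \<open>n\<^sup>2 * K\<close>.
\<close>

lemma sum_pairs_le:
  fixes h :: "nat \<Rightarrow> nat \<Rightarrow> ennreal"
  assumes diag: "\<And>i. h i i \<le> M" and sym: "\<And>i j. h i j = h j i"
    and row: "\<And>j. (\<Sum>i<j. h j i) \<le> of_nat j * K"
  shows "(\<Sum>i<n. \<Sum>j<n. h i j) \<le> of_nat n * M + of_nat (n * n) * K"
proof (induction n)
  case (Suc n)
  have "(\<Sum>i<Suc n. \<Sum>j<Suc n. h i j) = (\<Sum>i<n. \<Sum>j<n. h i j) + (\<Sum>i<n. h i n) + (\<Sum>j<n. h n j) + h n n"
    by (simp add: sum.distrib ac_simps)
  also have "(\<Sum>i<n. h i n) = (\<Sum>j<n. h n j)" by (intro sum.cong sym refl)
  also have "(\<Sum>i<n. \<Sum>j<n. h i j) + (\<Sum>j<n. h n j) + (\<Sum>j<n. h n j) + h n n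
      \<le> (of_nat n * M + of_nat (n * n) * K) + of_nat n * K + of_nat n * K + M"
    by (intro add_mono Suc row diag)
  also have "\<dots> \<le> of_nat (Suc n) * M + (of_nat (n * n) * K + of_nat n * K + of_nat n * K + K)"
    by (simp add: distrib_right add_ac)
  also have "of_nat (n * n) * K + of_nat n * K + of_nat n * K + K = of_nat (Suc n * Suc n) * K"
    by (simp add: distrib_right distrib_left add_ac)
  finally show ?case .
qed simp

text \<open>
  This rests on the weak compactness of the probability measures on \<open>S\<close>. The points are lifted to the unit interval along the
  space-filling curve; there Helly's theorem gives a weak limit of the empirical measures and
  Skorohod's theorem realises the convergence pointwise, so that Fatou's lemma bounds the energy of
  the limit. The kernel is cut off at height \<open>sqrt (n + 1)\<close>: high enough not to be felt in
  the limit, low enough to make the diagonal terms negligible.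
\<close>

lemma ex_measure_energy_le:
  assumes S: "compact S" "S \<subseteq> ball 0 1"
    and w: "\<And>i. w i \<in> S" and K: "0 \<le> K"
    and row: "\<And>j. (\<Sum>i<j. green_disk (w j) (w i)) \<le> of_nat j * ennreal K"
  shows "\<exists>\<nu> \<in> unit_borel_measures_on S. green_energy \<nu> \<le> ennreal K"
proof -
  obtain \<phi> :: "real \<Rightarrow> complex" where \<phi>: "continuous_on UNIV \<phi>" "ball 0 1 \<subseteq> \<phi> ` {0..1}"
    using ex_space_filling_curve by blast
  have [measurable]: "\<phi> \<in> borel_measurable borel" using \<phi>(1) by (rule borel_measurable_continuous_onI)
  have clS: "closed S" using S compact_imp_closed by blast
  then have Sb [measurable]: "S \<in> sets borel" by simp
  have "\<exists>t. t \<in> {0..1} \<and> \<phi> t = w i" for i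
    using \<phi>(2) w[of i] S(2) by (metis imageE subsetD)
  then obtain t where t: "\<And>i. t i \<in> {0..1}" "\<And>i. \<phi> (t i) = w i" by metis
  define \<mu> where "\<mu> n = empirical_measure n t" for n
  have rd: "real_distribution (\<mu> n)" for n
    unfolding real_distribution_def real_distribution_axioms_def \<mu>_def
    using empirical_measure(1,2)[of n t] sets_eq_imp_space_eq[OF empirical_measure(1)[of n t]] by simp
  have "tight \<mu>"
    unfolding tight_def
  proof (intro conjI allI impI)
    fix e :: real assume e: "0 < e"
    have "1 - e < measure (\<mu> n) {-1<..1}" for n
    proof -
      interpret real_distribution "\<mu> n" by (rule rd)
      have "AE x in \<mu> n. x \<in> {-1<..1}"
        unfolding \<mu>_def
      proof (rule empirical_measure(4))
        show "t i \<in> {-1<..1}" for i using t(1)[of i] by auto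
      qed simp
      then have "prob {-1<..1} = 1" by (subst prob_eq_1) auto
      then show ?thesis using e by simp
    qed
    then show "\<exists>a b. a < b \<and> (\<forall>n. 1 - e < measure (\<mu> n) {a<..b})"
      by (intro exI[of _ "-1"] exI[of _ 1]) auto
  qed (rule rd)
  then obtain r M where r: "strict_mono (r :: nat \<Rightarrow> nat)" and M: "real_distribution M"
    and conv: "weak_conv_m (\<lambda>n. \<mu> (r n)) M"
    using tight_imp_convergent_subsubsequence[of \<mu> id] by (auto simp: o_def strict_mono_def)
  obtain \<Omega> :: "real measure" and Y_seq Y where \<Omega>: "prob_space \<Omega>"
    and Ym: "\<And>n. Y_seq n \<in> borel_measurable \<Omega>" and Yd: "\<And>n. distr \<Omega> borel (Y_seq n) = \<mu> (r n)"
    and Y [measurable]: "Y \<in> borel_measurable \<Omega>"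
    and Ylim: "\<And>x. x \<in> space \<Omega> \<Longrightarrow> (\<lambda>n. Y_seq n x) \<longlonglongrightarrow> Y x"
    using Skorohod[of "\<lambda>n. \<mu> (r n)", OF rd M conv] unfolding measurable_lborel1 by blast
  note [measurable] = Ym
  interpret prob_space \<Omega> by fact
  define X where "X n x = \<phi> (Y_seq n x)" for n x
  define X' where "X' x = \<phi> (Y x)" for x
  have [measurable]: "X n \<in> borel_measurable \<Omega>" "X' \<in> borel_measurable \<Omega>" for n
    unfolding X_def[abs_def] X'_def[abs_def] by measurable
  have Xlim: "(\<lambda>n. X n x) \<longlonglongrightarrow> X' x" if "x \<in> space \<Omega>" for x
    unfolding X_def X'_def using continuous_on_tendsto_compose[OF \<phi>(1) Ylim[OF that]] by simp
  have int: "(\<integral>\<^sup>+ x. f (X n x) \<partial>\<Omega>) = (\<Sum>i\<le>r n. f (w i)) / of_nat (Suc (r n))"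
    if [measurable]: "f \<in> borel_measurable borel" for f n
  proof -
    have "(\<integral>\<^sup>+ x. f (X n x) \<partial>\<Omega>) = (\<integral>\<^sup>+ y. f (\<phi> y) \<partial>\<mu> (r n))"
      unfolding X_def Yd[symmetric] by (subst nn_integral_distr) auto
    also have "\<dots> = (\<Sum>i\<le>r n. f (w i)) / of_nat (Suc (r n))"
      unfolding \<mu>_def by (subst empirical_measure(3)) (auto simp: t(2))
    finally show ?thesis .
  qed
  have "AE x in \<Omega>. \<forall>n. X n x \<in> S"
  proof (subst AE_all_countable, rule allI)
    fix n
    have "AE y in distr \<Omega> borel (Y_seq n). \<phi> y \<in> S"
      unfolding Yd \<mu>_def using w by (intro empirical_measure(4)) (auto simp: t(2))
    then show "AE x in \<Omega>. X n x \<in> S" unfolding X_def by (subst (asm) AE_distr_iff) auto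
  qed
  then have X'S: "AE x in \<Omega>. X' x \<in> S"
    using AE_space
  proof eventually_elim
    case (elim x)
    then show ?case by (intro closed_sequentially[OF clS _ Xlim[of x]]) auto
  qed
  define \<nu> where "\<nu> = distr \<Omega> borel X'"
  have "\<nu> \<in> unit_borel_measures_on S"
  proof (rule unit_borel_measures_onI)
    show "prob_space \<nu>" unfolding \<nu>_def by (intro prob_space_distr) simp
    show "AE x in \<nu>. x \<in> S" unfolding \<nu>_def using X'S by (subst AE_distr_iff) auto
  qed (auto simp: \<nu>_def)
  moreover have "green_energy \<nu> \<le> ennreal K"
  proof -
    define q where "q n = sqrt (real (Suc n))" for n
    have q0: "0 \<le> q n" for n by (simp add: q_def)
    define g where "g n x y = min (green_disk x y) (ennreal (q n))" for n x y
    let ?F = "\<lambda>n x. \<integral>\<^sup>+ y. g n (X n x) (X n y) \<partial>\<Omega>"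
    let ?I = "\<lambda>n. \<integral>\<^sup>+ x. ?F n x \<partial>\<Omega>"
    have gm: "(\<lambda>y. g n x y) \<in> borel_measurable borel" for n x unfolding g_def by measurable
    have [measurable]: "(\<lambda>p. g n (fst p) (snd p)) \<in> borel_measurable (borel \<Otimes>\<^sub>M borel)" for n
      unfolding g_def by measurable
    have inner: "(\<lambda>x. \<integral>\<^sup>+ y. g n x (X n y) \<partial>\<Omega>) \<in> borel_measurable borel" for n
      by (subst int[OF gm]) (unfold g_def, measurable)
    have sqrt_top: "(\<lambda>n. ennreal (q n)) \<longlonglongrightarrow> top"
      unfolding ennreal_tendsto_top_eq_at_top q_def
      by (intro filterlim_compose[OF sqrt_at_top] filterlim_compose[OF filterlim_real_sequentially] filterlim_Suc)
    have glim: "(\<lambda>n. g n (X n x) (X n y)) \<longlonglongrightarrow> green_disk (X' x) (X' y)"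
      if "x \<in> space \<Omega>" "y \<in> space \<Omega>" "X' x \<in> S" "X' y \<in> S" for x y
    proof -
      have "cmod (X' x) < 1" "cmod (X' y) < 1" using that S by auto
      then have "(\<lambda>n. g n (X n x) (X n y)) \<longlonglongrightarrow> min (green_disk (X' x) (X' y)) top"
        unfolding g_def using that by (intro tendsto_min tendsto_green_disk sqrt_top Xlim)
      then show ?thesis by (simp add: min_absorb1)
    qed
    have pair: "?I n \<le> ennreal (1 / q n + K)" for n
    proof -
      let ?N = "Suc (r n)"
      have nN: "Suc n \<le> ?N" using seq_suble[OF r] by simp
      have "?I n = (\<Sum>i\<le>r n. \<integral>\<^sup>+ y. g n (w i) (X n y) \<partial>\<Omega>) / of_nat ?N"
        by (rule int[OF inner])
      also have "\<dots> = (\<Sum>i\<le>r n. (\<Sum>j\<le>r n. g n (w i) (w j)) / of_nat ?N) / of_nat ?N"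
        by (simp only: int[OF gm])
      also have "\<dots> = (\<Sum>i<?N. \<Sum>j<?N. g n (w i) (w j)) / of_nat ?N / of_nat ?N"
          by (simp only: lessThan_Suc_atMost divide_ennreal_def sum_distrib_right)
      also have "\<dots> \<le> (of_nat ?N * ennreal (q n) + of_nat (?N * ?N) * ennreal K) / of_nat ?N / of_nat ?N"
      proof (intro divide_right_mono_ennreal sum_pairs_le)
        show "g n (w i) (w i) \<le> ennreal (q n)" for i by (simp add: g_def)
        show "g n (w i) (w j) = g n (w j) (w i)" for i j
        proof -
          have "cmod (w i) < 1" "cmod (w j) < 1" using w[of i] w[of j] S by auto
          then show ?thesis by (simp add: g_def green_disk_commute)
        qed
        show "(\<Sum>i<j. g n (w j) (w i)) \<le> of_nat j * ennreal K" for j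
          using row[of j] by (rule order_trans[rotated]) (auto simp: g_def intro!: sum_mono)
      qed
      also have "\<dots> = ennreal (q n / real ?N) + ennreal K"
      proof -
        have "(of_nat ?N * ennreal (q n) + of_nat (?N * ?N) * ennreal K) / of_nat ?N / of_nat ?N
            = (of_nat ?N * (ennreal (q n) + of_nat ?N * ennreal K)) / of_nat ?N / of_nat ?N"
          by (simp only: distrib_left mult.assoc of_nat_mult)
        also have "\<dots> = (ennreal (q n) + of_nat ?N * ennreal K) / of_nat ?N"
          by (subst ennreal_of_nat_mult_divide) auto
        also have "\<dots> = ennreal (q n) / of_nat ?N + ennreal K"
          unfolding add_divide_distrib_ennreal by (subst ennreal_of_nat_mult_divide) auto
        also have "ennreal (q n) / of_nat ?N = ennreal (q n / real ?N)"
          unfolding ennreal_of_nat_eq_real_of_nat using q0 by (intro divide_ennreal) auto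
        finally show ?thesis .
      qed
      also have "\<dots> \<le> ennreal (1 / q n) + ennreal K"
      proof (intro add_right_mono ennreal_leI)
        have "q n / real ?N \<le> q n / real (Suc n)"
          using nN q0 by (intro divide_left_mono) auto
        also have "\<dots> = 1 / q n"
          using real_sqrt_mult_self[of "real (Suc n)"] by (simp add: q_def divide_simps del: of_nat_Suc)
        finally show "q n / real ?N \<le> 1 / q n" .
      qed
      finally show ?thesis
        using K q0 by (subst ennreal_plus) auto
    qed
    have in\<nu>: "(\<integral>\<^sup>+ v. green_disk z v \<partial>\<nu>) = (\<integral>\<^sup>+ y. green_disk z (X' y) \<partial>\<Omega>)" for z
      unfolding \<nu>_def by (subst nn_integral_distr) auto
    have out\<nu>: "(\<lambda>z. \<integral>\<^sup>+ y. green_disk z (X' y) \<partial>\<Omega>) \<in> borel_measurable borel"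
      by (rule borel_measurable_nn_integral) measurable
    have "green_energy \<nu> = (\<integral>\<^sup>+ x. \<integral>\<^sup>+ y. green_disk (X' x) (X' y) \<partial>\<Omega> \<partial>\<Omega>)"
      unfolding green_energy_def in\<nu> unfolding \<nu>_def by (subst nn_integral_distr) (use out\<nu> in auto)
    also have "\<dots> \<le> (\<integral>\<^sup>+ x. liminf (\<lambda>n. ?F n x) \<partial>\<Omega>)"
    proof (rule nn_integral_mono_AE)
      show "AE x in \<Omega>. (\<integral>\<^sup>+ y. green_disk (X' x) (X' y) \<partial>\<Omega>) \<le> liminf (\<lambda>n. ?F n x)"
        using X'S AE_space
      proof eventually_elim
        case (elim x)
        have "(\<integral>\<^sup>+ y. green_disk (X' x) (X' y) \<partial>\<Omega>) = (\<integral>\<^sup>+ y. liminf (\<lambda>n. g n (X n x) (X n y)) \<partial>\<Omega>)"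
        proof (rule nn_integral_cong_AE)
          show "AE y in \<Omega>. green_disk (X' x) (X' y) = liminf (\<lambda>n. g n (X n x) (X n y))"
            using X'S AE_space
          proof eventually_elim
            case (elim y)
            then show ?case using glim[of x y] \<open>X' x \<in> S\<close> \<open>x \<in> space \<Omega>\<close> by (simp add: lim_imp_Liminf)
          qed
        qed
        also have "\<dots> \<le> liminf (\<lambda>n. ?F n x)"
          by (rule nn_integral_liminf) (rule measurable_compose[OF _ gm], measurable)
        finally show ?case .
      qed
    qed
    also have "\<dots> \<le> liminf (\<lambda>n. ?I n)"
      by (rule nn_integral_liminf) (rule measurable_compose[OF _ inner], measurable)
    also have "\<dots> \<le> liminf (\<lambda>n. ennreal (1 / q n + K))"
      by (intro Liminf_mono always_eventually allI pair)
    also have "\<dots> = ennreal K"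
    proof (rule lim_imp_Liminf)
      have "(\<lambda>n. 1 / q n + K) \<longlonglongrightarrow> 0 + K"
        unfolding q_def
        by (intro tendsto_add tendsto_const real_tendsto_divide_at_top[where f = "\<lambda>_. 1" and c = 1]
            filterlim_compose[OF sqrt_at_top] filterlim_compose[OF filterlim_real_sequentially] filterlim_Suc)
      then show "(\<lambda>n. ennreal (1 / q n + K)) \<longlonglongrightarrow> ennreal K" by (intro tendsto_ennrealI) simp
    qed simp
    finally show ?thesis .
  qed
  ultimately show ?thesis by blast
qed

text \<open>
  The points are chosen greedily: as long as the potential of the empirical measure of the points
  chosen so far drops below \<open>K\<close> somewhere on \<open>S\<close>, the next point goes there. If this never
  stops, the empirical measures have bounded energy, against the hypothesis.
\<close>

lemma ex_measure_large_potential: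
  assumes S: "compact S" "S \<subseteq> ball 0 1" "S \<noteq> {}" and K: "0 \<le> K"
    and inf: "\<And>\<nu>. \<nu> \<in> unit_borel_measures_on S \<Longrightarrow> green_energy \<nu> = \<infinity>"
  shows "\<exists>\<tau> \<in> unit_borel_measures_on S. \<forall>z\<in>S. ennreal K \<le> green_potential \<tau> z"
proof (rule ccontr)
  assume neg: "\<not> ?thesis"
  have Sb: "S \<in> sets borel" using S by (simp add: borel_compact)
  have "\<exists>w. \<forall>n. w n \<in> S \<and> (\<Sum>i<n. green_disk (w n) (w i)) \<le> of_nat n * ennreal K"
  proof (rule dependent_wf_choice[where R = less_than
        and P = "\<lambda>f n z. z \<in> S \<and> (\<Sum>i<n. green_disk z (f i)) \<le> of_nat n * ennreal K"])
    fix f g :: "nat \<Rightarrow> complex" and n z assume "\<And>i. (i, n) \<in> less_than \<Longrightarrow> f i = g i"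
    then show "(z \<in> S \<and> (\<Sum>i<n. green_disk z (f i)) \<le> of_nat n * ennreal K)
        = (z \<in> S \<and> (\<Sum>i<n. green_disk z (g i)) \<le> of_nat n * ennreal K)" by simp
  next
    fix n :: nat and f
    assume IH: "\<And>i. (i, n) \<in> less_than \<Longrightarrow> f i \<in> S \<and> (\<Sum>k<i. green_disk (f i) (f k)) \<le> of_nat i * ennreal K"
    show "\<exists>z. z \<in> S \<and> (\<Sum>i<n. green_disk z (f i)) \<le> of_nat n * ennreal K"
    proof (cases n)
      case 0
      then show ?thesis using S(3) by auto
    next
      case (Suc m)
      define f' where "f' i = f (min i m)" for i
      have f'S: "f' i \<in> S" for i using IH[of "min i m"] Suc by (auto simp: f'_def)
      let ?\<tau> = "empirical_measure m f'"
      have "?\<tau> \<in> unit_borel_measures_on S"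
        using empirical_measure(1,2) Sb f'S by (intro unit_borel_measures_onI empirical_measure(4)) auto
      then obtain z where z: "z \<in> S" "green_potential ?\<tau> z < ennreal K"
        using neg by (auto simp: not_le)
      have "(\<Sum>i\<le>m. green_disk z (f' i)) / of_nat (Suc m) \<le> ennreal K"
        using z(2) unfolding green_potential_def by (subst (asm) empirical_measure(3)) auto
      then have "of_nat (Suc m) * ((\<Sum>i\<le>m. green_disk z (f' i)) / of_nat (Suc m)) \<le> of_nat (Suc m) * ennreal K"
        by (rule mult_left_mono) simp
      moreover have "of_nat (Suc m) * ((\<Sum>i\<le>m. green_disk z (f' i)) / of_nat (Suc m)) = (\<Sum>i\<le>m. green_disk z (f' i))"
        unfolding ennreal_times_divide by (rule ennreal_of_nat_mult_divide) simp
      moreover have "(\<Sum>i\<le>m. green_disk z (f' i)) = (\<Sum>i<n. green_disk z (f i))"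
        unfolding Suc lessThan_Suc_atMost by (intro sum.cong) (auto simp: f'_def)
      ultimately show ?thesis using z(1) Suc by auto
    qed
  qed simp
  then obtain w where w: "\<And>n. w n \<in> S" "\<And>n. (\<Sum>i<n. green_disk (w n) (w i)) \<le> of_nat n * ennreal K"
    by blast
  obtain \<nu> where "\<nu> \<in> unit_borel_measures_on S" "green_energy \<nu> \<le> ennreal K"
    using ex_measure_energy_le[OF S(1,2) w(1) K w(2)] by blast
  with inf[of \<nu>] show False by (simp add: top_unique)
qed

section \<open>Sharpness\<close>

text \<open>
  Here \<open>X\<close> is a step function close to the identity, so that \<open>c\<close> and \<open>p\<close> are the points and
  weights of a discrete approximation of \<open>\<mu>\<close>. In each cell the point is chosen where \<open>f\<close> does
  not exceed its mean, so that discretising does not increase the integral of \<open>f\<close>.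
\<close>

lemma ex_discretisation:
  assumes \<mu>: "\<mu> \<in> unit_borel_measures_on E" and E: "compact E"
    and f: "f \<in> borel_measurable borel" "\<And>z. z \<in> E \<Longrightarrow> f z < (\<infinity>::ennreal)"
    and \<delta>: "0 < \<delta>"
  obtains P :: nat and p :: "nat \<Rightarrow> real" and c X :: "_ \<Rightarrow> complex"
  where "\<And>i. i < P \<Longrightarrow> c i \<in> E" "\<And>i. 0 \<le> p i" "(\<Sum>i<P. p i) = 1"
    "X \<in> borel_measurable borel" "\<And>z. z \<in> E \<Longrightarrow> dist (X z) z < \<delta>"
    "\<And>h. (\<integral>\<^sup>+ z. h (X z) \<partial>\<mu>) = (\<Sum>i<P. ennreal (p i) * h (c i))"
    "(\<Sum>i<P. ennreal (p i) * f (c i)) \<le> (\<integral>\<^sup>+ z. f z \<partial>\<mu>)"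
proof -
  interpret prob_space \<mu> using unit_borel_measures_onD(2)[OF \<mu>] .
  note sets = unit_borel_measures_onD(1)[OF \<mu>]
  note [measurable_cong] = sets
  note [measurable] = f(1)
  have Eb [measurable]: "E \<in> sets borel" using E by (simp add: borel_compact)
  have AE_E: "AE z in \<mu>. z \<in> E" using unit_borel_measures_on_AE[OF \<mu> Eb] .
  obtain T where T: "T \<subseteq> E" "finite T" "E \<subseteq> (\<Union>x\<in>T. ball x (\<delta> / 2))"
    by (rule compactE_image[OF E, of E "\<lambda>x. ball x (\<delta> / 2)"]) (use \<delta> in auto)
  obtain P :: nat and e where e: "T = e ` {i. i < P}" using finite_imp_nat_seg_image_inj_on[OF T(2)] by blast
  define A where "A i = E \<inter> (ball (e i) (\<delta> / 2) - (\<Union>j<i. ball (e j) (\<delta> / 2)))" for i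
  let ?fA = "\<lambda>i. \<integral>\<^sup>+ z. f z * indicator (A i) z \<partial>\<mu>"
  have [measurable]: "A i \<in> sets borel" for i unfolding A_def by (intro sets.Int sets.Diff Eb sets.finite_UN) auto
  have A_sub: "A i \<subseteq> E" for i by (auto simp: A_def)
  have A_unique: "i = j" if "z \<in> A i" "z \<in> A j" for z i j
    using that by (cases i j rule: linorder_cases) (auto simp: A_def)
  have A_cover: "\<exists>i<P. z \<in> A i" if z: "z \<in> E" for z
  proof -
    have ex: "\<exists>i. i < P \<and> z \<in> ball (e i) (\<delta> / 2)"
    proof -
      obtain x where x: "x \<in> T" "z \<in> ball x (\<delta> / 2)" using T(3) z by blast
      then obtain i where "i < P" "x = e i" using e by blast
      with x show ?thesis by blast
    qed
    define i where "i = (LEAST i. i < P \<and> z \<in> ball (e i) (\<delta> / 2))"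
    have "i < P \<and> z \<in> ball (e i) (\<delta> / 2)" unfolding i_def using ex by (rule LeastI_ex)
    moreover have "z \<notin> ball (e j) (\<delta> / 2)" if "j < i" for j
      using not_less_Least[of j "\<lambda>i. i < P \<and> z \<in> ball (e i) (\<delta> / 2)"] that calculation by (auto simp: i_def)
    ultimately show ?thesis using z by (auto simp: A_def)
  qed
  have "\<exists>c. i < P \<longrightarrow> c \<in> E \<and> (A i \<noteq> {} \<longrightarrow> c \<in> A i)
      \<and> emeasure \<mu> (A i) * f c \<le> ?fA i" for i
  proof (cases "A i = {}")
    case True
    have "e i \<in> E" if "i < P" using that T(1) e by auto
    then show ?thesis using True by (intro exI[of _ "e i"]) auto
  next
    case False
    have "\<exists>c\<in>A i. emeasure \<mu> (A i) * f c \<le> ?fA i"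
    proof (rule ccontr)
      let ?a = "emeasure \<mu> (A i)"
      let ?I = "?fA i"
      assume "\<not> ?thesis"
      then have lt: "?I < ?a * f z" if "z \<in> A i" for z using that by (auto simp: not_le)
      obtain z0 where z0: "z0 \<in> A i" using False by auto
      have a0: "?a \<noteq> 0" using lt[OF z0] by auto
      have I_fin: "?I < \<infinity>" using lt[OF z0] by (rule order_less_le_trans) simp
      have "?I * ?a = (\<integral>\<^sup>+ z. ?I * indicator (A i) z \<partial>\<mu>)"
        by (subst nn_integral_cmult_indicator) (auto simp: sets)
      also have "\<dots> < (\<integral>\<^sup>+ z. ?a * (f z * indicator (A i) z) \<partial>\<mu>)"
      proof (rule nn_integral_less)
        show "(\<integral>\<^sup>+ z. ?I * indicator (A i) z \<partial>\<mu>) \<noteq> \<infinity>"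
          using I_fin by (subst nn_integral_cmult_indicator) (auto simp: sets ennreal_mult_eq_top_iff)
        show "AE z in \<mu>. ?I * indicator (A i) z \<le> ?a * (f z * indicator (A i) z)"
          using lt by (intro AE_I2) (auto split: split_indicator intro: less_imp_le)
        show "\<not> (AE z in \<mu>. ?a * (f z * indicator (A i) z) \<le> ?I * indicator (A i) z)"
        proof
          assume "AE z in \<mu>. ?a * (f z * indicator (A i) z) \<le> ?I * indicator (A i) z"
          then have "AE z in \<mu>. z \<notin> A i"
            by eventually_elim (use lt in \<open>force split: split_indicator_asm simp: not_le[symmetric]\<close>)
          then have "?a = 0" by (subst AE_iff_measurable[symmetric, of "A i"]) (auto simp: sets unit_borel_measures_onD(3)[OF \<mu>])
          with a0 show False ..
        qed
      qed auto
      also have "\<dots> = ?a * ?I" by (subst nn_integral_cmult) auto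
      finally show False by (simp add: mult.commute)
    qed
    then show ?thesis using A_sub by blast
  qed
  then obtain c where c: "\<And>i. i < P \<Longrightarrow> c i \<in> E" "\<And>i. i < P \<Longrightarrow> A i \<noteq> {} \<Longrightarrow> c i \<in> A i"
    "\<And>i. i < P \<Longrightarrow> emeasure \<mu> (A i) * f (c i) \<le> ?fA i"
    by metis
  define X where "X z = (\<Sum>i<P. indicator (A i) z *\<^sub>R c i)" for z
  have X_eq: "X z = c i" if "i < P" "z \<in> A i" for z i
  proof -
    have "X z = (\<Sum>j<P. if j = i then c i else 0)"
      unfolding X_def using that A_unique by (intro sum.cong) (auto simp: indicator_def)
    then show ?thesis using that by simp
  qed
  have split: "(\<integral>\<^sup>+ z. g z \<partial>\<mu>) = (\<Sum>i<P. \<integral>\<^sup>+ z. g z * indicator (A i) z \<partial>\<mu>)"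
    if [measurable]: "g \<in> borel_measurable borel" for g
  proof -
    have "(\<integral>\<^sup>+ z. g z \<partial>\<mu>) = (\<integral>\<^sup>+ z. (\<Sum>i<P. g z * indicator (A i) z) \<partial>\<mu>)"
    proof (rule nn_integral_cong_AE)
      show "AE z in \<mu>. g z = (\<Sum>i<P. g z * indicator (A i) z)"
        using AE_E
      proof eventually_elim
        case (elim z)
        then obtain i where i: "i < P" "z \<in> A i" using A_cover by blast
        have "(\<Sum>j<P. g z * indicator (A j) z) = (\<Sum>j<P. if j = i then g z else 0)"
          using i A_unique by (intro sum.cong) (auto simp: indicator_def)
        then show ?case using i by simp
      qed
    qed
    also have "\<dots> = (\<Sum>i<P. \<integral>\<^sup>+ z. g z * indicator (A i) z \<partial>\<mu>)"
      by (intro nn_integral_sum) auto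
    finally show ?thesis .
  qed
  define p where "p i = measure \<mu> (A i)" for i
  have p: "ennreal (p i) = emeasure \<mu> (A i)" for i by (simp add: p_def emeasure_eq_measure)
  have [measurable]: "X \<in> borel_measurable borel" unfolding X_def[abs_def] by measurable
  show ?thesis
  proof (rule that[of P c p X])
    show "(\<Sum>i<P. p i) = 1"
    proof -
      have "1 = (\<integral>\<^sup>+ z. 1 \<partial>\<mu>)" by (simp add: emeasure_space_1)
      also have "\<dots> = ennreal (\<Sum>i<P. p i)"
      proof -
        have "(\<integral>\<^sup>+ z. 1 * indicator (A i) z \<partial>\<mu>) = ennreal (p i)" for i
          by (simp add: p sets)
        then have "(\<integral>\<^sup>+ z. 1 \<partial>\<mu>) = (\<Sum>i<P. ennreal (p i))" by (subst split) auto
        also have "\<dots> = ennreal (\<Sum>i<P. p i)" by (intro sum_ennreal) (simp add: p_def)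
        finally show ?thesis .
      qed
      finally show ?thesis by (metis ennreal_eq_1)
    qed
    show "dist (X z) z < \<delta>" if "z \<in> E" for z
    proof -
      obtain i where i: "i < P" "z \<in> A i" using A_cover \<open>z \<in> E\<close> by blast
      then have "c i \<in> A i" using c(2) by blast
      then show ?thesis using i(2) X_eq[OF i] dist_triangle3[of "c i" z "e i"] by (auto simp: A_def)
    qed
    show "(\<integral>\<^sup>+ z. h (X z) \<partial>\<mu>) = (\<Sum>i<P. ennreal (p i) * h (c i))" for h
    proof -
      have "(\<integral>\<^sup>+ z. h (X z) \<partial>\<mu>) = (\<integral>\<^sup>+ z. (\<Sum>i<P. h (c i) * indicator (A i) z) \<partial>\<mu>)"
      proof (rule nn_integral_cong_AE)
        show "AE z in \<mu>. h (X z) = (\<Sum>i<P. h (c i) * indicator (A i) z)"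
          using AE_E
        proof eventually_elim
          case (elim z)
          then obtain i where i: "i < P" "z \<in> A i" using A_cover by blast
          have "(\<Sum>j<P. h (c j) * indicator (A j) z) = (\<Sum>j<P. if j = i then h (c i) else 0)"
            using i A_unique by (intro sum.cong) (auto simp: indicator_def)
          then show ?case using i by (simp add: X_eq)
        qed
      qed
      also have "\<dots> = (\<Sum>i<P. \<integral>\<^sup>+ z. h (c i) * indicator (A i) z \<partial>\<mu>)" by (intro nn_integral_sum) auto
      also have "\<dots> = (\<Sum>i<P. ennreal (p i) * h (c i))"
        unfolding p by (intro sum.cong refl, subst nn_integral_cmult_indicator) (auto simp: sets mult.commute)
      finally show ?thesis .
    qed
    show "(\<Sum>i<P. ennreal (p i) * f (c i)) \<le> (\<integral>\<^sup>+ z. f z \<partial>\<mu>)"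
      unfolding split[OF f(1)] p by (intro sum_mono c(3)) simp
  qed (use c in \<open>auto simp: p_def\<close>)
qed

lemma add_mult_le_of_less:
  fixes C D s v :: real
  assumes "0 \<le> s" and le: "\<And>u. 0 \<le> u \<Longrightarrow> u = 0 \<or> u < v \<Longrightarrow> C + u * s \<le> D"
  shows "C + v * s \<le> D"
proof (rule field_le_epsilon)
  fix \<epsilon> :: real assume \<epsilon>: "0 < \<epsilon>"
  define u where "u = max 0 (v - \<epsilon> / (s + 1))"
  have "0 < \<epsilon> / (s + 1)" using \<epsilon> assms by simp
  then have "C + u * s \<le> D" by (intro le) (auto simp: u_def)
  moreover have "(v - \<epsilon> / (s + 1)) * s \<le> u * s" using assms by (intro mult_right_mono) (auto simp: u_def)
  moreover have "\<epsilon> / (s + 1) * s \<le> \<epsilon>" using assms \<epsilon> by (simp add: pos_divide_le_eq)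
  ultimately show "C + v * s \<le> D + \<epsilon>" by (simp add: left_diff_distrib)
qed

text \<open>
  An inequality for point masses extends to measures. Fatou's lemma shows that some discretisation
  of \<open>\<nu>\<close> has a potential above any \<open>T' < T\<close> on all of \<open>E\<close>: otherwise a sequence of points
  violating this would accumulate at a point where the potential of \<open>\<nu>\<close> is at most \<open>T'\<close>. The
  weights of the discretisation are then approximated by integer multiplicities, rounded up
  to keep the lower bound for the potential.
\<close>

lemma points_to_measure_inequality:
  fixes d :: "complex \<Rightarrow> real"
  assumes E: "compact E" "E \<subseteq> ball 0 1" and \<nu>: "\<nu> \<in> unit_borel_measures_on E"
    and d: "\<And>z. 0 \<le> d z" "f \<in> borel_measurable borel" "\<And>z. z \<in> E \<Longrightarrow> f z = ennreal (d z)"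
    and s: "0 \<le> s"
    and points: "\<And>(J :: (nat \<times> nat) set) a T. finite J \<Longrightarrow> a ` J \<subseteq> E \<Longrightarrow> 0 \<le> T \<Longrightarrow>
      (\<And>z. z \<in> E \<Longrightarrow> ennreal T \<le> (\<Sum>i\<in>J. green_disk z (a i))) \<Longrightarrow>
      real (card J) * C + T * s \<le> (\<Sum>i\<in>J. d (a i))"
    and T: "0 \<le> T" "\<And>z. z \<in> E \<Longrightarrow> ennreal T \<le> green_potential \<nu> z"
    and D: "(\<integral>\<^sup>+ z. f z \<partial>\<nu>) = ennreal D" "0 \<le> D"
  shows "C + T * s \<le> D"
proof -
  have key: "C + T' * s \<le> D" if T': "0 \<le> T'" "T' = 0 \<or> T' < T" for T'
  proof -
    have fin: "f z < \<infinity>" if "z \<in> E" for z using d(3)[OF that] by simp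
    define approx where "approx k P p c X \<longleftrightarrow> (\<forall>i<P. c i \<in> E) \<and> (\<forall>i. 0 \<le> p i) \<and> (\<Sum>i<P. p i) = 1
        \<and> X \<in> borel_measurable borel \<and> (\<forall>z\<in>E. dist (X z) z < 1 / real (Suc k))
        \<and> (\<forall>h. (\<integral>\<^sup>+ z. h (X z) \<partial>\<nu>) = (\<Sum>i<P. ennreal (p i) * h (c i)))
        \<and> (\<Sum>i<P. ennreal (p i) * f (c i)) \<le> (\<integral>\<^sup>+ z. f z \<partial>\<nu>)"
      for k P :: nat and p :: "nat \<Rightarrow> real" and c :: "nat \<Rightarrow> complex" and X :: "complex \<Rightarrow> complex"
    have "\<exists>P p c X. approx k P p c X" for k
    proof (rule ex_discretisation[OF \<nu> E(1) d(2) fin, of "1 / real (Suc k)"])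
      fix P :: nat and p :: "nat \<Rightarrow> real" and c X :: "_ \<Rightarrow> complex"
      assume *: "\<And>i. i < P \<Longrightarrow> c i \<in> E" "\<And>i. 0 \<le> p i" "(\<Sum>i<P. p i) = 1"
        "X \<in> borel_measurable borel" "\<And>z. z \<in> E \<Longrightarrow> dist (X z) z < 1 / real (Suc k)"
        "\<And>h. (\<integral>\<^sup>+ z. h (X z) \<partial>\<nu>) = (\<Sum>i<P. ennreal (p i) * h (c i))"
        "(\<Sum>i<P. ennreal (p i) * f (c i)) \<le> (\<integral>\<^sup>+ z. f z \<partial>\<nu>)"
      show ?thesis
        unfolding approx_def
        by (rule exI[of _ P], rule exI[of _ p], rule exI[of _ c], rule exI[of _ X])
          (intro conjI allI impI ballI; rule *; assumption)
    qed auto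
    then obtain P p c X where approx: "\<And>k. approx k (P k) (p k) (c k) (X k)" by metis
    then have c: "\<And>k i. i < P k \<Longrightarrow> c k i \<in> E" and p0: "\<And>k i. 0 \<le> p k i" and p1: "\<And>k. (\<Sum>i<P k. p k i) = 1"
      and Xm: "\<And>k. X k \<in> borel_measurable borel"
      and Xd: "\<And>k z. z \<in> E \<Longrightarrow> dist (X k z) z < 1 / real (Suc k)"
      and Xi: "\<And>k h. (\<integral>\<^sup>+ z. h (X k z) \<partial>\<nu>) = (\<Sum>i<P k. ennreal (p k i) * h (c k i))"
      and pf: "\<And>k. (\<Sum>i<P k. ennreal (p k i) * f (c k i)) \<le> (\<integral>\<^sup>+ z. f z \<partial>\<nu>)"
      unfolding approx_def by blast+
    have AE_E: "AE w in \<nu>. w \<in> E" using unit_borel_measures_on_AE[OF \<nu> borel_compact[OF E(1)]] .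
    have "\<exists>k. \<forall>z\<in>E. ennreal T' \<le> (\<Sum>i<P k. ennreal (p k i) * green_disk z (c k i))"
    proof (cases "T' = 0")
      case False
      then have lt: "T' < T" using T'(2) by simp
      show ?thesis
      proof (rule ccontr)
        assume "\<not> ?thesis"
        then have "\<forall>k. \<exists>z. z \<in> E \<and> (\<Sum>i<P k. ennreal (p k i) * green_disk z (c k i)) < ennreal T'"
          by (auto simp: not_le)
        then obtain z where z: "\<And>k. z k \<in> E"
          "\<And>k. (\<Sum>i<P k. ennreal (p k i) * green_disk (z k) (c k i)) < ennreal T'" by metis
        obtain l r where l: "l \<in> E" and r: "strict_mono r" "(z \<circ> r) \<longlonglongrightarrow> l"
          using E(1) z(1) unfolding compact_def by metis
        have l1: "cmod l < 1" using l E by auto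
        have "green_potential \<nu> l \<le> liminf (\<lambda>k. \<integral>\<^sup>+ w. green_disk ((z \<circ> r) k) (X (r k) w) \<partial>\<nu>)"
          unfolding green_potential_def
        proof (rule green_potential_fatou[OF _ r(2) l1])
          show "X (r k) \<in> borel_measurable \<nu>" for k
            using Xm unit_borel_measures_onD(1)[OF \<nu>] by (simp cong: measurable_cong_sets)
          show "AE w in \<nu>. (\<lambda>k. X (r k) w) \<longlonglongrightarrow> w"
            using AE_E
          proof eventually_elim
            case (elim w)
            have "(\<lambda>k. X k w) \<longlonglongrightarrow> w"
            proof (rule Lim_null_comparison[THEN LIM_zero_cancel])
              show "\<forall>\<^sub>F k in sequentially. norm (X k w - w) \<le> inverse (real (Suc k))"
                using Xd[OF elim] by (auto simp: dist_norm inverse_eq_divide intro!: always_eventually less_imp_le)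
              show "(\<lambda>k. inverse (real (Suc k))) \<longlonglongrightarrow> 0" by (rule LIMSEQ_inverse_real_of_nat)
            qed
            from LIMSEQ_subseq_LIMSEQ[OF this r(1)] show ?case by (simp add: o_def)
          qed
          show "AE w in \<nu>. cmod w < 1" using AE_E by eventually_elim (use E in auto)
        qed
        also have "\<dots> \<le> ennreal T'"
          using z(2) unfolding Xi by (intro Liminf_le always_eventually allI less_imp_le) (auto simp: o_def)
        finally have "ennreal T \<le> ennreal T'" using T(2)[OF l] by (rule order_trans[rotated])
        then show False using lt T' by (simp add: ennreal_le_iff)
      qed
    qed simp
    then obtain k where k: "\<And>z. z \<in> E \<Longrightarrow> ennreal T' \<le> (\<Sum>i<P k. ennreal (p k i) * green_disk z (c k i))"
      by blast
    define Q where "Q = (\<Sum>i<P k. d (c k i)) + real (P k) * \<bar>C\<bar>"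
    have lin: "real N * (C + T' * s - D) \<le> Q" for N :: nat
    proof -
      define n where "n i = nat \<lceil>real N * p k i\<rceil>" for i
      have n_ge: "real N * p k i \<le> real (n i)" and n_le: "real (n i) \<le> real N * p k i + 1" for i
        using p0[of k i] by (auto simp: n_def of_nat_nat intro: order_trans[OF of_int_ceiling_le_add_one])
      define J where "J = (SIGMA i:{..<P k}. {..<n i})"
      let ?a = "\<lambda>ij. c k (fst ij)"
      have J: "finite J" "?a ` J \<subseteq> E" using c by (auto simp: J_def)
      have cardJ: "real (card J) = (\<Sum>i<P k. real (n i))" by (simp add: J_def)
      have "ennreal (real N * T') \<le> (\<Sum>i\<in>J. green_disk z (?a i))" if "z \<in> E" for z
      proof -
        have "ennreal (real N * T') = ennreal (real N) * ennreal T'" by (simp add: ennreal_mult T')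
        also have "\<dots> \<le> ennreal (real N) * (\<Sum>i<P k. ennreal (p k i) * green_disk z (c k i))"
          using k[OF that] by (intro mult_left_mono) auto
        also have "\<dots> = (\<Sum>i<P k. ennreal (real N * p k i) * green_disk z (c k i))"
          using p0 by (simp add: sum_distrib_left ennreal_mult mult.assoc)
        also have "\<dots> \<le> (\<Sum>i<P k. ennreal (real (n i)) * green_disk z (c k i))"
          using n_ge by (intro sum_mono mult_right_mono ennreal_leI) auto
        also have "\<dots> = (\<Sum>i<P k. \<Sum>j<n i. green_disk z (c k i))"
          by (simp add: ennreal_of_nat_eq_real_of_nat)
        also have "\<dots> = (\<Sum>i\<in>J. green_disk z (?a i))"
          unfolding J_def by (subst sum.Sigma) (simp_all add: case_prod_unfold)
        finally show ?thesis .
      qed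
      then have 1: "real (card J) * C + real N * T' * s \<le> (\<Sum>i\<in>J. d (?a i))"
        using points[OF J, of "real N * T'"] T' by simp
      have 2: "(\<Sum>i\<in>J. d (?a i)) \<le> real N * D + (\<Sum>i<P k. d (c k i))"
      proof -
        have "(\<Sum>i<P k. ennreal (p k i) * f (c k i)) = ennreal (\<Sum>i<P k. p k i * d (c k i))"
        proof -
          have "(\<Sum>i<P k. ennreal (p k i) * f (c k i)) = (\<Sum>i<P k. ennreal (p k i * d (c k i)))"
            using c p0 d by (intro sum.cong) (auto simp: ennreal_mult)
          also have "\<dots> = ennreal (\<Sum>i<P k. p k i * d (c k i))"
            using p0 d by (intro sum_ennreal) auto
          finally show ?thesis .
        qed
        then have pd: "(\<Sum>i<P k. p k i * d (c k i)) \<le> D"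
          using pf[of k] D by (simp add: ennreal_le_iff)
        have "(\<Sum>i\<in>J. d (?a i)) = (\<Sum>i<P k. \<Sum>j<n i. d (c k i))"
          unfolding J_def by (subst sum.Sigma) (simp_all add: case_prod_unfold)
        also have "\<dots> = (\<Sum>i<P k. real (n i) * d (c k i))" by simp
        also have "\<dots> \<le> (\<Sum>i<P k. (real N * p k i + 1) * d (c k i))"
          using n_le d by (intro sum_mono mult_right_mono) auto
        also have "\<dots> = real N * (\<Sum>i<P k. p k i * d (c k i)) + (\<Sum>i<P k. d (c k i))"
          by (simp add: distrib_right sum.distrib sum_distrib_left mult.assoc)
        also have "\<dots> \<le> real N * D + (\<Sum>i<P k. d (c k i))"
          using pd by (intro add_right_mono mult_left_mono) auto
        finally show ?thesis .
      qed
      have 3: "real N * C - real (P k) * \<bar>C\<bar> \<le> real (card J) * C"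
      proof -
        have "real N = (\<Sum>i<P k. real N * p k i)" using p1[of k] by (simp flip: sum_distrib_left)
        moreover have "(\<Sum>i<P k. real N * p k i) \<le> (\<Sum>i<P k. real (n i))" by (intro sum_mono n_ge)
        moreover have "(\<Sum>i<P k. real (n i)) \<le> (\<Sum>i<P k. real N * p k i + 1)" by (intro sum_mono n_le)
        moreover have "(\<Sum>i<P k. real N * p k i + 1) = (\<Sum>i<P k. real N * p k i) + real (P k)"
          by (simp add: sum.distrib)
        ultimately have "\<bar>real N - real (card J)\<bar> \<le> real (P k)" unfolding cardJ by linarith
        then have "\<bar>real N - real (card J)\<bar> * \<bar>C\<bar> \<le> real (P k) * \<bar>C\<bar>" by (intro mult_right_mono) auto
        then have "(real N - real (card J)) * C \<le> real (P k) * \<bar>C\<bar>"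
          using abs_ge_self[of "(real N - real (card J)) * C"] by (simp add: abs_mult)
        then show ?thesis by (simp add: left_diff_distrib)
      qed
      have "real N * (C + T' * s - D) = real N * C + real N * T' * s - real N * D" by (simp add: algebra_simps)
      then show ?thesis using 1 2 3 unfolding Q_def by linarith
    qed
    show "C + T' * s \<le> D"
    proof (rule ccontr)
      assume "\<not> ?thesis"
      then have pos: "0 < C + T' * s - D" by simp
      obtain N :: nat where "Q < real N * (C + T' * s - D)" using reals_Archimedean3[OF pos] by blast
      with lin[of N] show False by simp
    qed
  qed
  show ?thesis by (rule add_mult_le_of_less[OF s key])
qed

text \<open>
  Products of single Blaschke factors turn the inequality for Blaschke products into one for
  points, because their norms on \<open>E\<close> are the values of \<open>exp (- inf_green E w)\<close> at their zeros \<open>w\<close>.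
\<close>

lemma blaschke_factors_inequality:
  assumes E: "infinite E" "E \<subseteq> ball 0 1"
    and all: "\<And>(m::nat) (n :: nat \<Rightarrow> nat) (B :: nat \<Rightarrow> complex \<Rightarrow> complex).
      (\<forall>k\<in>{1..m}. finite_blaschke (n k) (B k)) \<Longrightarrow>
      (\<Prod>k=1..m. sup_norm_on E (B k))
        \<le> exp (- (real (\<Sum>k=1..m. n k) * C)) * sup_norm_on E (\<lambda>z. \<Prod>k=1..m. B k z) powr s"
    and s: "0 \<le> s"
    and J: "finite J" "a ` J \<subseteq> E" and T: "0 \<le> T"
    and le: "\<And>z. z \<in> E \<Longrightarrow> ennreal T \<le> (\<Sum>i\<in>J. green_disk z (a i))"
  shows "real (card J) * C + T * s \<le> (\<Sum>i\<in>J. enn2real (inf_green E (a i)))"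
proof -
  have E0: "E \<noteq> {}" using E by auto
  have E1: "cmod z < 1" if "z \<in> E" for z using that E by auto
  obtain e where e: "bij_betw e {1..card J} J" using ex_bij_betw_nat_finite_1[OF J(1)] by blast
  define B where "B k z = (z - a (e k)) / (1 - cnj (a (e k)) * z)" for k z
  let ?P = "\<lambda>z. \<Prod>k=1..card J. B k z"
  have ek: "e k \<in> J" if "k \<in> {1..card J}" for k using e that by (auto simp: bij_betw_def)
  have aE: "a i \<in> E" if "i \<in> J" for i using J that by auto
  have Bn: "cmod (B k z) = pseudo_dist z (a (e k))" for k z by (simp add: B_def pseudo_dist_def)
  have "\<forall>k\<in>{1..card J}. finite_blaschke 1 (B k)"
    unfolding B_def[abs_def] using ek aE E1 by (intro ballI finite_blaschke_factor) auto
  from all[OF this] have main: "(\<Prod>k=1..card J. sup_norm_on E (B k))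
      \<le> exp (- (real (card J) * C)) * sup_norm_on E ?P powr s" by simp
  have single: "exp (- enn2real (inf_green E w)) \<le> sup_norm_on E f"
    if w: "cmod w < 1" and f: "\<And>z. cmod (f z) = pseudo_dist z w" for f w
  proof -
    let ?S = "sup_norm_on E f"
    have up: "pseudo_dist z w \<le> ?S" if "z \<in> E" for z
      using sup_norm_on_upper[OF that, of f 1] E1 w by (auto simp: f intro!: less_imp_le[OF pseudo_dist_less_1])
    obtain z where z: "z \<in> E" "z \<noteq> w"
      using E(1) by (metis finite.emptyI finite.insertI finite_subset insertI1 subsetI)
    have "0 < pseudo_dist z w" using z E1[OF z(1)] w pseudo_dist_eq_0_iff[of z w] by (simp add: less_le)
    then have S0: "0 < ?S" using up[OF z(1)] by linarith
    have S1: "?S \<le> 1"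
      using E0 E1 w by (intro sup_norm_on_least) (auto simp: f intro!: less_imp_le[OF pseudo_dist_less_1])
    have "ennreal (- ln ?S) \<le> inf_green E w"
      unfolding inf_green_def
    proof (rule INF_greatest)
      fix z assume z: "z \<in> E"
      have "ennreal (- ln ?S) \<le> green_disk z w"
        using prod_pseudo_dist_le_iff[of "{()}" "\<lambda>_. w" z ?S] up[OF z] E1[OF z] w S0 S1 by simp
      then show "ennreal (- ln ?S) \<le> green_disk w z" using E1[OF z] w by (simp add: green_disk_commute)
    qed
    moreover have "inf_green E w = ennreal (enn2real (inf_green E w))"
      using inf_green_finite[OF E w] by simp
    ultimately have "- ln ?S \<le> enn2real (inf_green E w)" by (metis enn2real_nonneg ennreal_le_iff)
    then have "exp (- enn2real (inf_green E w)) \<le> exp (ln ?S)" by simp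
    then show ?thesis using S0 by simp
  qed
  have reindex: "(\<Prod>k=1..card J. g (e k)) = (\<Prod>i\<in>J. g i)" for g :: "_ \<Rightarrow> real"
    using e by (rule prod.reindex_bij_betw)
  have "exp (- (\<Sum>i\<in>J. enn2real (inf_green E (a i)))) = (\<Prod>i\<in>J. exp (- enn2real (inf_green E (a i))))"
    using J by (simp add: exp_sum flip: sum_negf)
  also have "\<dots> = (\<Prod>k=1..card J. exp (- enn2real (inf_green E (a (e k)))))"
    by (rule reindex[symmetric])
  also have "\<dots> \<le> (\<Prod>k=1..card J. sup_norm_on E (B k))"
    using ek aE E1 by (intro prod_mono conjI single) (auto simp: Bn)
  also have "\<dots> \<le> exp (- (real (card J) * C)) * sup_norm_on E ?P powr s"
    by (rule main)
  also have "\<dots> \<le> exp (- (real (card J) * C)) * exp (- T) powr s"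
  proof (intro mult_left_mono powr_mono2)
    have P: "cmod (?P z) = (\<Prod>i\<in>J. pseudo_dist z (a i))" for z
      using reindex[of "\<lambda>i. pseudo_dist z (a i)"] by (simp add: Bn flip: prod_norm)
    have le': "cmod (?P z) \<le> exp (- T)" if "z \<in> E" for z
      unfolding P using le[OF that] T J E E1[OF that]
      by (subst prod_pseudo_dist_le_iff) auto
    show "sup_norm_on E ?P \<le> exp (- T)"
      using E0 le' by (rule sup_norm_on_least)
    obtain z where "z \<in> E" using E0 by blast
    then have "cmod (?P z) \<le> sup_norm_on E ?P"
      using le' by (rule sup_norm_on_upper)
    then show "0 \<le> sup_norm_on E ?P" using norm_ge_zero order_trans by blast
  qed (use s in auto)
  also have "\<dots> = exp (- (real (card J) * C) - T * s)"
    by (simp add: powr_def exp_add[symmetric] mult.commute)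
  finally show ?thesis by simp
qed

text \<open>
  The equilibrium potential may drop below the minimal energy on an exceptional part of \<open>E\<close>. The
  set \<open>S\<close> where it is at most \<open>u\<close>, below that energy, carries no measure of finite
  energy, so a small multiple of a measure with large potential on \<open>S\<close> repairs the defect.
\<close>

lemma green_constant_sharp:
  assumes eq: "green_equilibrium_measure E \<mu>" and E: "compact E" "E \<subseteq> ball 0 1"
    and V: "min_green_energy E < \<infinity>"
    and \<sigma>: "inf_green_riesz_measure E \<sigma>"
    and all: "\<And>(m::nat) (n :: nat \<Rightarrow> nat) (B :: nat \<Rightarrow> complex \<Rightarrow> complex).
      (\<forall>k\<in>{1..m}. finite_blaschke (n k) (B k)) \<Longrightarrow>
      (\<Prod>k=1..m. sup_norm_on E (B k))
        \<le> exp (- (real (\<Sum>k=1..m. n k) * C))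
          * sup_norm_on E (\<lambda>z. \<Prod>k=1..m. B k z) powr measure \<sigma> (ball 0 1)"
  shows "C \<le> green_constant E \<mu> \<sigma>"
proof -
  let ?s = "measure \<sigma> (ball 0 1)"
  let ?\<tau> = "riesz_on_plane \<sigma>"
  define f where "f = green_potential ?\<tau>"
  define d where "d z = enn2real (inf_green E z)" for z
  note \<tau>' = nn_integral_inf_green[OF eq E V \<sigma>]
  interpret t: finite_measure ?\<tau> by (rule \<tau>'(5))
  have inf: "infinite E" using green_equilibrium_infinite[OF eq E V] .
  have E1: "cmod z < 1" if "z \<in> E" for z using that E by auto
  have Eb: "E \<in> sets borel" using E by (simp add: borel_compact)
  have \<mu>: "\<mu> \<in> unit_borel_measures_on E" using eq by (simp add: green_equilibrium_measure_def)
  obtain v where v: "min_green_energy E = ennreal v" "0 \<le> v" using V by (cases "min_green_energy E") auto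
  have f: "f \<in> borel_measurable borel" unfolding f_def
    using riesz_on_plane(1)[OF \<sigma>] t.sigma_finite_measure_axioms by (rule green_potential_measurable)
  have f_inf: "f z = inf_green E z" if "cmod z < 1" for z using that riesz_on_plane(4)[OF \<sigma>] by (simp add: f_def)
  have fd: "f z = ennreal (d z)" if "z \<in> E" for z
    using f_inf[OF E1[OF that]] inf_green_finite[OF inf E(2) E1[OF that]] by (simp add: d_def)
  have to_f: "(\<integral>\<^sup>+ z. f z \<partial>\<nu>) = (\<integral>\<^sup>+ z. inf_green E z \<partial>\<nu>)" if "\<nu> \<in> unit_borel_measures_on E" for \<nu>
    using unit_borel_measures_on_AE_disk[OF that E]
    by (intro nn_integral_cong_AE, eventually_elim) (rule f_inf)
  obtain D where D: "(\<integral>\<^sup>+ z. f z \<partial>\<mu>) = ennreal D" "0 \<le> D"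
    unfolding to_f[OF \<mu>] using \<tau>'(3) by (cases "\<integral>\<^sup>+ z. inf_green E z \<partial>\<mu>") auto
  have const: "green_constant E \<mu> \<sigma> = D - v * ?s"
    unfolding green_constant_def \<tau>'(1) to_f[OF \<mu>, symmetric] D(1) v(1) using D v by simp
  have measure_ineq: "C + T * ?s \<le> D'"
    if "\<nu> \<in> unit_borel_measures_on E" "0 \<le> T" "\<And>z. z \<in> E \<Longrightarrow> ennreal T \<le> green_potential \<nu> z"
      "(\<integral>\<^sup>+ z. f z \<partial>\<nu>) = ennreal D'" "0 \<le> D'" for \<nu> T D'
  proof (rule points_to_measure_inequality[OF E that(1) _ f fd])
    show "real (card J) * C + T * ?s \<le> (\<Sum>i\<in>J. d (a i))"
      if "finite J" "a ` J \<subseteq> E" "0 \<le> T" "\<And>z. z \<in> E \<Longrightarrow> ennreal T \<le> (\<Sum>i\<in>J. green_disk z (a i))"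
      for J :: "(nat \<times> nat) set" and a T
      unfolding d_def by (rule blaschke_factors_inequality[OF inf E(2) all]) (use that in auto)
  qed (use that in \<open>auto simp: d_def\<close>)
  have sub: "C + u * ?s \<le> D" if u: "0 \<le> u" "u < v" for u
  proof -
    define S where "S = {z \<in> E. green_potential \<mu> z \<le> ennreal u}"
    have clS: "closed S" unfolding S_def
      using unit_borel_measures_onD(1)[OF \<mu>] unit_borel_measures_on_AE_disk[OF \<mu> E] E compact_imp_closed
      by (intro closed_green_potential_le) auto
    have SE: "S \<subseteq> E" by (auto simp: S_def)
    have S: "compact S" "S \<subseteq> ball 0 1"
      using clS SE E compact_Int_closed[of E S] by (auto simp: Int_absorb1)
    have Sb: "S \<in> sets borel" using clS by simp
    have off: "ennreal u \<le> green_potential \<mu> z" if "z \<in> E" "z \<notin> S" for z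
      using that by (auto simp: S_def)
    show ?thesis
    proof (cases "S = {}")
      case True
      then show ?thesis using u D off by (intro measure_ineq[OF \<mu>]) auto
    next
      case False
      have S_inf: "green_energy \<nu> = \<infinity>" if \<nu>: "\<nu> \<in> unit_borel_measures_on S" for \<nu>
      proof (rule ccontr)
        assume "green_energy \<nu> \<noteq> \<infinity>"
        then have fin: "green_energy \<nu> < \<infinity>" by (simp add: less_top)
        interpret prob_space \<nu> using unit_borel_measures_onD(2)[OF \<nu>] .
        have "ennreal v \<le> (\<integral>\<^sup>+ z. green_potential \<mu> z \<partial>\<nu>)"
          unfolding v(1)[symmetric]
          using unit_borel_measures_on_mono[OF \<nu> SE Sb Eb] fin
          by (intro green_equilibrium_variation[OF eq E V])
        also have "\<dots> \<le> (\<integral>\<^sup>+ z. ennreal u \<partial>\<nu>)"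
          using unit_borel_measures_on_AE[OF \<nu> Sb]
          by (intro nn_integral_mono_AE, eventually_elim) (simp add: S_def)
        also have "\<dots> = ennreal u" by (simp add: emeasure_space_1)
        finally show False using u by (simp add: ennreal_le_iff)
      qed
      \<comment> \<open>Every point stays away from one of two distinct points of \<open>E\<close>, which bounds
          \<^term>\<open>inf_green E\<close>.\<close>
      obtain M where M: "0 \<le> M" "\<And>z. z \<in> E \<Longrightarrow> f z \<le> ennreal M"
      proof -
        obtain z1 where z1: "z1 \<in> E" using inf by (metis finite.emptyI ex_in_conv)
        obtain z2 where z2: "z2 \<in> E" "z2 \<noteq> z1"
          using inf by (metis finite.emptyI finite.insertI finite_subset insertI1 subsetI)
        define \<eta> where "\<eta> = dist z1 z2 / 2"
        have \<eta>: "0 < \<eta>" using z2 by (simp add: \<eta>_def)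
        have b: "f z \<le> ennreal (ln (2 / \<eta>))" if z: "z \<in> E" for z
        proof -
          have "\<eta> \<le> dist z z1 \<or> \<eta> \<le> dist z z2"
            using dist_triangle3[of z1 z2 z] unfolding \<eta>_def by linarith
          then obtain y where y: "y \<in> E" "\<eta> \<le> dist z y" using z1 z2 by auto
          have "f z \<le> green_disk z y" unfolding f_inf[OF E1[OF z]] using y by (intro inf_green_le)
          also have "\<dots> \<le> ennreal (ln (2 / \<eta>))"
            using y \<eta> E1[OF z] E1[OF y(1)] by (intro green_disk_le) (auto simp: dist_norm)
          finally show ?thesis .
        qed
        show ?thesis
          by (rule that[of "max 0 (ln (2 / \<eta>))"]) (use b in \<open>auto intro: order_trans ennreal_leI\<close>)
      qed
      show ?thesis
      proof (rule field_le_epsilon)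
        fix \<epsilon> :: real assume \<epsilon>: "0 < \<epsilon>"
        define \<delta> where "\<delta> = min (1 / 2) (\<epsilon> / (M + u * ?s + 1))"
        have den: "0 < M + u * ?s + 1" using M u by (intro add_nonneg_pos add_nonneg_nonneg mult_nonneg_nonneg) auto
        have \<delta>: "0 < \<delta>" "\<delta> \<le> 1" using \<epsilon> den by (auto simp: \<delta>_def)
        have \<delta>2: "\<delta> * (M + u * ?s) \<le> \<epsilon>"
        proof -
          have "\<delta> * (M + u * ?s) \<le> \<delta> * (M + u * ?s + 1)" using \<delta> by (intro mult_left_mono) auto
          also have "\<dots> \<le> \<epsilon> / (M + u * ?s + 1) * (M + u * ?s + 1)"
            using den by (intro mult_right_mono) (auto simp: \<delta>_def)
          also have "\<dots> = \<epsilon>" using den by simp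
          finally show ?thesis .
        qed
        have "0 \<le> u / \<delta>" using u \<delta> by simp
        then obtain \<tau> where \<tau>: "\<tau> \<in> unit_borel_measures_on S" "\<And>z. z \<in> S \<Longrightarrow> ennreal (u / \<delta>) \<le> green_potential \<tau> z"
          using ex_measure_large_potential[OF S False _ S_inf, of "u / \<delta>"] by blast
        have \<tau>E: "\<tau> \<in> unit_borel_measures_on E" using unit_borel_measures_on_mono[OF \<tau>(1) SE Sb Eb] .
        interpret ta: prob_space \<tau> using unit_borel_measures_onD(2)[OF \<tau>E] .
        obtain \<kappa> where \<kappa>: "\<kappa> \<in> unit_borel_measures_on E" and
          int\<kappa>: "\<And>h. h \<in> borel_measurable borel \<Longrightarrow>
            (\<integral>\<^sup>+ z. h z \<partial>\<kappa>) = ennreal (1 - \<delta>) * (\<integral>\<^sup>+ z. h z \<partial>\<mu>) + ennreal \<delta> * (\<integral>\<^sup>+ z. h z \<partial>\<tau>)"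
          using ex_mixture[OF \<mu> \<tau>E Eb, of \<delta>] \<delta> by auto
        have pot: "green_potential \<kappa> z = ennreal (1 - \<delta>) * green_potential \<mu> z + ennreal \<delta> * green_potential \<tau> z" for z
          unfolding green_potential_def by (rule int\<kappa>) measurable
        have low: "ennreal ((1 - \<delta>) * u) \<le> green_potential \<kappa> z" if z: "z \<in> E" for z
        proof (cases "z \<in> S")
          case True
          have "ennreal ((1 - \<delta>) * u) \<le> ennreal (\<delta> * (u / \<delta>))"
            using \<delta> u by (intro ennreal_leI) (simp add: mult_left_le_one_le)
          also have "\<dots> = ennreal \<delta> * ennreal (u / \<delta>)" using \<delta> u by (intro ennreal_mult) auto
          also have "\<dots> \<le> ennreal \<delta> * green_potential \<tau> z" using \<tau>(2)[OF True] by (intro mult_left_mono) auto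
          also have "\<dots> \<le> green_potential \<kappa> z" unfolding pot by simp
          finally show ?thesis .
        next
          case False
          have "ennreal ((1 - \<delta>) * u) = ennreal (1 - \<delta>) * ennreal u" using \<delta> u by (intro ennreal_mult) auto
          also have "\<dots> \<le> ennreal (1 - \<delta>) * green_potential \<mu> z" using off[OF z False] by (intro mult_left_mono) auto
          also have "\<dots> \<le> green_potential \<kappa> z" unfolding pot by simp
          finally show ?thesis .
        qed
        have "(\<integral>\<^sup>+ z. f z \<partial>\<tau>) \<le> (\<integral>\<^sup>+ z. ennreal M \<partial>\<tau>)"
          using unit_borel_measures_on_AE[OF \<tau>E Eb] by (intro nn_integral_mono_AE, eventually_elim) (rule M(2))
        also have "\<dots> = ennreal M" by (simp add: ta.emeasure_space_1)
        finally have f\<tau>: "(\<integral>\<^sup>+ z. f z \<partial>\<tau>) \<le> ennreal M" .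
        have "(\<integral>\<^sup>+ z. f z \<partial>\<kappa>) \<le> ennreal (1 - \<delta>) * ennreal D + ennreal \<delta> * ennreal M"
          unfolding int\<kappa>[OF f] D(1) using f\<tau> by (intro add_left_mono mult_left_mono) auto
        also have "\<dots> = ennreal ((1 - \<delta>) * D + \<delta> * M)"
          using \<delta> D M by (simp add: ennreal_mult)
        finally have f\<kappa>: "(\<integral>\<^sup>+ z. f z \<partial>\<kappa>) \<le> ennreal ((1 - \<delta>) * D + \<delta> * M)" .
        obtain D' where D': "(\<integral>\<^sup>+ z. f z \<partial>\<kappa>) = ennreal D'" "0 \<le> D'"
          using f\<kappa> by (cases "\<integral>\<^sup>+ z. f z \<partial>\<kappa>") (auto simp: top_unique)
        have "D' \<le> (1 - \<delta>) * D + \<delta> * M"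
          using f\<kappa> D' \<delta> D M by (subst (asm) D'(1), subst (asm) ennreal_le_iff) auto
        also have "\<dots> \<le> D + \<delta> * M" using \<delta> D by (simp add: mult_left_le_one_le)
        finally have D'_le: "D' \<le> D + \<delta> * M" .
        have "C + (1 - \<delta>) * u * ?s \<le> D'"
          using measure_ineq[OF \<kappa> _ low D'] \<delta> u by simp
        then have "C + u * ?s \<le> D + \<delta> * (M + u * ?s)"
          using D'_le by (simp add: algebra_simps)
        then show "C + u * ?s \<le> D + \<epsilon>" using \<delta>2 by linarith
      qed
    qed
  qed
  have "C + v * ?s \<le> D"
  proof (rule add_mult_le_of_less)
    show "C + u * ?s \<le> D" if "0 \<le> u" "u = 0 \<or> u < v" for u
      using that sub[of u] measure_ineq[OF \<mu> _ _ D, of 0] by auto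
  qed simp
  then show ?thesis unfolding const by simp
qed

theorem theorem2p1:
  fixes E :: "complex set" and \<mu> \<sigma> :: "complex measure"
  assumes "compact E" and "E \<subseteq> ball 0 1" and "log_capacity E > 0"
    and "green_equilibrium_measure E \<mu>"
    and "inf_green_riesz_measure E \<sigma>"
  shows "(\<forall>(m::nat) (n :: nat \<Rightarrow> nat) (B :: nat \<Rightarrow> complex \<Rightarrow> complex).
            (\<forall>k\<in>{1..m}. finite_blaschke (n k) (B k)) \<longrightarrow>
            (\<Prod>k=1..m. sup_norm_on E (B k))
              \<le> exp (- (real (\<Sum>k=1..m. n k) * green_constant E \<mu> \<sigma>))
                * sup_norm_on E (\<lambda>z. \<Prod>k=1..m. B k z) powr measure \<sigma> (ball 0 1))
       \<and> \<not> (\<exists>C > green_constant E \<mu> \<sigma>.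
            \<forall>(m::nat) (n :: nat \<Rightarrow> nat) (B :: nat \<Rightarrow> complex \<Rightarrow> complex).
              (\<forall>k\<in>{1..m}. finite_blaschke (n k) (B k)) \<longrightarrow>
              (\<Prod>k=1..m. sup_norm_on E (B k))
                \<le> exp (- (real (\<Sum>k=1..m. n k) * C))
                  * sup_norm_on E (\<lambda>z. \<Prod>k=1..m. B k z) powr measure \<sigma> (ball 0 1))"
proof (intro conjI allI impI notI, goal_cases)
  case (1 m n B)
  then show ?case
    by (rule blaschke_product_inequality[OF assms(4,1,2) min_green_energy_finite[OF assms(1-3)] assms(5)])
next
  case 2
  then show ?case
  proof (elim exE conjE, goal_cases)
    case (1 C)
    have "C \<le> green_constant E \<mu> \<sigma>"
      by (rule green_constant_sharp[OF assms(4,1,2) min_green_energy_finite[OF assms(1-3)] assms(5)])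
        (use 1(2) in blast)
    with 1(1) show False by simp
  qed
qed

end
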